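(* Let $1<p<\infty$, $\max\{1,p-1\}\le q<\infty$ and $\lambda\ge1$. Assume that $|F|\in L^{q}_{\mathrm{loc}}(\Omega_T)$ and that $u\in L^q_{\mathrm{loc}}(0,T;W^{1,q}_{\mathrm{loc}}(\Omega;\mathbb{R}^N))$ satisfies $$\iint_{\Omega_T}\bigl(-u\cdot\varphi_t+\mathcal{A}(z,\nabla u)\cdot\nabla\varphi\bigr)\,dz=\iint_{\Omega_T}|F|^{p-2}F\cdot\nabla\varphi\,dz$$ for every $\varphi\in C_0^\infty(\Omega_T;\mathbb{R}^N)$, and that there exist a parabolic cylinder $Q=Q^\lambda_\rho\Subset\Omega_T$ and a constant $\gamma>1$ such that $$\gamma^{-1}\lambda\le\left(\frac1{|Q|}\iint_Q(|\nabla u|+|F|)^q\,dz\right)^{\frac1q}\le\lambda.$$ (i) If $2<p<\infty$ and $p-1\le q<n+p$, then for $q\le q^*<\frac{q(n+2)}{n+p-q}$ there exists a constant $c=c(n,p,q,q^*,L,\gamma)$ such that $$\left(\frac1{|Q|}\iint_{Q}\frac{|u-u_{Q}|^{q^*}}{\rho^{q^*}}\,dz\right)^{\frac1{q^*}}\le c\left(\frac1{|Q|}\iint_{Q}(|\nabla u|+|F|)^q\,dz\right)^{\frac1q}.$$ If $1<p<2$ and $\max\bigl\{1,\frac{(2-p)n}{2}\bigr\}<q<n+p$, then the estimate above holds for $q\le q^*<\frac{q(n+2)}{n+p-q}$. (ii) If $2<p<\infty$ and $q=n+p$, then there exists a constant $c=c(n,p,L,\gamma)$ such that $$\frac1{|Q|}\iint_Q\exp\left(\left(\frac{|u-u_{Q}|}{c\rho\left(\frac1{|Q|}\iint_{Q}(|\nabla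 u|+|F|)^{n+p}\,dz\right)^{\frac1{n+p}}}\right)^{\frac{n+2}{n+p}}\right)dz\le c.$$ If $1<p<2$ and $q=n+p$, then there exists a constant $c=c(n,p,L,\gamma)$ such that $$\frac1{|Q|}\iint_Q\exp\left(\frac{|u-u_{Q}|}{c\rho\left(\frac1{|Q|}\iint_{Q}(|\nabla u|+|F|)^{n+p}\,dz\right)^{\frac1{n+p}}}\right)dz\le c.$$ (iii) If $q>n+p$, then there exists a constant $c=c(n,p,q,L,\gamma)$ such that $$\operatorname*{ess\,sup}_Q\frac{|u-u_{Q}|}{\rho}\le c\left(\frac1{|Q|}\iint_{Q}(|\nabla u|+|F|)^q\,dz\right)^{\frac1q}.$$
   Context: $\Omega\subset\mathbb{R}^n$, $n\ge1$, is a bounded open domain, $T>0$, $\Omega_T=\Omega\times(0,T)$, $N\ge1$, $0<\nu<L<\infty$. $\mathcal{A}:\Omega_T\times\mathbb{R}^{Nn}\to\mathbb{R}^{Nn}$ is a Carathéodory vector field ($\mathcal{A}(\cdot,\xi)$ measurable for every $\xi$, $\mathcal{A}(z,\cdot)$ continuous for a.e. $z$) with $\nu|\xi|^p\le\mathcal{A}(z,\xi)\cdot\xi$ and $|\mathcal{A}(z,\xi)|\le L|\xi|^{p-1}$ for a.e. $z\in\Omega_T$ and every $\xi\in\mathbb{R}^{Nn}$. $F:\Omega_T\to\mathbb{R}^{Nn}$ is measurable. We write $z=(x,t)$, $dz=dx\,dt$, and $\nabla$ is the gradient in $x$. $u\in L^q_{\mathrm{loc}}(0,T;W^{1,q}_{\mathrm{loc}}(\Omega;\mathbb{R}^N))$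 means that for all $\Omega'\Subset\Omega$ and $0<t_1<t_2<T$ one has $u(\cdot,t)\in W^{1,q}(\Omega';\mathbb{R}^N)$ for a.e. $t\in(t_1,t_2)$ and $\int_{t_1}^{t_2}\int_{\Omega'}(|u|^q+|\nabla u|^q)\,dx\,dt<\infty$. The (intrinsic) parabolic cylinder of radius $\rho>0$ with scaling factor $\lambda>0$ centered at $(x_0,t_0)$ is $Q^\lambda_\rho=B_\rho(x_0)\times(t_0-\lambda^{2-p}\rho^2,t_0+\lambda^{2-p}\rho^2)$. $u_Q=\frac1{|Q|}\iint_Q u\,dz$ (componentwise). $Q\Subset\Omega_T$ means that the closure of $Q$ is a compact subset of $\Omega_T$. *)

theory Defs
  imports "HOL-Analysis.Analysis" "HOL-Probability.Essential_Supremum"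
begin

text \<open>
  The constants in the theorem do not depend on the number \<open>N\<close> of equations, so \<open>N\<close> has to be a
  quantified natural number rather than the size of an index type. The space \<open>V\<^sup>N\<close> is represented by
  the sequences in \<open>V\<close> that vanish from index \<open>N\<close> on: \<open>V = real\<close> gives the space of the values of \<open>u\<close>,
  and \<open>V = real^'n\<close> gives the space of \<open>N \<times> n\<close> matrices (row \<open>i\<close> of \<open>\<nabla>u\<close> is the gradient of \<open>u\<^sub>i\<close>).
  As a subspace of the product space \<open>nat \<Rightarrow> V\<close>, it carries the usual topology of \<open>V\<^sup>N\<close>.
\<close>

definition vecs :: "nat \<Rightarrow> (nat \<Rightarrow> 'v::real_inner) set" where
  "vecs N = {v. \<forall>i\<ge>N. v i = 0}"

definition vnorm :: "nat \<Rightarrow> (nat \<Rightarrow> 'v::real_inner) \<Rightarrow> real" where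
  "vnorm N v = L2_set (\<lambda>i. norm (v i)) {..<N}"

definition vinner :: "nat \<Rightarrow> (nat \<Rightarrow> 'v::real_inner) \<Rightarrow> (nat \<Rightarrow> 'v) \<Rightarrow> real" where
  "vinner N v w = (\<Sum>i<N. v i \<bullet> w i)"

definition vmeasurable :: "nat \<Rightarrow> 'a::euclidean_space set \<Rightarrow> ('a \<Rightarrow> nat \<Rightarrow> 'v::real_inner) \<Rightarrow> bool" where
  "vmeasurable N S f \<longleftrightarrow> (\<forall>i<N. (\<lambda>x. f x i) \<in> borel_measurable (lebesgue_on S))"

definition Lq_on :: "real \<Rightarrow> nat \<Rightarrow> 'a::euclidean_space set \<Rightarrow> ('a \<Rightarrow> nat \<Rightarrow> 'v::real_inner) \<Rightarrow> bool" where
  "Lq_on q N S f \<longleftrightarrow>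
     vmeasurable N S f \<and> integrable (lebesgue_on S) (\<lambda>x. vnorm N (f x) powr q)"

definition Lq_loc :: "real \<Rightarrow> nat \<Rightarrow> 'a::euclidean_space set \<Rightarrow> ('a \<Rightarrow> nat \<Rightarrow> 'v::real_inner) \<Rightarrow> bool" where
  "Lq_loc q N S f \<longleftrightarrow> (\<forall>K. compact K \<and> K \<subseteq> S \<longrightarrow> Lq_on q N K f)"

definition average :: "'a::euclidean_space set \<Rightarrow> ('a \<Rightarrow> real) \<Rightarrow> real" where
  "average S f = (LINT x|lebesgue_on S. f x) / measure lebesgue S"

definition vaverage :: "'a::euclidean_space set \<Rightarrow> ('a \<Rightarrow> nat \<Rightarrow> real) \<Rightarrow> (nat \<Rightarrow> real)" where
  "vaverage S f = (\<lambda>i. average S (\<lambda>x. f x i))"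

definition compactly_inside :: "'a::euclidean_space set \<Rightarrow> 'a set \<Rightarrow> bool" where
  "compactly_inside A B \<longleftrightarrow> compact (closure A) \<and> closure A \<subseteq> B"

primrec C_k :: "nat \<Rightarrow> ('a::euclidean_space \<Rightarrow> real) \<Rightarrow> bool" where
  "C_k 0 f \<longleftrightarrow> continuous_on UNIV f"
| "C_k (Suc k) f \<longleftrightarrow>
     (\<forall>x. f differentiable (at x)) \<and> (\<forall>v. C_k k (\<lambda>x. frechet_derivative f (at x) v))"

text \<open>Elements of \<open>C\<^sub>0\<^sup>\<infinity>(S)\<close> are extended by zero to the whole space.\<close>

definition test_fun :: "'a::euclidean_space set \<Rightarrow> ('a \<Rightarrow> real) \<Rightarrow> bool" where
  "test_fun S f \<longleftrightarrow> (\<forall>k. C_k k f) \<and> compactly_inside {x. f x \<noteq> 0} S"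

definition grad :: "(real^'n \<Rightarrow> real) \<Rightarrow> real^'n \<Rightarrow> real^'n" where
  "grad f x = (\<chi> j. frechet_derivative f (at x) (axis j 1))"

definition time_deriv :: "((real^'n) \<times> real \<Rightarrow> nat \<Rightarrow> real) \<Rightarrow> (real^'n) \<times> real \<Rightarrow> nat \<Rightarrow> real" where
  "time_deriv \<phi> z = (\<lambda>i. frechet_derivative (\<lambda>w. \<phi> w i) (at z) (0, 1))"

definition space_grad :: "((real^'n) \<times> real \<Rightarrow> nat \<Rightarrow> real) \<Rightarrow> (real^'n) \<times> real \<Rightarrow> nat \<Rightarrow> real^'n" where
  "space_grad \<phi> z = (\<lambda>i. \<chi> j. frechet_derivative (\<lambda>w. \<phi> w i) (at z) (axis j 1, 0))"

definition weak_gradient :: "(real^'n) set \<Rightarrow> (real^'n \<Rightarrow> real) \<Rightarrow> (real^'n \<Rightarrow> real^'n) \<Rightarrow> bool" where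
  "weak_gradient U v g \<longleftrightarrow>
     (\<forall>\<eta>. test_fun U \<eta> \<longrightarrow>
        (LINT x|lebesgue_on U. v x *\<^sub>R grad \<eta> x) = - (LINT x|lebesgue_on U. \<eta> x *\<^sub>R g x))"

text \<open>\<open>v\<close> belongs to \<open>W\<^sup>1\<^sup>,\<^sup>q(U;\<real>\<^sup>N)\<close> and \<open>g\<close> is (a representative of) its weak gradient.\<close>

definition sobolev_W1 ::
  "real \<Rightarrow> nat \<Rightarrow> (real^'n) set \<Rightarrow> (real^'n \<Rightarrow> nat \<Rightarrow> real) \<Rightarrow> (real^'n \<Rightarrow> nat \<Rightarrow> real^'n) \<Rightarrow> bool" where
  "sobolev_W1 q N U v g \<longleftrightarrow>
     Lq_on q N U v \<and> Lq_on q N U g \<and> (\<forall>i<N. weak_gradient U (\<lambda>x. v x i) (\<lambda>x. g x i))"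

text \<open>
  \<open>u\<close> belongs to \<open>L\<^sup>q\<^sub>l\<^sub>o\<^sub>c(0,T;W\<^sup>1\<^sup>,\<^sup>q\<^sub>l\<^sub>o\<^sub>c(\<Omega>;\<real>\<^sup>N))\<close> and \<open>Du\<close> is (a jointly measurable representative of) its
  spatial weak gradient, which is unique up to null sets.
\<close>

definition parabolic_sobolev_loc ::
  "real \<Rightarrow> nat \<Rightarrow> (real^'n) set \<Rightarrow> real \<Rightarrow> ((real^'n) \<times> real \<Rightarrow> nat \<Rightarrow> real) \<Rightarrow>
    ((real^'n) \<times> real \<Rightarrow> nat \<Rightarrow> real^'n) \<Rightarrow> bool" where
  "parabolic_sobolev_loc q N \<Omega> T u Du \<longleftrightarrow>
     (\<forall>z\<in>\<Omega> \<times> {0<..<T}. u z \<in> vecs N \<and> Du z \<in> vecs N) \<and>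
     vmeasurable N (\<Omega> \<times> {0<..<T}) u \<and> vmeasurable N (\<Omega> \<times> {0<..<T}) Du \<and>
     (\<forall>\<Omega>' t1 t2. open \<Omega>' \<and> compactly_inside \<Omega>' \<Omega> \<and> 0 < t1 \<and> t1 < t2 \<and> t2 < T \<longrightarrow>
        (AE t in lebesgue_on {t1<..<t2}. sobolev_W1 q N \<Omega>' (\<lambda>x. u (x, t)) (\<lambda>x. Du (x, t))) \<and>
        integrable (lebesgue_on (\<Omega>' \<times> {t1<..<t2}))
          (\<lambda>z. vnorm N (u z) powr q + vnorm N (Du z) powr q))"

definition admissible_field ::
  "real \<Rightarrow> real \<Rightarrow> real \<Rightarrow> nat \<Rightarrow> ((real^'n) \<times> real) set \<Rightarrow>
    ((real^'n) \<times> real \<Rightarrow> (nat \<Rightarrow> real^'n) \<Rightarrow> (nat \<Rightarrow> real^'n)) \<Rightarrow> bool" where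
  "admissible_field p \<nu> L N S A \<longleftrightarrow>
     (\<forall>z\<in>S. \<forall>\<xi>\<in>vecs N. A z \<xi> \<in> vecs N) \<and>
     (\<forall>\<xi>\<in>vecs N. vmeasurable N S (\<lambda>z. A z \<xi>)) \<and>
     (AE z in lebesgue_on S. continuous_on (vecs N) (A z)) \<and>
     (AE z in lebesgue_on S. \<forall>\<xi>\<in>vecs N.
        \<nu> * vnorm N \<xi> powr p \<le> vinner N (A z \<xi>) \<xi> \<and>
        vnorm N (A z \<xi>) \<le> L * vnorm N \<xi> powr (p - 1))"

definition weak_solution ::
  "real \<Rightarrow> nat \<Rightarrow> ((real^'n) \<times> real) set \<Rightarrow>
    ((real^'n) \<times> real \<Rightarrow> (nat \<Rightarrow> real^'n) \<Rightarrow> (nat \<Rightarrow> real^'n)) \<Rightarrow>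
    ((real^'n) \<times> real \<Rightarrow> nat \<Rightarrow> real^'n) \<Rightarrow> ((real^'n) \<times> real \<Rightarrow> nat \<Rightarrow> real) \<Rightarrow>
    ((real^'n) \<times> real \<Rightarrow> nat \<Rightarrow> real^'n) \<Rightarrow> bool" where
  "weak_solution p N S A F u Du \<longleftrightarrow>
     (\<forall>\<phi>. (\<forall>z. \<phi> z \<in> vecs N) \<and> (\<forall>i<N. test_fun S (\<lambda>z. \<phi> z i)) \<longrightarrow>
        (LINT z|lebesgue_on S.
            - vinner N (u z) (time_deriv \<phi> z) + vinner N (A z (Du z)) (space_grad \<phi> z)) =
        (LINT z|lebesgue_on S.
            vinner N (\<lambda>i. vnorm N (F z) powr (p - 2) *\<^sub>R F z i) (space_grad \<phi> z)))"

definition cylinder :: "real \<Rightarrow> real \<Rightarrow> real \<Rightarrow> real^'n \<Rightarrow> real \<Rightarrow> ((real^'n) \<times> real) set" where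
  "cylinder p lam \<rho> x0 t0 =
     ball x0 \<rho> \<times> {t0 - lam powr (2 - p) * \<rho>\<^sup>2 <..< t0 + lam powr (2 - p) * \<rho>\<^sup>2}"

definition data_mean ::
  "real \<Rightarrow> nat \<Rightarrow> ((real^'n) \<times> real \<Rightarrow> nat \<Rightarrow> real^'n) \<Rightarrow> ((real^'n) \<times> real \<Rightarrow> nat \<Rightarrow> real^'n) \<Rightarrow>
    ((real^'n) \<times> real) set \<Rightarrow> real" where
  "data_mean q N Du F Q = average Q (\<lambda>z. (vnorm N (Du z) + vnorm N (F z)) powr q) powr (1 / q)"

definition oscillation ::
  "nat \<Rightarrow> ((real^'n) \<times> real \<Rightarrow> nat \<Rightarrow> real) \<Rightarrow> ((real^'n) \<times> real) set \<Rightarrow> (real^'n) \<times> real \<Rightarrow> real" where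
  "oscillation N u Q z = vnorm N (\<lambda>i. u z i - vaverage Q u i)"

text \<open>
  All hypotheses shared by the estimates, apart from the bounds on \<open>p\<close> and \<open>q\<close>. The estimates are
  for the cylinder \<open>Q = cylinder p lam \<rho> x0 t0\<close>.
\<close>

definition intrinsic_setting ::
  "real \<Rightarrow> real \<Rightarrow> real \<Rightarrow> real \<Rightarrow> nat \<Rightarrow> real \<Rightarrow> (real^'n) set \<Rightarrow> real \<Rightarrow>
    ((real^'n) \<times> real \<Rightarrow> (nat \<Rightarrow> real^'n) \<Rightarrow> (nat \<Rightarrow> real^'n)) \<Rightarrow>
    ((real^'n) \<times> real \<Rightarrow> nat \<Rightarrow> real^'n) \<Rightarrow> ((real^'n) \<times> real \<Rightarrow> nat \<Rightarrow> real) \<Rightarrow>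
    ((real^'n) \<times> real \<Rightarrow> nat \<Rightarrow> real^'n) \<Rightarrow> real \<Rightarrow> real \<Rightarrow> real^'n \<Rightarrow> real \<Rightarrow> bool" where
  "intrinsic_setting p q L \<gamma> N \<nu> \<Omega> T A F u Du lam \<rho> x0 t0 \<longleftrightarrow>
     1 \<le> N \<and> 0 < \<nu> \<and> \<nu> < L \<and> 1 < \<gamma> \<and> 1 \<le> lam \<and> 0 < \<rho> \<and>
     open \<Omega> \<and> connected \<Omega> \<and> \<Omega> \<noteq> {} \<and> bounded \<Omega> \<and> 0 < T \<and>
     admissible_field p \<nu> L N (\<Omega> \<times> {0<..<T}) A \<and>
     (\<forall>z\<in>\<Omega> \<times> {0<..<T}. F z \<in> vecs N) \<and> vmeasurable N (\<Omega> \<times> {0<..<T}) F \<and>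
     Lq_loc q N (\<Omega> \<times> {0<..<T}) F \<and>
     parabolic_sobolev_loc q N \<Omega> T u Du \<and>
     weak_solution p N (\<Omega> \<times> {0<..<T}) A F u Du \<and>
     compactly_inside (cylinder p lam \<rho> x0 t0) (\<Omega> \<times> {0<..<T}) \<and>
     lam / \<gamma> \<le> data_mean q N Du F (cylinder p lam \<rho> x0 t0) \<and>
     data_mean q N Du F (cylinder p lam \<rho> x0 t0) \<le> lam"

end

theory Submission
  imports Defs "HOL-Computational_Algebra.Polynomial"
begin

text \<open>
  Write \<open>n = CARD('n)\<close>, \<open>h = (|Du| + |F|) / lam\<close> and rescale the cylinder \<open>Q\<close> to the unit cylinder by
  \<open>x = x0 + \<rho> X\<close>, \<open>t = t0 + lam powr (2 - p) * \<rho>\<^sup>2 * \<tau>\<close>. With \<open>v = u / (\<rho> * lam)\<close> in the new variables the equation says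
  that \<open>\<partial>\<^sub>\<tau> v\<close> is the divergence of a field \<open>G\<close>, and the intrinsic choice of the height makes all powers of
  \<open>lam\<close> disappear: \<open>|Dv| \<le> h\<close>, \<open>|G| \<le> (L + 1) h powr (p - 1)\<close> and \<open>\<integral>h powr q\<close> is at most the volume of the unit cylinder.
  Since \<open>lam\<close> is comparable to the mean of the data, it suffices to estimate \<open>v\<close> minus a constant in
  terms of these bounds (\<open>unit_transform\<close>, \<open>master_estimate\<close>).

  At a point \<open>z\<close> consider the means \<open>v\<^sub>k\<^sub>,\<^sub>l(z)\<close> of \<open>v\<close> against smooth product kernels of width \<open>2\<^sup>-\<^sup>k\<close> in space and
  \<open>2\<^sup>-\<^sup>l\<close> in time. Halving one width changes the kernel by a derivative of a test function in that
  direction, so the weak formulation alone gives, with averages \<open>A\<^sub>k\<^sub>,\<^sub>l\<close> over boxes of these widths,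
    \<open>|v\<^sub>k\<^sub>,\<^sub>l - v\<^sub>k\<^sub>+\<^sub>1\<^sub>,\<^sub>l| \<le> c 2\<^sup>-\<^sup>k A\<^sub>k\<^sub>,\<^sub>l(|Dv|)\<close>  and  \<open>|v\<^sub>k\<^sub>,\<^sub>l - v\<^sub>k\<^sub>,\<^sub>l\<^sub>+\<^sub>1| \<le> c 2\<^sup>k\<^sup>-\<^sup>l A\<^sub>k\<^sub>,\<^sub>l(|G|)\<close>
  (\<open>space_step\<close>, \<open>time_step\<close>). The kernels are moved towards the origin so that they stay in the cylinder,
  and at the coarsest scale the kernel is the same for every \<open>z\<close>; thus \<open>v\<^sub>0\<^sub>,\<^sub>0\<close> is the constant to subtract,
  while \<open>v\<^sub>k\<^sub>,\<^sub>l(z)\<close> tends to \<open>v(z)\<close> almost everywhere along suitable sequences of scales.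

  The chain from \<open>(0,0)\<close> to infinity is adapted to \<open>z\<close> (\<open>path_estimate\<close>). The global bound
  \<open>A\<^sub>k\<^sub>,\<^sub>l(h powr q) \<le> c 2\<^sup>k\<^sup>n\<^sup>+\<^sup>l\<close> is the better one on coarse scales. Using it along \<open>l = \<alpha> k\<close>, the space and the
  time steps are balanced if \<open>\<alpha> - 2 = (D / q) (p - 2)\<close> with \<open>D = n + \<alpha>\<close>, and both cost \<open>2 powr (k (D / q - 1))\<close>.
  On fine scales the maximal function is better: \<open>A\<^sub>k\<^sub>,\<^sub>l(h powr q) \<le> Y(z) 2 powr (\<delta> (k + l))\<close> with an integrable \<open>Y\<close>,
  where the small loss \<open>\<delta>\<close> makes the summation over all scales elementary (\<open>maximal_function\<close>). From the
  level \<open>K\<close> on, where both bounds agree, the chain follows the parabolic scaling \<open>l = 2 k + const\<close> and the costs decay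
  geometrically. This is a version of Hedberg's argument for Riesz potentials. The result (\<open>unit_estimate\<close>) is
    \<open>|v(z) - v\<^sub>0\<^sub>,\<^sub>0| \<le> C (\<Sum>k\<le>K. 2 powr (k (D / q - 1)))\<close>  with  \<open>2 powr (K \<theta>) \<le> Y(z)\<close>,  for any \<open>\<theta> < D\<close>.

  Here \<open>D / q - 1\<close> has the sign of \<open>n + p - q\<close>. If it is positive, the sum is comparable to its last term, and
  the power \<open>qs\<close> of the oscillation is integrable as soon as \<open>qs (D / q - 1) < D\<close>, which is precisely
  \<open>qs < q (n + 2) / (n + p - q)\<close>. If it is zero, the sum is \<open>K + 1\<close> and some exponential is integrable. If it is
  negative, the sum is bounded.
\<close>

section \<open>Smooth functions and a smooth step\<close>

lemma C_k_SucI: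
  assumes "\<And>x. (f has_derivative f' x) (at x)" and "\<And>v. C_k k (\<lambda>x. f' x v)"
  shows "C_k (Suc k) f"
proof -
  have "frechet_derivative f (at x) = f' x" for x
    using frechet_derivative_at[OF assms(1)] by simp
  then show ?thesis
    using assms by (auto simp: differentiable_def)
qed

lemma C_k_SucD:
  assumes "C_k (Suc k) f"
  shows "(f has_derivative frechet_derivative f (at x)) (at x)"
    and "C_k k (\<lambda>x. frechet_derivative f (at x) v)"
  using assms frechet_derivative_works by auto

lemma C_k_continuous: "C_k k f \<Longrightarrow> continuous_on UNIV f"
  by (cases k) (auto simp: continuous_on_eq_continuous_at dest: differentiable_imp_continuous_within)

lemma C_k_decrease: "C_k (Suc k) f \<Longrightarrow> C_k k f"
proof (induction k arbitrary: f)
  case 0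
  then show ?case using C_k_continuous[of "Suc 0" f] by simp
next
  case (Suc k)
  show ?case
    by (rule C_k_SucI[OF C_k_SucD(1)[OF Suc.prems] Suc.IH[OF C_k_SucD(2)[OF Suc.prems]]])
qed

lemma C_k_const: "C_k k (\<lambda>x. c)"
proof (induction k arbitrary: c)
  case (Suc k)
  show ?case by (rule C_k_SucI[OF has_derivative_const]) (rule Suc.IH)
qed simp

lemma C_k_add: "C_k k f \<Longrightarrow> C_k k g \<Longrightarrow> C_k k (\<lambda>x. f x + g x)"
proof (induction k arbitrary: f g)
  case (Suc k)
  show ?case
    by (rule C_k_SucI[OF has_derivative_add[OF C_k_SucD(1)[OF Suc.prems(1)] C_k_SucD(1)[OF Suc.prems(2)]]])
      (rule Suc.IH[OF C_k_SucD(2)[OF Suc.prems(1)] C_k_SucD(2)[OF Suc.prems(2)]])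
qed (auto intro: continuous_intros)

lemma C_k_mult: "C_k k f \<Longrightarrow> C_k k g \<Longrightarrow> C_k k (\<lambda>x. f x * g x)"
proof (induction k arbitrary: f g)
  case (Suc k)
  show ?case
    by (rule C_k_SucI[OF has_derivative_mult[OF C_k_SucD(1)[OF Suc.prems(1)] C_k_SucD(1)[OF Suc.prems(2)]]])
      (intro C_k_add Suc.IH C_k_SucD(2)[OF Suc.prems(1)] C_k_SucD(2)[OF Suc.prems(2)]
        C_k_decrease[OF Suc.prems(1)] C_k_decrease[OF Suc.prems(2)])
qed (auto intro: continuous_intros)

lemma C_k_diff: "C_k k f \<Longrightarrow> C_k k g \<Longrightarrow> C_k k (\<lambda>x. f x - g x)"
  using C_k_add[of k f "\<lambda>x. (-1) * g x"] C_k_mult[OF C_k_const[of k "-1"], of g] by simp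

lemma C_k_prod: "(\<And>i. i \<in> A \<Longrightarrow> C_k k (f i)) \<Longrightarrow> C_k k (\<lambda>x. \<Prod>i\<in>A. f i x)"
  by (induction A rule: infinite_finite_induct) (auto intro: C_k_const C_k_mult)

lemma C_k_affine:
  assumes "bounded_linear l"
  shows "C_k k f \<Longrightarrow> C_k k (\<lambda>x. f (d + l x))"
proof (induction k arbitrary: f)
  case 0
  have "continuous_on UNIV (\<lambda>x. d + l x)"
    using assms by (intro continuous_intros linear_continuous_on)
  then show ?case
    using 0 continuous_on_compose2[of UNIV f UNIV "\<lambda>x. d + l x"] by simp
next
  case (Suc k)
  have "((\<lambda>x. d + l x) has_derivative l) (at x)" for x
    using has_derivative_add[OF has_derivative_const[of d] bounded_linear_imp_has_derivative[OF assms]]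
    by simp
  from has_derivative_compose[OF this C_k_SucD(1)[OF Suc.prems]]
  show ?case
    by (rule C_k_SucI) (rule Suc.IH[OF C_k_SucD(2)[OF Suc.prems]])
qed

lemma C_k_real_SucI:
  assumes "\<And>x. (f has_real_derivative f' x) (at x)" "C_k k f'"
  shows "C_k (Suc k) f"
  by (rule C_k_SucI[OF assms(1)[unfolded has_field_derivative_def]])
    (use C_k_mult[OF assms(2) C_k_const] in simp)

text \<open>
  The functions \<open>P(1/x) exp(-1/x)\<close> on the positive half line, extended by zero. The family is closed under
  differentiation, so that one induction shows that all of them are smooth.
\<close>

definition flat :: "real poly \<Rightarrow> real \<Rightarrow> real" where
  "flat P x = (if 0 < x then poly P (1 / x) * exp (- (1 / x)) else 0)"

lemma tendsto_poly_over_exp: "((\<lambda>x. poly P x * exp (- x)) \<longlongrightarrow> (0::real)) at_top"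
proof -
  have "((\<lambda>x. \<Sum>i\<le>degree P. coeff P i * (x ^ i / exp x)) \<longlongrightarrow> (\<Sum>i\<le>degree P. coeff P i * 0)) at_top"
    by (intro tendsto_sum tendsto_mult tendsto_const tendsto_power_div_exp_0)
  moreover have "(\<lambda>x. \<Sum>i\<le>degree P. coeff P i * (x ^ i / exp x)) = (\<lambda>x. poly P x * exp (- x))"
    by (simp add: poly_altdef sum_distrib_right exp_minus divide_inverse mult.assoc)
  ultimately show ?thesis by simp
qed

lemma flat_at_0: "((\<lambda>x. flat P x) \<longlongrightarrow> 0) (at 0)"
proof -
  have "((\<lambda>x. poly P (1 / x) * exp (- (1 / x))) \<longlongrightarrow> 0) (at_right (0::real))"
    using filterlim_compose[OF tendsto_poly_over_exp filterlim_inverse_at_top_right]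
    by (simp add: inverse_eq_divide)
  then have "((\<lambda>x. flat P x) \<longlongrightarrow> 0) (at_right 0)"
    by (rule Lim_transform_eventually) (auto simp: flat_def eventually_at_filter)
  moreover have "((\<lambda>x. flat P x) \<longlongrightarrow> 0) (at_left 0)"
    by (rule Lim_transform_eventually[OF tendsto_const]) (auto simp: flat_def eventually_at_filter)
  ultimately show ?thesis by (simp add: filterlim_split_at)
qed

lemma flat_deriv:
  "(flat P has_real_derivative flat ([:0, 0, 1:] * (P - pderiv P)) x) (at x)"
proof -
  consider "x > 0" | "x < 0" | "x = 0" by linarith
  then show ?thesis
  proof cases
    case 1
    have "((\<lambda>x. 1 / x) has_real_derivative - (1 / x\<^sup>2)) (at x)"
      using 1 by (auto intro!: derivative_eq_intros simp: power2_eq_square)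
    note d = DERIV_chain2[OF poly_DERIV this, of P] DERIV_fun_exp[OF DERIV_minus[OF this]]
    have "((\<lambda>x. poly P (1 / x) * exp (- (1 / x))) has_real_derivative
        poly (pderiv P) (1 / x) * - (1 / x\<^sup>2) * exp (- (1 / x)) +
        exp (- (1 / x)) * - (- (1 / x\<^sup>2)) * poly P (1 / x)) (at x)"
      by (rule DERIV_mult[OF d])
    also have "poly (pderiv P) (1 / x) * - (1 / x\<^sup>2) * exp (- (1 / x)) +
        exp (- (1 / x)) * - (- (1 / x\<^sup>2)) * poly P (1 / x) =
        flat ([:0, 0, 1:] * (P - pderiv P)) x"
      using 1 by (simp add: flat_def power2_eq_square algebra_simps)
    finally have "((\<lambda>x. poly P (1 / x) * exp (- (1 / x))) has_real_derivative
        flat ([:0, 0, 1:] * (P - pderiv P)) x) (at x)" .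
    moreover have "eventually (\<lambda>y. y > 0) (nhds x)"
      using 1 by (intro eventually_nhds_in_open[of "{0<..}", simplified]) auto
    ultimately show ?thesis
      by (subst DERIV_cong_ev[OF refl _ refl]) (auto elim!: eventually_mono simp: flat_def)
  next
    case 2
    have "((\<lambda>x. 0) has_real_derivative flat ([:0, 0, 1:] * (P - pderiv P)) x) (at x)"
      using 2 by (simp add: flat_def)
    moreover have "eventually (\<lambda>y. y < 0) (nhds x)"
      using 2 by (intro eventually_nhds_in_open[of "{..<0}", simplified]) auto
    ultimately show ?thesis
      by (subst DERIV_cong_ev[OF refl _ refl]) (auto elim!: eventually_mono simp: flat_def)
  next
    case 3
    have "((\<lambda>h. (flat P h - flat P 0) / (h - 0)) \<longlongrightarrow> 0) (at 0)"
      by (rule Lim_transform_eventually[OF flat_at_0[of "[:0, 1:] * P"]])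
        (auto simp: flat_def eventually_at_filter)
    then show ?thesis
      using 3 by (simp add: has_field_derivative_iff flat_def)
  qed
qed

lemma C_k_flat: "C_k k (flat P)"
proof (induction k arbitrary: P)
  case 0
  show ?case
    using flat_deriv by (simp add: continuous_on_eq_continuous_at) (meson DERIV_isCont)
next
  case (Suc k)
  show ?case by (rule C_k_real_SucI[OF flat_deriv Suc.IH])
qed

text \<open>
  A smooth bump \<open>b\<close> of mass one is needed together with its antiderivative \<open>I\<close>: differences of rescaled
  copies of \<open>I\<close> are the compactly supported primitives of differences of rescaled copies of \<open>b\<close>.
\<close>

lemma smooth_step_exists:
  fixes s :: real
  assumes "0 < s"
  obtains I b b' :: "real \<Rightarrow> real" where
    "\<And>k. C_k k b" "\<And>x. (I has_real_derivative b x) (at x)" "\<And>x. (b has_real_derivative b' x) (at x)"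
    "\<And>x. x \<le> - s \<Longrightarrow> I x = 0" "\<And>x. s \<le> x \<Longrightarrow> I x = 1"
    "\<And>x. 0 \<le> b x" "\<And>x. s < \<bar>x\<bar> \<Longrightarrow> b x = 0" "\<And>x. s < \<bar>x\<bar> \<Longrightarrow> b' x = 0" "continuous_on UNIV b'"
proof -
  \<comment> \<open>The product of two one-sided flat functions is positive exactly in the interval from \<open>-s\<close> to \<open>s\<close>.\<close>
  define e where "e = (\<lambda>x. flat 1 (s + (1::real) *\<^sub>R x) * flat 1 (s + (-1) *\<^sub>R x))"
  have ek: "C_k k e" for k
    unfolding e_def by (intro C_k_mult C_k_affine C_k_flat bounded_linear_scaleR_right)
  have ec: "continuous_on A e" for A
    using C_k_continuous[OF ek] continuous_on_subset by blast
  have e0: "0 \<le> e x" for x by (auto simp: e_def flat_def)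
  have eout: "e x = 0" if "s \<le> \<bar>x\<bar>" for x
    using that by (auto simp: e_def flat_def)
  have epos: "0 < e 0" using assms by (simp add: e_def flat_def)
  define m where "m = integral {- s..s} e"
  have "m \<noteq> 0"
  proof
    assume "m = 0"
    then have "integral (cbox (- s) s) e = 0" by (simp add: m_def)
    then have "(e has_integral 0) (cbox (- s) s)"
      using integrable_integral[OF integrable_continuous[OF ec, of "- s" s]] by (simp del: cbox_interval)
    from has_integral_0_cbox_imp_0[OF ec e0 this] assms
    have "e 0 = 0" by (auto simp: box_real)
    then show False using epos by simp
  qed
  moreover have "0 \<le> m"
    unfolding m_def by (rule Henstock_Kurzweil_Integration.integral_nonneg)
      (auto intro: integrable_continuous_real ec e0)
  ultimately have m: "0 < m" by simp
  define b where "b = (\<lambda>x. inverse m * e x)"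
  have bk: "C_k k b" for k
    unfolding b_def by (intro C_k_mult ek C_k_const)
  have bc: "continuous_on A b" for A
    using C_k_continuous[OF bk] continuous_on_subset by blast
  define J where "J = (\<lambda>x. integral {- s..x} b)"
  define I where "I = (\<lambda>x. if x < - s then 0 else J x)"
  define b' where "b' = (\<lambda>x. frechet_derivative b (at x) 1)"
  have b'k: "C_k k b'" for k
    unfolding b'_def by (rule C_k_SucD(2)[OF bk])
  have db: "(b has_real_derivative b' x) (at x)" for x
  proof -
    have d: "(b has_derivative frechet_derivative b (at x)) (at x)" by (rule C_k_SucD(1)[OF bk])
    have "frechet_derivative b (at x) y = b' x * y" for y
      using linear_scale[OF linear_frechet_derivative[of b "at x"], of y 1] d
      by (simp add: b'_def differentiable_def mult.commute) blast
    then have "frechet_derivative b (at x) = (*) (b' x)" by blast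
    with d show ?thesis by (simp add: has_field_derivative_def)
  qed
  have bout: "b x = 0" if "s \<le> \<bar>x\<bar>" for x using that eout by (simp add: b_def)
  have J1: "J x = 1" if "s \<le> x" for x
  proof -
    have "integral {- s..x} b = integral {- s..s} b + integral {s..x} b"
      using that assms by (intro Henstock_Kurzweil_Integration.integral_combine[symmetric] integrable_continuous_real bc) auto
    also have "integral {s..x} b = integral {s..x} (\<lambda>_. 0)"
      using assms by (intro integral_cong) (auto intro: bout)
    also have "integral {- s..s} b = 1"
      using m by (simp add: b_def m_def[symmetric])
    finally show ?thesis by (simp add: J_def)
  qed
  have I2: "I x = integral {a..x} b" if "a \<le> x" "a < - s" for a x
  proof -
    have *: "integral {a..y} b = 0" if "y \<le> - s" for y
    proof -
      have "integral {a..y} b = integral {a..y} (\<lambda>_. 0)"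
        using assms that by (intro integral_cong) (auto intro: bout)
      then show ?thesis by simp
    qed
    show ?thesis
    proof (cases "x < - s")
      case False
      have "integral {a..x} b = integral {a..- s} b + integral {- s..x} b"
        using that False by (intro Henstock_Kurzweil_Integration.integral_combine[symmetric] integrable_continuous_real bc) auto
      then show ?thesis using * False by (simp add: I_def J_def)
    qed (use * in \<open>simp add: I_def\<close>)
  qed
  have dI: "(I has_real_derivative b x) (at x)" for x
  proof -
    define a c where "a = min x (- s) - 1" and "c = x + 1"
    have "((\<lambda>u. integral {a..u} b) has_real_derivative b x) (at x within {a..c})"
      using bc by (intro integral_has_real_derivative) (auto simp: a_def c_def)
    then have "((\<lambda>u. integral {a..u} b) has_real_derivative b x) (at x)"
      by (subst (asm) at_within_interior) (auto simp: a_def c_def)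
    moreover have "eventually (\<lambda>y. y > a) (nhds x)"
      using eventually_nhds_in_open[of "{a<..}" x] by (simp add: a_def)
    then have "\<forall>\<^sub>F y in nhds x. I y = integral {a..y} b"
      by (rule eventually_mono) (rule I2, auto simp: a_def)
    ultimately show ?thesis
      by (subst DERIV_cong_ev[OF refl _ refl])
  qed
  have b'out: "b' x = 0" if "s < \<bar>x\<bar>" for x
  proof -
    have "open {y::real. s < \<bar>y\<bar>}" by (intro open_Collect_less continuous_intros)
    then have "\<forall>\<^sub>F y in nhds x. y \<in> {y. s < \<bar>y\<bar>}" using that by (intro eventually_nhds_in_open) auto
    then have "\<forall>\<^sub>F y in nhds x. b y = 0" by (rule eventually_mono) (auto intro: bout)
    then have "(b has_real_derivative 0) (at x)"
      using DERIV_const[of 0] by (subst DERIV_cong_ev[OF refl _ refl])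
    then show ?thesis using db DERIV_unique by blast
  qed
  show thesis
  proof (rule that[of b I b'])
    show "I x = 0" if "x \<le> - s" for x
      using that by (cases "x = - s") (auto simp: I_def J_def)
    show "I x = 1" if "s \<le> x" for x
      using that J1 assms by (auto simp: I_def)
    show "0 \<le> b x" for x using m e0 by (simp add: b_def)
  qed (use bk dI db b'out C_k_continuous[OF b'k] bout in auto)
qed


section \<open>Product functions\<close>

definition tensor :: "('a::euclidean_space \<Rightarrow> real \<Rightarrow> real) \<Rightarrow> 'a \<Rightarrow> real" where
  "tensor f Z = (\<Prod>b\<in>Basis. f b (Z \<bullet> b))"

lemma C_k_tensor:
  assumes "\<And>b. b \<in> Basis \<Longrightarrow> C_k k (f b)"
  shows "C_k k (tensor f)"
  unfolding tensor_def[abs_def]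
proof (rule C_k_prod)
  fix b :: 'a assume "b \<in> Basis"
  from C_k_affine[OF bounded_linear_inner_left[of b] assms[OF this], of 0]
  show "C_k k (\<lambda>x. f b (x \<bullet> b))" by simp
qed

lemma tensor_frechet_derivative:
  assumes "\<And>b x. b \<in> Basis \<Longrightarrow> (f b has_real_derivative f' b x) (at x)" and c: "c \<in> Basis"
  shows "frechet_derivative (tensor f) (at Z) c = f' c (Z \<bullet> c) * (\<Prod>b\<in>Basis - {c}. f b (Z \<bullet> b))"
proof -
  have 1: "((\<lambda>Z. f b (Z \<bullet> b)) has_derivative (\<lambda>y. f' b (Z \<bullet> b) * (y \<bullet> b))) (at Z)" if "b \<in> Basis" for b
    using has_derivative_compose[OF bounded_linear_imp_has_derivative[OF bounded_linear_inner_left]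
      assms(1)[OF that, unfolded has_field_derivative_def]] .
  have "(tensor f has_derivative
      (\<lambda>y. \<Sum>i\<in>Basis. f' i (Z \<bullet> i) * (y \<bullet> i) * (\<Prod>j\<in>Basis - {i}. f j (Z \<bullet> j)))) (at Z)"
    unfolding tensor_def[abs_def] by (rule has_derivative_prod) (rule 1)
  from frechet_derivative_at[OF this, symmetric]
  have "frechet_derivative (tensor f) (at Z) c =
      (\<Sum>i\<in>Basis. f' i (Z \<bullet> i) * (c \<bullet> i) * (\<Prod>j\<in>Basis - {i}. f j (Z \<bullet> j)))"
    by simp
  also have "\<dots> = (\<Sum>i\<in>Basis. if i = c then f' c (Z \<bullet> c) * (\<Prod>j\<in>Basis - {c}. f j (Z \<bullet> j)) else 0)"
    using c by (intro sum.cong) (auto simp: inner_Basis)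
  finally show ?thesis using c by simp
qed

section \<open>Product kernels at different scales\<close>

text \<open>
  A vector \<open>\<kappa>\<close> of scales assigns to each coordinate \<open>b\<close> a width \<open>2 powr (- \<kappa> b)\<close>; the box of these widths
  contains the supports of all kernels used at \<open>z\<close>.
\<close>

definition nbhd :: "('a \<Rightarrow> nat) \<Rightarrow> 'a \<Rightarrow> 'a::euclidean_space set" where
  "nbhd \<kappa> z = {Z. \<forall>b\<in>Basis. \<bar>Z \<bullet> b - z \<bullet> b\<bar> \<le> 2 / 2 ^ \<kappa> b}"

definition weight :: "('a::euclidean_space \<Rightarrow> nat) \<Rightarrow> real" where
  "weight \<kappa> = (\<Prod>b\<in>Basis. 2 ^ \<kappa> b)"

lemma weight_pos: "0 < weight \<kappa>" by (simp add: weight_def prod_pos)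

locale smooth_step =
  fixes s M :: real and I b b' :: "real \<Rightarrow> real"
  assumes s: "0 < s" "s \<le> 1" and M: "1 \<le> M"
    and b_smooth: "\<And>k. C_k k b"
    and I_deriv: "\<And>x. (I has_real_derivative b x) (at x)"
    and b_deriv: "\<And>x. (b has_real_derivative b' x) (at x)"
    and I_left: "\<And>x. x \<le> - s \<Longrightarrow> I x = 0" and I_right: "\<And>x. s \<le> x \<Longrightarrow> I x = 1"
    and b_nonneg: "\<And>x. 0 \<le> b x"
    and b_out: "\<And>x. s < \<bar>x\<bar> \<Longrightarrow> b x = 0" and b'_out: "\<And>x. s < \<bar>x\<bar> \<Longrightarrow> b' x = 0"
    and b_le: "\<And>x. b x \<le> M" and b'_le: "\<And>x. \<bar>b' x\<bar> \<le> M"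
begin

text \<open>
  With \<open>e = 2\<^sup>-\<^sup>k\<close>, the bump \<open>beta k x\<close> has width \<open>e s\<close> and is centred at \<open>(1 - e) x\<close> instead of \<open>x\<close>. This makes
  \<open>beta 0 x = b\<close> independent of \<open>x\<close>, and keeps the support inside the unit interval when \<open>|x| < 1\<close>.
\<close>

definition beta :: "nat \<Rightarrow> real \<Rightarrow> real \<Rightarrow> real" where
  "beta k x X = 2 ^ k * b (2 ^ k * (X - x) + x)"

definition beta' :: "nat \<Rightarrow> real \<Rightarrow> real \<Rightarrow> real" where
  "beta' k x X = 4 ^ k * b' (2 ^ k * (X - x) + x)"

definition beta_integral :: "nat \<Rightarrow> real \<Rightarrow> real \<Rightarrow> real" where
  "beta_integral k x X = I (2 ^ k * (X - x) + x)"

text \<open>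
  The region that is swept by the support of \<open>beta\<close> while the scale runs continuously from \<open>k\<close> to \<open>k + 1\<close>. It
  contains the supports of both bumps and also that of the difference of their antiderivatives.
\<close>

definition near :: "nat \<Rightarrow> real \<Rightarrow> real \<Rightarrow> bool" where
  "near k x X \<longleftrightarrow> (\<exists>e. 1 / 2 ^ Suc k \<le> e \<and> e \<le> 1 / 2 ^ k \<and> \<bar>X - (1 - e) * x\<bar> \<le> e * s)"

definition ker :: "('a \<Rightarrow> nat) \<Rightarrow> 'a \<Rightarrow> 'a::euclidean_space \<Rightarrow> real" where
  "ker \<kappa> z = tensor (\<lambda>c. beta (\<kappa> c) (z \<bullet> c))"

text \<open>
  The kernels at the scales \<open>\<kappa>\<close> and \<open>\<kappa>(a := Suc (\<kappa> a))\<close> differ only in the factor for the coordinate \<open>a\<close>. Replacing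
  this factor by the difference of the two antiderivatives gives a function \<open>prim\<close> whose derivative in
  the direction \<open>a\<close> is the difference of the kernels.
\<close>

definition primf :: "('a \<Rightarrow> nat) \<Rightarrow> 'a \<Rightarrow> 'a \<Rightarrow> 'a::euclidean_space \<Rightarrow> real \<Rightarrow> real" where
  "primf \<kappa> a z c X = (if c = a then beta_integral (\<kappa> a) (z \<bullet> a) X - beta_integral (Suc (\<kappa> a)) (z \<bullet> a) X
     else beta (\<kappa> c) (z \<bullet> c) X)"

definition prim :: "('a \<Rightarrow> nat) \<Rightarrow> 'a \<Rightarrow> 'a \<Rightarrow> 'a::euclidean_space \<Rightarrow> real" where
  "prim \<kappa> a z = tensor (primf \<kappa> a z)"

lemma I_range: "0 \<le> I x \<and> I x \<le> 1"
proof -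
  have mono: "I x \<le> I y" if "x \<le> y" for x y
    by (rule DERIV_nonneg_imp_nondecreasing[OF that]) (use I_deriv b_nonneg in blast)
  show ?thesis
    using mono[of "min x (- s)" x] mono[of x "max x s"] I_left[of "min x (- s)"] I_right[of "max x s"]
    by auto
qed

lemma beta_smooth: "C_k m (beta k x)"
proof -
  have "C_k m (\<lambda>X. 2 ^ k * b ((x - 2 ^ k * x) + 2 ^ k *\<^sub>R X))"
    by (intro C_k_mult C_k_const C_k_affine b_smooth bounded_linear_scaleR_right)
  also have "(\<lambda>X. 2 ^ k * b ((x - 2 ^ k * x) + 2 ^ k *\<^sub>R X)) = beta k x"
    by (simp add: beta_def fun_eq_iff algebra_simps)
  finally show ?thesis .
qed

lemma beta_integral_deriv: "(beta_integral k x has_real_derivative beta k x X) (at X)"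
proof -
  have "((\<lambda>X. 2 ^ k * (X - x) + x) has_real_derivative 2 ^ k) (at X)"
    by (auto intro!: derivative_eq_intros)
  from DERIV_chain2[OF I_deriv this] show ?thesis
    by (simp add: beta_integral_def[abs_def] beta_def mult.commute)
qed

lemma beta_deriv: "(beta k x has_real_derivative beta' k x X) (at X)"
proof -
  have "((\<lambda>X. 2 ^ k * (X - x) + x) has_real_derivative 2 ^ k) (at X)"
    by (auto intro!: derivative_eq_intros)
  then have "((\<lambda>X. 2 ^ k * b (2 ^ k * (X - x) + x)) has_real_derivative
      2 ^ k * (b' (2 ^ k * (X - x) + x) * 2 ^ k)) (at X)"
    by (intro DERIV_cmult DERIV_chain2[OF b_deriv])
  moreover have "(4::real) ^ k = 2 ^ k * 2 ^ k"
    by (simp flip: power_mult_distrib)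
  ultimately show ?thesis
    by (simp add: beta_def[abs_def] beta'_def mult_ac)
qed

lemma beta_integral_smooth: "C_k m (beta_integral k x)"
  using C_k_real_SucI[OF beta_integral_deriv beta_smooth] C_k_decrease by blast

lemma beta_nonneg: "0 \<le> beta k x X" by (simp add: beta_def b_nonneg)
lemma beta_le: "beta k x X \<le> M * 2 ^ k" using b_le by (simp add: beta_def mult.commute)
lemma beta'_le: "\<bar>beta' k x X\<bar> \<le> M * 4 ^ k" using b'_le by (simp add: beta'_def abs_mult mult.commute)
lemma dstp_le: "\<bar>beta_integral k x X - beta_integral l x X\<bar> \<le> 1"
  unfolding beta_integral_def using I_range[of "2 ^ k * (X - x) + x"] I_range[of "2 ^ l * (X - x) + x"] by linarith

lemma nearI:
  assumes "2 ^ k \<le> m" "m \<le> 2 ^ Suc k" "\<bar>m * (X - x) + x\<bar> \<le> s"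
  shows "near k x X"
  unfolding near_def
proof (intro exI[of _ "1 / m"] conjI)
  have m: "0 < m" using assms(1) by (smt (verit) zero_less_power)
  show "1 / 2 ^ Suc k \<le> 1 / m" "1 / m \<le> 1 / 2 ^ k"
    using assms m by (auto intro!: divide_left_mono)
  have "X - (1 - 1 / m) * x = (m * (X - x) + x) / m"
    using m by (simp add: field_simps)
  then show "\<bar>X - (1 - 1 / m) * x\<bar> \<le> 1 / m * s"
    using assms(3) m by (simp add: abs_divide divide_right_mono)
qed

lemma near_beta: "beta j x X \<noteq> 0 \<Longrightarrow> j = k \<or> j = Suc k \<Longrightarrow> near k x X"
  using b_out by (intro nearI[of _ "2 ^ j"]) (fastforce simp: beta_def not_less[symmetric])+

lemma near_beta': "beta' j x X \<noteq> 0 \<Longrightarrow> j = k \<or> j = Suc k \<Longrightarrow> near k x X"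
  using b'_out by (intro nearI[of _ "2 ^ j"]) (fastforce simp: beta'_def not_less[symmetric])+

text \<open>
  The argument \<open>m (X - x) + x\<close> of the step is affine in the dilation \<open>m\<close>. If it avoids the interval from \<open>-s\<close>
  to \<open>s\<close> for all \<open>m\<close> between \<open>2\<^sup>k\<close> and \<open>2\<^sup>k\<^sup>+\<^sup>1\<close>, it keeps its sign by the intermediate value theorem, and both
  steps have the same value.
\<close>

lemma near_dstp:
  assumes "beta_integral k x X \<noteq> beta_integral (Suc k) x X"
  shows "near k x X"
proof -
  define f where "f m = m * (X - x) + x" for m
  have "\<exists>m. 2 ^ k \<le> m \<and> m \<le> 2 ^ Suc k \<and> \<bar>f m\<bar> \<le> s"
  proof (rule ccontr)
    assume "\<not> ?thesis"
    then have n: "s < \<bar>f m\<bar>" if "2 ^ k \<le> m" "m \<le> 2 ^ Suc k" for m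
      using that by force
    have c: "isCont f m" for m unfolding f_def by (intro continuous_intros)
    have "\<not> (f (2 ^ k) \<le> 0 \<and> 0 \<le> f (2 ^ Suc k))"
    proof
      assume "f (2 ^ k) \<le> 0 \<and> 0 \<le> f (2 ^ Suc k)"
      then obtain m where "2 ^ k \<le> m" "m \<le> 2 ^ Suc k" "f m = 0"
        using IVT[of f "2 ^ k" 0 "2 ^ Suc k"] c by auto
      then show False using n[of m] s by auto
    qed
    moreover have "\<not> (f (2 ^ Suc k) \<le> 0 \<and> 0 \<le> f (2 ^ k))"
    proof
      assume "f (2 ^ Suc k) \<le> 0 \<and> 0 \<le> f (2 ^ k)"
      then obtain m where "2 ^ k \<le> m" "m \<le> 2 ^ Suc k" "f m = 0"
        using IVT2[of f "2 ^ Suc k" 0 "2 ^ k"] c by auto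
      then show False using n[of m] s by auto
    qed
    ultimately have "f (2 ^ k) < 0 \<and> f (2 ^ Suc k) < 0 \<or> 0 < f (2 ^ k) \<and> 0 < f (2 ^ Suc k)"
      by linarith
    moreover have "s < \<bar>f (2 ^ k)\<bar>" "s < \<bar>f (2 ^ Suc k)\<bar>" by (auto intro: n)
    ultimately have "beta_integral k x X = beta_integral (Suc k) x X"
      using I_left[of "f (2 ^ k)"] I_left[of "f (2 ^ Suc k)"] I_right[of "f (2 ^ k)"] I_right[of "f (2 ^ Suc k)"]
      unfolding beta_integral_def f_def by linarith
    then show False using assms by simp
  qed
  then show ?thesis using nearI unfolding f_def by blast
qed

lemma near_close:
  assumes "near k x X" "\<bar>x\<bar> \<le> 1"
  shows "\<bar>X - x\<bar> \<le> 2 / 2 ^ k"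
proof -
  obtain e where e: "1 / 2 ^ Suc k \<le> e" "e \<le> 1 / 2 ^ k" "\<bar>X - (1 - e) * x\<bar> \<le> e * s"
    using assms(1) unfolding near_def by auto
  have e0: "0 \<le> e" using e(1) by (smt (verit) divide_nonneg_nonneg zero_le_power)
  have "\<bar>X - x\<bar> \<le> \<bar>X - (1 - e) * x\<bar> + \<bar>e * x\<bar>" by (simp add: algebra_simps)
  also have "\<dots> \<le> e * 1 + e * 1"
    using e(3) mult_left_mono[OF assms(2) e0] mult_left_mono[OF s(2) e0] e0 by (simp add: abs_mult)
  also have "\<dots> \<le> 2 / 2 ^ k" using e(2) by simp
  finally show ?thesis .
qed

text \<open>
  Space steps refine the coordinates one after the other, so the kernels of one step have intermediate
  scales; all of them are estimated by boxes at the scale \<open>\<kappa>\<close> before the step.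
\<close>

definition adj :: "('a::euclidean_space \<Rightarrow> nat) \<Rightarrow> ('a \<Rightarrow> nat) \<Rightarrow> bool" where
  "adj \<kappa> \<kappa>' \<longleftrightarrow> (\<forall>b\<in>Basis. \<kappa>' b = \<kappa> b \<or> \<kappa>' b = Suc (\<kappa> b))"

lemma near_ker:
  assumes "ker \<kappa> z Z \<noteq> 0" "c \<in> Basis"
  shows "near (\<kappa> c) (z \<bullet> c) (Z \<bullet> c)"
  using assms by (auto simp: ker_def tensor_def intro: near_beta)

lemma near_primf:
  assumes "primf \<kappa>' a z c (Z \<bullet> c) \<noteq> 0" "c \<in> Basis" "adj \<kappa> \<kappa>'" "\<kappa>' a = \<kappa> a"
  shows "near (\<kappa> c) (z \<bullet> c) (Z \<bullet> c)"
  using assms by (auto simp: primf_def adj_def intro: near_beta near_dstp split: if_splits)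

lemma near_prim:
  assumes "prim \<kappa>' a z Z \<noteq> 0" "c \<in> Basis" "adj \<kappa> \<kappa>'" "\<kappa>' a = \<kappa> a"
  shows "near (\<kappa> c) (z \<bullet> c) (Z \<bullet> c)"
proof -
  have "primf \<kappa>' a z c (Z \<bullet> c) \<noteq> 0"
    using assms(1,2) by (auto simp: prim_def tensor_def)
  then show ?thesis using near_primf assms(2-4) by blast
qed

lemma near_nbhd:
  assumes "\<And>c. c \<in> Basis \<Longrightarrow> near (\<kappa> c) (z \<bullet> c) (Z \<bullet> c)" "\<And>c. c \<in> Basis \<Longrightarrow> \<bar>z \<bullet> c\<bar> \<le> 1"
  shows "Z \<in> nbhd \<kappa> z"
  using near_close assms by (auto simp: nbhd_def)

lemma primf_deriv:
  "(primf \<kappa> a z c has_real_derivative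
    (if c = a then beta (\<kappa> a) (z \<bullet> a) X - beta (Suc (\<kappa> a)) (z \<bullet> a) X else beta' (\<kappa> c) (z \<bullet> c) X)) (at X)"
  unfolding primf_def[abs_def] using beta_integral_deriv beta_deriv by (auto intro!: derivative_intros)

lemma prim_smooth: "C_k k (prim \<kappa> a z)"
  unfolding prim_def
proof (rule C_k_tensor)
  show "C_k k (primf \<kappa> a z b)" for b
    by (cases "b = a") (auto simp: primf_def[abs_def] intro: C_k_diff beta_integral_smooth beta_smooth)
qed

lemma prim_deriv_same:
  assumes "a \<in> Basis"
  shows "frechet_derivative (prim \<kappa> a z) (at Z) a = ker \<kappa> z Z - ker (\<kappa>(a := Suc (\<kappa> a))) z Z"
proof -
  have *: "ker \<kappa>' z Z = beta (\<kappa>' a) (z \<bullet> a) (Z \<bullet> a) * (\<Prod>c\<in>Basis - {a}. beta (\<kappa>' c) (z \<bullet> c) (Z \<bullet> c))" for \<kappa>'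
    unfolding ker_def tensor_def by (rule prod.remove) (use assms in auto)
  show ?thesis
    unfolding prim_def tensor_frechet_derivative[OF primf_deriv assms]
    unfolding * by (simp add: primf_def left_diff_distrib)
qed

lemma prim_deriv_other:
  assumes "d \<in> Basis" "d \<noteq> a"
  shows "frechet_derivative (prim \<kappa> a z) (at Z) d =
    beta' (\<kappa> d) (z \<bullet> d) (Z \<bullet> d) * (\<Prod>c\<in>Basis - {d}. primf \<kappa> a z c (Z \<bullet> c))"
  unfolding prim_def tensor_frechet_derivative[OF primf_deriv assms(1)] using assms(2) by simp

definition ker_bound :: "'a::euclidean_space itself \<Rightarrow> real" where
  "ker_bound _ = (4 * M) ^ DIM('a)"

lemma ker_bound_ge_1: "1 \<le> ker_bound TYPE('a::euclidean_space)"
  unfolding ker_bound_def using M by (intro one_le_power) simp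

lemma abs_primf_le:
  assumes "adj \<kappa> \<kappa>'" "c \<in> Basis"
  shows "\<bar>primf \<kappa>' a z c X\<bar> \<le> 4 * M * (if c = a then 1 else 2 ^ \<kappa> c)"
proof (cases "c = a")
  case True
  then show ?thesis using dstp_le[of "\<kappa>' a" "z \<bullet> a" X "Suc (\<kappa>' a)"] M by (simp add: primf_def)
next
  case False
  have "beta (\<kappa>' c) (z \<bullet> c) X \<le> M * 2 ^ \<kappa>' c" by (rule beta_le)
  also have "\<dots> \<le> M * (4 * 2 ^ \<kappa> c)"
    using assms M by (intro mult_left_mono) (auto simp: adj_def)
  finally show ?thesis using False beta_nonneg by (simp add: primf_def)
qed

lemma prod_weight: "a \<in> Basis \<Longrightarrow> (\<Prod>c\<in>Basis. if c = a then 1 else 2 ^ \<kappa> c) = weight \<kappa> / 2 ^ \<kappa> a"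
  for a :: "'a::euclidean_space"
  unfolding weight_def by (subst (1 2) prod.remove[of _ a]) (auto intro!: prod.cong)

text \<open>
  The coordinate \<open>a\<close> contributes a bounded factor instead of \<open>2 ^ \<kappa> a\<close>; this is the gain of one power of the
  width in a space step.
\<close>

lemma prim_le:
  assumes "adj \<kappa> \<kappa>'" "\<kappa>' a = \<kappa> a" "a \<in> Basis" "\<And>c. c \<in> Basis \<Longrightarrow> \<bar>z \<bullet> c\<bar> \<le> 1"
  shows "\<bar>prim \<kappa>' a z Z\<bar> \<le> ker_bound TYPE('a) * (weight \<kappa> / 2 ^ \<kappa> a) * indicator (nbhd \<kappa> z) (Z::'a::euclidean_space)"
proof (cases "prim \<kappa>' a z Z = 0")
  case True
  then show ?thesis using ker_bound_ge_1[where ?'a = 'a] weight_pos[of \<kappa>] by (simp add: indicator_def)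
next
  case False
  have "Z \<in> nbhd \<kappa> z"
    using near_nbhd[OF near_prim[OF False _ assms(1,2)]] assms(4) by blast
  have "\<bar>prim \<kappa>' a z Z\<bar> \<le> (\<Prod>c\<in>Basis. 4 * M * (if c = a then 1 else 2 ^ \<kappa> c))"
    unfolding prim_def tensor_def abs_prod
    by (rule prod_mono) (use abs_primf_le[OF assms(1)] in auto)
  also have "\<dots> = ker_bound TYPE('a) * (weight \<kappa> / 2 ^ \<kappa> a)"
    by (simp add: prod.distrib ker_bound_def prod_weight[OF assms(3)])
  finally show ?thesis using \<open>Z \<in> nbhd \<kappa> z\<close> by simp
qed

text \<open>
  In a time step, the derivative falls on a space coordinate \<open>d\<close>, which costs \<open>2 ^ \<kappa> d\<close>, while the time coordinate
  \<open>a\<close> still gains \<open>2 ^ \<kappa> a\<close>.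
\<close>

lemma prim_deriv_le:
  assumes "adj \<kappa> \<kappa>'" "\<kappa>' a = \<kappa> a" "a \<in> Basis" "d \<in> Basis" "d \<noteq> a" "\<kappa>' d = \<kappa> d"
    "\<And>c. c \<in> Basis \<Longrightarrow> \<bar>z \<bullet> c\<bar> \<le> 1"
  shows "\<bar>frechet_derivative (prim \<kappa>' a z) (at Z) d\<bar>
    \<le> ker_bound TYPE('a) * (2 ^ \<kappa> d * weight \<kappa> / 2 ^ \<kappa> a) * indicator (nbhd \<kappa> z) (Z::'a::euclidean_space)"
proof -
  let ?f = "\<lambda>c. if c = d then beta' (\<kappa>' d) (z \<bullet> d) (Z \<bullet> d) else primf \<kappa>' a z c (Z \<bullet> c)"
  have eq: "frechet_derivative (prim \<kappa>' a z) (at Z) d = (\<Prod>c\<in>Basis. ?f c)"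
    unfolding prim_deriv_other[OF assms(4,5)]
    by (subst prod.remove[of Basis d]) (use assms(4) in auto)
  show ?thesis
  proof (cases "(\<Prod>c\<in>Basis. ?f c) = 0")
    case True
    show ?thesis
      unfolding eq True using ker_bound_ge_1[where ?'a = 'a] weight_pos[of \<kappa>] by simp
  next
    case False
    then have nz: "?f c \<noteq> 0" if "c \<in> Basis" for c using that by auto
    have "near (\<kappa> c) (z \<bullet> c) (Z \<bullet> c)" if "c \<in> Basis" for c
      using nz[OF that] near_primf[OF _ that assms(1,2), of z Z] near_beta'[of "\<kappa>' d" "z \<bullet> d" "Z \<bullet> d" "\<kappa> d"] assms(6)
      by (auto split: if_splits)
    then have Z: "Z \<in> nbhd \<kappa> z" using near_nbhd assms(7) by blast
    have "\<bar>\<Prod>c\<in>Basis. ?f c\<bar> \<le> (\<Prod>c\<in>Basis. 4 * M * ((if c = a then 1 else 2 ^ \<kappa> c) * (if c = d then 2 ^ \<kappa> d else 1)))"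
      unfolding abs_prod
    proof (rule prod_mono, safe)
      fix c :: 'a assume c: "c \<in> Basis"
      show "\<bar>?f c\<bar> \<le> 4 * M * ((if c = a then 1 else 2 ^ \<kappa> c) * (if c = d then 2 ^ \<kappa> d else 1))"
      proof (cases "c = d")
        case True
        have "M * 4 ^ \<kappa> d \<le> 4 * (M * 4 ^ \<kappa> d)" using M by simp
        then show ?thesis
          using True beta'_le[of "\<kappa> d" "z \<bullet> d" "Z \<bullet> d"] assms(5,6)
          by (simp add: mult.assoc flip: power_mult_distrib)
      qed (use abs_primf_le[OF assms(1) c] in auto)
    qed auto
    also have "\<dots> = ker_bound TYPE('a) * (weight \<kappa> / 2 ^ \<kappa> a * 2 ^ \<kappa> d)"
      using assms(4) by (simp add: prod.distrib ker_bound_def prod_weight[OF assms(3)])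
    finally show ?thesis using eq Z by (simp add: mult.commute)
  qed
qed

lemma ker_nonneg: "0 \<le> ker \<kappa> z Z"
  by (auto simp: ker_def tensor_def intro!: prod_nonneg beta_nonneg)

lemma ker_le:
  assumes "\<And>c. c \<in> Basis \<Longrightarrow> \<bar>z \<bullet> c\<bar> \<le> 1"
  shows "ker \<kappa> z Z \<le> ker_bound TYPE('a) * weight \<kappa> * indicator (nbhd \<kappa> z) (Z::'a::euclidean_space)"
proof (cases "ker \<kappa> z Z = 0")
  case True
  then show ?thesis using ker_bound_ge_1[where ?'a = 'a] weight_pos[of \<kappa>] by (simp add: indicator_def)
next
  case False
  have "Z \<in> nbhd \<kappa> z"
    using near_nbhd[OF near_ker[OF False]] assms by blast
  have "ker \<kappa> z Z \<le> (\<Prod>c\<in>Basis. 4 * M * 2 ^ \<kappa> c)"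
    unfolding ker_def tensor_def
  proof (rule prod_mono, safe)
    fix c :: 'a
    have "M * 2 ^ \<kappa> c \<le> 4 * (M * 2 ^ \<kappa> c)" using M by simp
    then show "beta (\<kappa> c) (z \<bullet> c) (Z \<bullet> c) \<le> 4 * M * 2 ^ \<kappa> c"
      using beta_le[of "\<kappa> c" "z \<bullet> c" "Z \<bullet> c"] by simp
  qed (rule beta_nonneg)
  also have "\<dots> = ker_bound TYPE('a) * weight \<kappa>"
    by (simp add: prod.distrib ker_bound_def weight_def)
  finally show ?thesis using \<open>Z \<in> nbhd \<kappa> z\<close> by simp
qed

lemma continuous_b: "continuous_on A b"
  using C_k_continuous[OF b_smooth] continuous_on_subset by blast

lemma measurable_b [measurable]: "b \<in> borel_measurable borel"
  using continuous_b by (rule borel_measurable_continuous_onI)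

lemma measurable_ker [measurable]: "(\<lambda>(z, Z). ker \<kappa> z Z) \<in> borel_measurable (borel \<Otimes>\<^sub>M borel)"
  unfolding ker_def tensor_def beta_def by measurable

lemma beta_mass: "(\<integral>\<^sup>+X. ennreal (beta k x X) \<partial>lborel) = 1"
proof -
  define a c where "a = x - (s + x) / 2 ^ k" and "c = x + (s - x) / 2 ^ k"
  have arg: "2 ^ k * (a - x) + x = - s" "2 ^ k * (c - x) + x = s"
    by (auto simp: a_def c_def)
  have "a \<le> c" using s by (simp add: a_def c_def field_simps)
  have "beta k x X = 0" if "X \<notin> {a..c}" for X
  proof -
    have "2 ^ k * (X - x) < 2 ^ k * (a - x) \<or> 2 ^ k * (c - x) < 2 ^ k * (X - x)"
      using that by auto
    then have "2 ^ k * (X - x) + x < - s \<or> s < 2 ^ k * (X - x) + x"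
      using arg by linarith
    then show ?thesis using s by (auto simp: beta_def intro!: b_out)
  qed
  then have "(\<integral>\<^sup>+X. ennreal (beta k x X) \<partial>lborel) = (\<integral>\<^sup>+X. ennreal (beta k x X) * indicator {a..c} X \<partial>lborel)"
    by (intro nn_integral_cong) (auto simp: indicator_def)
  also have "\<dots> = ennreal (beta_integral k x c - beta_integral k x a)"
    by (rule nn_integral_FTC_Icc)
      (auto simp: beta_nonneg \<open>a \<le> c\<close> intro: beta_integral_deriv borel_measurable_continuous_onI C_k_continuous[OF beta_smooth])
  also have "beta_integral k x c - beta_integral k x a = 1"
    using I_left[of "- s"] I_right[of s] by (simp add: beta_integral_def arg)
  finally show ?thesis by simp
qed

lemma ker_mass: "(\<integral>\<^sup>+Z. ennreal (ker \<kappa> z Z) \<partial>lborel) = 1"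
proof -
  have "(\<integral>\<^sup>+Z. ennreal (ker \<kappa> z Z) \<partial>lborel) = (\<integral>\<^sup>+Z. (\<Prod>c\<in>Basis. ennreal (beta (\<kappa> c) (z \<bullet> c) (Z \<bullet> c))) \<partial>lborel)"
    by (simp add: ker_def tensor_def prod_ennreal beta_nonneg)
  also have "\<dots> = (\<Prod>c\<in>Basis. \<integral>\<^sup>+X. ennreal (beta (\<kappa> c) (z \<bullet> c) X) \<partial>lborel)"
    by (rule nn_integral_lborel_prod)
      (auto intro: measurable_compose[OF borel_measurable_continuous_onI[OF C_k_continuous[OF beta_smooth]] measurable_ennreal])
  also have "\<dots> = 1" by (simp add: beta_mass)
  finally show ?thesis .
qed

end


section \<open>Averages over anisotropic boxes\<close>

lemma nbhd_sym: "Z \<in> nbhd \<kappa> z \<longleftrightarrow> z \<in> nbhd \<kappa> Z"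
  by (simp add: nbhd_def abs_minus_commute)

lemma measurable_nbhd [measurable]:
  "Measurable.pred (borel \<Otimes>\<^sub>M borel) (\<lambda>(z, Z). Z \<in> nbhd \<kappa> z)"
  unfolding nbhd_def mem_Collect_eq by measurable

lemma nbhd_cbox:
  "nbhd \<kappa> z = cbox (z - (\<Sum>b\<in>Basis. (2 / 2 ^ \<kappa> b) *\<^sub>R b)) (z + (\<Sum>b\<in>Basis. (2 / 2 ^ \<kappa> b) *\<^sub>R b))"
  by (auto simp: nbhd_def cbox_def inner_simps abs_le_iff algebra_simps)

lemma emeasure_nbhd: "emeasure lborel (nbhd \<kappa> (z::'a::euclidean_space)) = ennreal (4 ^ DIM('a) / weight \<kappa>)"
  unfolding nbhd_cbox emeasure_lborel_cbox_eq
  by (auto simp: inner_simps weight_def prod_dividef prod_ennreal[symmetric] intro!: arg_cong[where f=ennreal])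

text \<open>
  Averaging over boxes preserves the integral up to a constant, by Tonelli and the symmetry of the relation
  \<open>Z \<in> nbhd \<kappa> z\<close>.
\<close>

lemma nn_integral_average:
  fixes f :: "'a::euclidean_space \<Rightarrow> ennreal"
  assumes [measurable]: "f \<in> borel_measurable borel"
  shows "(\<integral>\<^sup>+z. ennreal (weight \<kappa>) * (\<integral>\<^sup>+Z. f Z * indicator (nbhd \<kappa> z) Z \<partial>lborel) \<partial>lborel)
    = ennreal (4 ^ DIM('a)) * (\<integral>\<^sup>+Z. f Z \<partial>lborel)"
proof -
  have [measurable]: "(\<lambda>(z, Z). indicator (nbhd \<kappa> z) Z :: ennreal) \<in> borel_measurable (borel \<Otimes>\<^sub>M borel)"
    using measurable_nbhd[of \<kappa>] by (auto simp: split_beta' indicator_def intro!: measurable_If)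
  have sets: "nbhd \<kappa> Z \<in> sets lborel" for Z :: 'a
    by (simp add: nbhd_cbox)
  have "(\<integral>\<^sup>+z. ennreal (weight \<kappa>) * (\<integral>\<^sup>+Z. f Z * indicator (nbhd \<kappa> z) Z \<partial>lborel) \<partial>lborel)
      = ennreal (weight \<kappa>) * (\<integral>\<^sup>+z. (\<integral>\<^sup>+Z. f Z * indicator (nbhd \<kappa> z) Z \<partial>lborel) \<partial>lborel)"
    by (rule nn_integral_cmult) measurable
  also have "(\<integral>\<^sup>+z. (\<integral>\<^sup>+Z. f Z * indicator (nbhd \<kappa> z) Z \<partial>lborel) \<partial>lborel)
      = (\<integral>\<^sup>+Z. (\<integral>\<^sup>+z. f Z * indicator (nbhd \<kappa> z) Z \<partial>lborel) \<partial>lborel)"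
    by (rule lborel_pair.Fubini') measurable
  also have "\<dots> = (\<integral>\<^sup>+Z. f Z * ennreal (4 ^ DIM('a) / weight \<kappa>) \<partial>lborel)"
  proof (rule nn_integral_cong)
    fix Z :: 'a
    have "(\<integral>\<^sup>+z. f Z * indicator (nbhd \<kappa> z) Z \<partial>lborel) = (\<integral>\<^sup>+z. f Z * indicator (nbhd \<kappa> Z) z \<partial>lborel)"
      using nbhd_sym by (intro nn_integral_cong) (auto simp: indicator_def)
    also have "\<dots> = f Z * ennreal (4 ^ DIM('a) / weight \<kappa>)"
      by (simp add: nn_integral_cmult_indicator[OF sets] emeasure_nbhd)
    finally show "(\<integral>\<^sup>+z. f Z * indicator (nbhd \<kappa> z) Z \<partial>lborel) = f Z * ennreal (4 ^ DIM('a) / weight \<kappa>)" .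
  qed
  also have "\<dots> = ennreal (4 ^ DIM('a) / weight \<kappa>) * (\<integral>\<^sup>+Z. f Z \<partial>lborel)"
    by (simp add: nn_integral_multc mult.commute)
  also have "ennreal (weight \<kappa>) * \<dots> = ennreal (4 ^ DIM('a)) * (\<integral>\<^sup>+Z. f Z \<partial>lborel)"
    using weight_pos[of \<kappa>] by (simp add: mult.assoc[symmetric] ennreal_mult[symmetric])
  finally show ?thesis .
qed

section \<open>Convergence of kernel means\<close>

lemma ennreal_tendsto_0I:
  fixes f :: "nat \<Rightarrow> ennreal"
  assumes "\<And>e::real. 0 < e \<Longrightarrow> eventually (\<lambda>j. f j \<le> ennreal e) sequentially"
  shows "f \<longlonglongrightarrow> 0"
proof (rule order_tendstoI)
  fix a :: ennreal assume "0 < a"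
  then obtain x where x: "0 < x" "x < a" using dense by blast
  then obtain r where r: "x = ennreal r" "0 < r"
    by (cases x) (auto simp: top_unique)
  show "eventually (\<lambda>j. f j < a) sequentially"
    using assms[OF r(2)] by (rule eventually_mono) (use x r in auto)
qed simp

text \<open>
  The function is first truncated at a height \<open>m\<close>, so that the pointwise approximation of measurable functions
  by continuous ones becomes an approximation in the mean on a ball by dominated convergence.
\<close>

lemma L1_continuous_approx:
  fixes v :: "'a::euclidean_space \<Rightarrow> real"
  assumes v: "integrable lborel v" and e: "0 < e"
  obtains g where "continuous_on UNIV g" "(\<integral>\<^sup>+z. ennreal \<bar>v z - g z\<bar> * indicator (cball 0 R) z \<partial>lborel) \<le> ennreal e"
proof -
  have [measurable]: "v \<in> borel_measurable borel" using v by auto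
  have [measurable]: "cball (0::'a) R \<in> sets borel" by simp
  define tr where "tr m x = max (- real m) (min (real m) x)" for m and x :: real
  have tr_le: "\<bar>tr m x - x\<bar> \<le> \<bar>x\<bar>" "\<bar>tr m x\<bar> \<le> real m" for m x by (auto simp: tr_def)
  have [measurable]: "tr m \<in> borel_measurable borel" for m unfolding tr_def[abs_def] by measurable
  have tr_cont: "continuous_on UNIV (tr m)" for m unfolding tr_def[abs_def] by (intro continuous_intros)
  have "(\<lambda>m. \<integral>\<^sup>+z. ennreal \<bar>tr m (v z) - v z\<bar> \<partial>lborel) \<longlonglongrightarrow> (\<integral>\<^sup>+z. 0 \<partial>(lborel::'a measure))"
  proof (rule nn_integral_dominated_convergence[where w="\<lambda>z. ennreal \<bar>v z\<bar>"])
    show "(\<integral>\<^sup>+z. ennreal \<bar>v z\<bar> \<partial>lborel) < \<infinity>"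
      using v by (simp add: integrable_iff_bounded)
    show "AE z in lborel. (\<lambda>m. ennreal \<bar>tr m (v z) - v z\<bar>) \<longlonglongrightarrow> 0"
    proof (rule AE_I2)
      fix z
      obtain m0 where "\<bar>v z\<bar> \<le> real m0" using real_arch_simple by blast
      then have "\<forall>\<^sub>F m in sequentially. 0 = ennreal \<bar>tr m (v z) - v z\<bar>"
        by (intro eventually_sequentiallyI[of m0]) (auto simp: tr_def)
      then show "(\<lambda>m. ennreal \<bar>tr m (v z) - v z\<bar>) \<longlonglongrightarrow> 0"
        by (rule Lim_transform_eventually[OF tendsto_const])
    qed
  qed (auto intro: tr_le)
  then have "eventually (\<lambda>m. (\<integral>\<^sup>+z. ennreal \<bar>tr m (v z) - v z\<bar> \<partial>lborel) < ennreal (e / 2)) sequentially"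
    using e by (intro order_tendstoD) auto
  then obtain m where m: "(\<integral>\<^sup>+z. ennreal \<bar>tr m (v z) - v z\<bar> \<partial>lborel) \<le> ennreal (e / 2)"
    by (auto simp: eventually_sequentially intro: less_imp_le)
  have "v \<in> borel_measurable lebesgue" by (simp add: measurable_completion)
  then have "v measurable_on UNIV"
    by (intro lebesgue_measurable_imp_measurable_on) auto
  then obtain S g where S: "negligible S" and g: "\<And>n. continuous_on UNIV (g n)"
    "\<And>x. x \<notin> S \<Longrightarrow> (\<lambda>n. g n x) \<longlonglongrightarrow> v x"
    unfolding measurable_on_def by auto
  have [measurable]: "g n \<in> borel_measurable borel" for n
    using g(1) by (rule borel_measurable_continuous_onI)
  have "AE x in lebesgue. x \<notin> S"
    using S by (simp add: AE_not_in negligible_iff_null_sets)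
  then have AE_S: "AE x in lborel. x \<notin> S"
    by (simp add: AE_completion_iff)
  have "(\<lambda>n. \<integral>\<^sup>+z. ennreal \<bar>tr m (v z) - tr m (g n z)\<bar> * indicator (cball 0 R) z \<partial>lborel)
      \<longlonglongrightarrow> (\<integral>\<^sup>+z. 0 \<partial>(lborel::'a measure))"
  proof (rule nn_integral_dominated_convergence[where w="\<lambda>z. ennreal (2 * real m) * indicator (cball 0 R) z"])
    show "(\<integral>\<^sup>+z. ennreal (2 * real m) * indicator (cball 0 R) z \<partial>(lborel::'a measure)) < \<infinity>"
      using emeasure_bounded_finite[OF bounded_cball, of "0::'a" R]
      by (subst nn_integral_cmult_indicator) (auto simp: ennreal_mult_less_top)
    show "AE z in lborel. ennreal \<bar>tr m (v z) - tr m (g n z)\<bar> * indicator (cball 0 R) z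
        \<le> ennreal (2 * real m) * indicator (cball 0 R) z" for n
    proof (rule AE_I2, rule mult_right_mono)
      fix z show "ennreal \<bar>tr m (v z) - tr m (g n z)\<bar> \<le> ennreal (2 * real m)"
        using tr_le(2)[of m "v z"] tr_le(2)[of m "g n z"] by (intro ennreal_leI) linarith
    qed simp
    show "AE z in lborel. (\<lambda>n. ennreal \<bar>tr m (v z) - tr m (g n z)\<bar> * indicator (cball 0 R) z) \<longlonglongrightarrow> 0"
      using AE_S
    proof (rule AE_mp, intro AE_I2 impI)
      fix z assume "z \<notin> S"
      from g(2)[OF this] have "(\<lambda>n. tr m (g n z)) \<longlonglongrightarrow> tr m (v z)"
        using tr_cont[of m] by (auto intro: continuous_on_tendsto_compose)
      then have "(\<lambda>n. \<bar>tr m (v z) - tr m (g n z)\<bar>) \<longlonglongrightarrow> \<bar>tr m (v z) - tr m (v z)\<bar>"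
        by (intro tendsto_intros)
      then have "(\<lambda>n. ennreal \<bar>tr m (v z) - tr m (g n z)\<bar>) \<longlonglongrightarrow> ennreal 0"
        by (intro tendsto_ennrealI) simp
      then show "(\<lambda>n. ennreal \<bar>tr m (v z) - tr m (g n z)\<bar> * indicator (cball 0 R) z) \<longlonglongrightarrow> 0"
        by (cases "z \<in> cball 0 R") simp_all
    qed
  qed auto
  then have "eventually (\<lambda>n. (\<integral>\<^sup>+z. ennreal \<bar>tr m (v z) - tr m (g n z)\<bar> * indicator (cball 0 R) z \<partial>lborel)
      < ennreal (e / 2)) sequentially"
    using e by (intro order_tendstoD) auto
  then obtain n where n: "(\<integral>\<^sup>+z. ennreal \<bar>tr m (v z) - tr m (g n z)\<bar> * indicator (cball 0 R) z \<partial>lborel) \<le> ennreal (e / 2)"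
    by (auto simp: eventually_sequentially intro: less_imp_le)
  show thesis
  proof (rule that)
    show "continuous_on UNIV (\<lambda>z. tr m (g n z))"
      using continuous_on_compose2[OF tr_cont g(1)] by simp
    have "(\<integral>\<^sup>+z. ennreal \<bar>v z - tr m (g n z)\<bar> * indicator (cball 0 R) z \<partial>lborel)
        \<le> (\<integral>\<^sup>+z. ennreal \<bar>tr m (v z) - v z\<bar> + ennreal \<bar>tr m (v z) - tr m (g n z)\<bar> * indicator (cball 0 R) z \<partial>lborel)"
      by (intro nn_integral_mono) (auto simp: indicator_def ennreal_plus[symmetric] simp del: ennreal_plus intro!: ennreal_leI)
    also have "\<dots> = (\<integral>\<^sup>+z. ennreal \<bar>tr m (v z) - v z\<bar> \<partial>lborel)
        + (\<integral>\<^sup>+z. ennreal \<bar>tr m (v z) - tr m (g n z)\<bar> * indicator (cball 0 R) z \<partial>lborel)"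
      by (intro nn_integral_add) auto
    also have "\<dots> \<le> ennreal (e / 2) + ennreal (e / 2)"
      by (intro add_mono m n)
    also have "\<dots> = ennreal e" using e by (simp add: ennreal_plus[symmetric] del: ennreal_plus)
    finally show "(\<integral>\<^sup>+z. ennreal \<bar>v z - tr m (g n z)\<bar> * indicator (cball 0 R) z \<partial>lborel) \<le> ennreal e" .
  qed
qed

context smooth_step begin

lemma measurable_ker1 [measurable]: "ker \<kappa> z \<in> borel_measurable borel"
  unfolding ker_def tensor_def[abs_def] beta_def by measurable

lemma integrable_ker: "integrable lborel (ker \<kappa> z)" and integral_ker: "(\<integral>Z. ker \<kappa> z Z \<partial>lborel) = 1"
proof -
  show 1: "integrable lborel (ker \<kappa> z)"
    using ker_mass[of \<kappa> z] by (simp add: integrable_iff_bounded ker_nonneg)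
  show "(\<integral>Z. ker \<kappa> z Z \<partial>lborel) = 1"
    by (simp add: integral_eq_nn_integral ker_nonneg ker_mass)
qed

lemma integrable_ker_mult:
  fixes v :: "'a::euclidean_space \<Rightarrow> real"
  assumes "integrable lborel v" "\<And>c. c \<in> Basis \<Longrightarrow> \<bar>z \<bullet> c\<bar> \<le> 1"
  shows "integrable lborel (\<lambda>Z. ker \<kappa> z Z * v Z)"
proof (rule Bochner_Integration.integrable_bound[of _ "\<lambda>Z. ker_bound TYPE('a) * weight \<kappa> * v Z"])
  show "AE Z in lborel. norm (ker \<kappa> z Z * v Z) \<le> norm (ker_bound TYPE('a) * weight \<kappa> * v Z)"
  proof (rule AE_I2)
    fix Z
    have "ker \<kappa> z Z \<le> ker_bound TYPE('a) * weight \<kappa> * indicator (nbhd \<kappa> z) Z"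
      by (rule ker_le[OF assms(2)])
    also have "\<dots> \<le> ker_bound TYPE('a) * weight \<kappa> * 1"
      using ker_bound_ge_1[where ?'a='a] weight_pos[of \<kappa>] by (intro mult_left_mono) (auto simp: indicator_def)
    finally have "ker \<kappa> z Z \<le> ker_bound TYPE('a) * weight \<kappa>" by simp
    then show "norm (ker \<kappa> z Z * v Z) \<le> norm (ker_bound TYPE('a) * weight \<kappa> * v Z)"
      using ker_nonneg[of \<kappa> z Z] ker_bound_ge_1[where ?'a='a] weight_pos[of \<kappa>]
      by (simp add: abs_mult mult_right_mono)
  qed
qed (use assms in auto)

text \<open>
  For a continuous function the kernel means converge uniformly. The error made by replacing \<open>v\<close> by a
  continuous function is controlled in the mean by \<open>nn_integral_average\<close>, uniformly in the scales; convergence in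
  the mean therefore needs no relation between the scales of different coordinates.
\<close>

lemma ker_approx_identity:
  fixes v :: "'a::euclidean_space \<Rightarrow> real"
  assumes v: "integrable lborel v" and U [measurable]: "U \<in> sets borel"
    and U1: "\<And>z c. z \<in> U \<Longrightarrow> c \<in> Basis \<Longrightarrow> \<bar>z \<bullet> c\<bar> \<le> 1"
    and \<kappa>: "\<And>b. b \<in> Basis \<Longrightarrow> filterlim (\<lambda>j. \<kappa> j b) at_top sequentially"
  shows "(\<lambda>j. \<integral>\<^sup>+z. ennreal \<bar>(\<integral>Z. ker (\<kappa> j) z Z * v Z \<partial>lborel) - v z\<bar> * indicator U z \<partial>lborel) \<longlonglongrightarrow> 0"
proof (rule ennreal_tendsto_0I)
  fix e :: real assume e: "0 < e"
  have [measurable]: "v \<in> borel_measurable borel" using v by auto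
  define R where "R = 3 * real DIM('a)"
  have R: "Z \<in> cball 0 R" if "\<And>c. c \<in> Basis \<Longrightarrow> \<bar>Z \<bullet> c\<bar> \<le> 3" for Z :: 'a
  proof -
    have "norm Z \<le> (\<Sum>b\<in>Basis. \<bar>Z \<bullet> b\<bar>)" by (rule norm_le_l1)
    also have "\<dots> \<le> (\<Sum>b\<in>(Basis::'a set). 3)" by (intro sum_mono that)
    finally show ?thesis by (simp add: R_def mult.commute)
  qed
  have U_R: "U \<subseteq> cball 0 R"
  proof
    fix z assume "z \<in> U"
    show "z \<in> cball 0 R" by (rule R) (use U1[OF \<open>z \<in> U\<close>] in force)
  qed
  have nbhd_R: "nbhd k z \<subseteq> cball 0 R" if "z \<in> U" for z k
  proof
    fix Z assume Z: "Z \<in> nbhd k z"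
    show "Z \<in> cball 0 R"
    proof (rule R)
      fix c :: 'a assume c: "c \<in> Basis"
      have "2 / 2 ^ k c \<le> (2::real)" by (simp add: field_simps)
      moreover have "\<bar>Z \<bullet> c - z \<bullet> c\<bar> \<le> 2 / 2 ^ k c" using Z c by (simp add: nbhd_def)
      ultimately show "\<bar>Z \<bullet> c\<bar> \<le> 3" using U1[OF that c] by linarith
    qed
  qed
  have [measurable]: "cball (0::'a) R \<in> sets borel" by simp
  define C where "C = ker_bound TYPE('a) * 4 ^ DIM('a) + 1"
  have C: "1 \<le> C" using ker_bound_ge_1[where ?'a='a] by (simp add: C_def)
  define m where "m = measure lborel (cball (0::'a) R)"
  have emU: "emeasure lborel U \<le> ennreal m"
    using emeasure_mono[OF U_R, of lborel] emeasure_bounded_finite[OF bounded_cball, of "0::'a" R]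
    by (simp add: m_def emeasure_eq_ennreal_measure)
  define e1 where "e1 = e / (2 * C)"
  define \<eta> where "\<eta> = e / (2 * (m + 1))"
  have m0: "0 \<le> m" by (simp add: m_def)
  have e1: "0 < e1" "C * e1 = e / 2" and \<eta>: "0 < \<eta>" "\<eta> * m \<le> e / 2"
    using e C m0 by (auto simp: e1_def \<eta>_def field_simps)
  obtain g where g: "continuous_on UNIV g"
    and gv: "(\<integral>\<^sup>+z. ennreal \<bar>v z - g z\<bar> * indicator (cball 0 R) z \<partial>lborel) \<le> ennreal e1"
    using L1_continuous_approx[OF v e1(1)] by blast
  have [measurable]: "g \<in> borel_measurable borel"
    using g by (rule borel_measurable_continuous_onI)
  have "uniformly_continuous_on (cball 0 R) g"
    using g continuous_on_subset by (intro compact_uniformly_continuous) auto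
  then obtain d where d: "0 < d" "\<And>z Z. z \<in> cball 0 R \<Longrightarrow> Z \<in> cball 0 R \<Longrightarrow> dist Z z < d \<Longrightarrow> dist (g Z) (g z) < \<eta>"
    using \<eta>(1) unfolding uniformly_continuous_on_def by metis
  have "(\<lambda>j. \<Sum>b\<in>(Basis::'a set). 2 * (1 / 2) ^ \<kappa> j b) \<longlonglongrightarrow> (\<Sum>b\<in>(Basis::'a set). 2 * (0::real))"
    by (intro tendsto_intros filterlim_compose[OF LIMSEQ_power_zero \<kappa>]) auto
  then have "eventually (\<lambda>j. (\<Sum>b\<in>(Basis::'a set). 2 * (1 / 2) ^ \<kappa> j b) < d) sequentially"
    using d(1) by (intro order_tendstoD) auto
  then show "eventually (\<lambda>j. (\<integral>\<^sup>+z. ennreal \<bar>(\<integral>Z. ker (\<kappa> j) z Z * v Z \<partial>lborel) - v z\<bar> * indicator U z \<partial>lborel) \<le> ennreal e) sequentially"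
  proof (rule eventually_mono)
    fix j assume j: "(\<Sum>b\<in>(Basis::'a set). 2 * (1 / 2) ^ \<kappa> j b) < d"
    let ?k = "\<kappa> j"
    define f where "f Z = ennreal \<bar>v Z - g Z\<bar> * indicator (cball 0 R) Z" for Z
    have [measurable]: "f \<in> borel_measurable borel" unfolding f_def[abs_def] by measurable
    define A where "A z = ennreal (weight ?k) * (\<integral>\<^sup>+Z. f Z * indicator (nbhd ?k z) Z \<partial>lborel)" for z
    have [measurable]: "(\<lambda>(z, Z). indicator (nbhd ?k z) Z :: ennreal) \<in> borel_measurable (borel \<Otimes>\<^sub>M borel)"
      using measurable_nbhd[of ?k] by (auto simp: split_beta' indicator_def intro!: measurable_If)
    have [measurable]: "A \<in> borel_measurable borel" unfolding A_def[abs_def] by measurable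
    have lin: "ennreal (c1 * (w * a) + t * k + c * k) =
        ennreal c1 * (ennreal w * ennreal a) + ennreal t * ennreal k + ennreal c * ennreal k"
      if "0 \<le> c1" "0 \<le> w" "0 \<le> a" "0 \<le> t" "0 \<le> k" "0 \<le> c" for c1 w a t k c :: real
      using that by (simp add: ennreal_mult)
    have lin': "ennreal (c1 * (w * a) + t * k + a) =
        ennreal c1 * (ennreal w * ennreal a) + ennreal t * ennreal k + ennreal a"
      if "0 \<le> c1" "0 \<le> w" "0 \<le> a" "0 \<le> t" "0 \<le> k" for c1 w a t k :: real
      using that by (simp add: ennreal_mult)
    have fint: "(\<integral>\<^sup>+z. f z \<partial>lborel) \<le> ennreal e1" unfolding f_def using gv by simp
    have pw: "ennreal \<bar>(\<integral>Z. ker ?k z Z * v Z \<partial>lborel) - v z\<bar> * indicator U z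
        \<le> ennreal (ker_bound TYPE('a)) * A z + ennreal \<eta> * indicator U z + f z" for z
    proof (cases "z \<in> U")
      case True
      note z1 = U1[OF True]
      have "(\<integral>Z. ker ?k z Z * v Z \<partial>lborel) - v z = (\<integral>Z. ker ?k z Z * (v Z - v z) \<partial>lborel)"
        using integrable_ker_mult[OF v z1, of ?k] integrable_ker[of ?k z] integral_ker[of ?k z]
        by (simp add: right_diff_distrib)
      also have "ennreal \<bar>\<dots>\<bar> \<le> (\<integral>\<^sup>+Z. ennreal (norm (ker ?k z Z * (v Z - v z))) \<partial>lborel)"
        using integrable_ker_mult[OF v z1, of ?k] integrable_ker[of ?k z]
        by (intro order_trans[OF _ integral_norm_bound_ennreal]) (auto simp: right_diff_distrib)
      also have "\<dots> \<le> (\<integral>\<^sup>+Z. ennreal (ker_bound TYPE('a)) * (ennreal (weight ?k) * (f Z * indicator (nbhd ?k z) Z))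
          + ennreal \<eta> * ennreal (ker ?k z Z) + f z * ennreal (ker ?k z Z) \<partial>lborel)"
      proof (intro nn_integral_mono)
        fix Z
        show "ennreal (norm (ker ?k z Z * (v Z - v z))) \<le> ennreal (ker_bound TYPE('a)) * (ennreal (weight ?k) * (f Z * indicator (nbhd ?k z) Z))
          + ennreal \<eta> * ennreal (ker ?k z Z) + f z * ennreal (ker ?k z Z)"
        proof (cases "ker ?k z Z = 0")
          case False
          have Z: "Z \<in> nbhd ?k z" using near_nbhd[OF near_ker[OF False]] z1 by blast
          then have ZR: "Z \<in> cball 0 R" and zR: "z \<in> cball 0 R" using nbhd_R[OF True] U_R True by blast+
          have "dist Z z \<le> (\<Sum>b\<in>Basis. \<bar>(Z - z) \<bullet> b\<bar>)"
            unfolding dist_norm by (rule norm_le_l1)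
          also have "\<dots> \<le> (\<Sum>b\<in>Basis. 2 * (1 / 2) ^ ?k b)"
            using Z by (intro sum_mono) (auto simp: nbhd_def inner_simps power_divide)
          finally have "\<bar>g Z - g z\<bar> \<le> \<eta>" using d(2)[OF zR ZR] j by (simp add: dist_real_def)
          then have "\<bar>v Z - v z\<bar> \<le> \<bar>v Z - g Z\<bar> + \<eta> + \<bar>v z - g z\<bar>" by linarith
          then have "ker ?k z Z * \<bar>v Z - v z\<bar> \<le> ker ?k z Z * (\<bar>v Z - g Z\<bar> + \<eta> + \<bar>v z - g z\<bar>)"
            by (rule mult_left_mono[OF _ ker_nonneg])
          also have "\<dots> = ker ?k z Z * \<bar>v Z - g Z\<bar> + \<eta> * ker ?k z Z + \<bar>v z - g z\<bar> * ker ?k z Z"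
            by (simp only: distrib_left mult.commute)
          also have "ker ?k z Z * \<bar>v Z - g Z\<bar> \<le> ker_bound TYPE('a) * weight ?k * \<bar>v Z - g Z\<bar>"
            using ker_le[OF z1, where \<kappa>="?k" and Z=Z] Z by (intro mult_right_mono) simp_all
          finally have "ker ?k z Z * \<bar>v Z - v z\<bar> \<le> ker_bound TYPE('a) * (weight ?k * \<bar>v Z - g Z\<bar>) + \<eta> * ker ?k z Z + \<bar>v z - g z\<bar> * ker ?k z Z"
            by (simp only: mult.assoc add_le_cancel_right)
          then have "ennreal (ker ?k z Z * \<bar>v Z - v z\<bar>) \<le> ennreal (ker_bound TYPE('a) * (weight ?k * \<bar>v Z - g Z\<bar>) + \<eta> * ker ?k z Z + \<bar>v z - g z\<bar> * ker ?k z Z)"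
            by (rule ennreal_leI)
          also have "\<dots> = ennreal (ker_bound TYPE('a)) * (ennreal (weight ?k) * ennreal \<bar>v Z - g Z\<bar>)
              + ennreal \<eta> * ennreal (ker ?k z Z) + ennreal \<bar>v z - g z\<bar> * ennreal (ker ?k z Z)"
            using ker_bound_ge_1[where ?'a='a] \<eta>(1) by (intro lin) (simp_all add: ker_nonneg less_imp_le[OF weight_pos])
          also have "\<dots> = ennreal (ker_bound TYPE('a)) * (ennreal (weight ?k) * (f Z * indicator (nbhd ?k z) Z))
              + ennreal \<eta> * ennreal (ker ?k z Z) + f z * ennreal (ker ?k z Z)"
            using Z ZR zR by (simp only: f_def indicator_simps mult_1_right)
          also have "ker ?k z Z * \<bar>v Z - v z\<bar> = norm (ker ?k z Z * (v Z - v z))"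
            using ker_nonneg[of ?k z Z] by (simp add: abs_mult)
          finally show ?thesis .
        qed simp
      qed
      also have "\<dots> = ennreal (ker_bound TYPE('a)) * A z + ennreal \<eta> * (\<integral>\<^sup>+Z. ennreal (ker ?k z Z) \<partial>lborel)
          + f z * (\<integral>\<^sup>+Z. ennreal (ker ?k z Z) \<partial>lborel)"
        by (simp add: nn_integral_add nn_integral_cmult A_def)
      finally show ?thesis using True by (simp add: ker_mass)
    qed simp
    have "(\<integral>\<^sup>+z. ennreal \<bar>(\<integral>Z. ker ?k z Z * v Z \<partial>lborel) - v z\<bar> * indicator U z \<partial>lborel)
        \<le> (\<integral>\<^sup>+z. ennreal (ker_bound TYPE('a)) * A z + ennreal \<eta> * indicator U z + f z \<partial>lborel)"
      by (intro nn_integral_mono pw)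
    also have "\<dots> = ennreal (ker_bound TYPE('a)) * (\<integral>\<^sup>+z. A z \<partial>lborel) + ennreal \<eta> * emeasure lborel U + (\<integral>\<^sup>+z. f z \<partial>lborel)"
      by (simp add: nn_integral_add nn_integral_cmult)
    also have "\<dots> \<le> ennreal (ker_bound TYPE('a)) * (ennreal (4 ^ DIM('a)) * ennreal e1) + ennreal \<eta> * ennreal m + ennreal e1"
    proof (intro add_mono mult_left_mono emU)
      show "(\<integral>\<^sup>+z. A z \<partial>lborel) \<le> ennreal (4 ^ DIM('a)) * ennreal e1"
        unfolding A_def by (subst nn_integral_average) (use fint in \<open>auto intro!: mult_left_mono\<close>)
    qed (use fint in auto)
    also have "\<dots> = ennreal (ker_bound TYPE('a) * (4 ^ DIM('a) * e1) + \<eta> * m + e1)"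
      using ker_bound_ge_1[where ?'a='a] e1(1) \<eta>(1) m0 by (intro lin'[symmetric]) auto
    also have "ker_bound TYPE('a) * (4 ^ DIM('a) * e1) + \<eta> * m + e1 = C * e1 + \<eta> * m"
      by (simp add: C_def distrib_right)
    also have "ennreal \<dots> \<le> ennreal e" using e1 \<eta> by (intro ennreal_leI) simp
    finally show "(\<integral>\<^sup>+z. ennreal \<bar>(\<integral>Z. ker ?k z Z * v Z \<partial>lborel) - v z\<bar> * indicator U z \<partial>lborel) \<le> ennreal e" .
  qed
qed

text \<open>
  Convergence in the mean is enough: for one chain of scales, almost everywhere convergence along a subsequence
  identifies the limit of the telescoping sum. This avoids a differentiation theorem for boxes of unbounded
  eccentricity.
\<close>

lemma ker_AE_subseq:
  fixes v :: "'a::euclidean_space \<Rightarrow> nat \<Rightarrow> real"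
  assumes v: "\<And>i. i < N \<Longrightarrow> integrable lborel (\<lambda>z. v z i)" and U [measurable]: "U \<in> sets borel"
    and U1: "\<And>z c. z \<in> U \<Longrightarrow> c \<in> Basis \<Longrightarrow> \<bar>z \<bullet> c\<bar> \<le> 1"
    and \<kappa>: "\<And>b. b \<in> Basis \<Longrightarrow> filterlim (\<lambda>j. \<kappa> j b) at_top sequentially"
  shows "\<exists>r. strict_mono r \<and> (AE z in lborel. z \<in> U \<longrightarrow>
    (\<forall>i<N. (\<lambda>j. \<integral>Z. ker (\<kappa> (r j)) z Z * v Z i \<partial>lborel) \<longlonglongrightarrow> v z i))"
proof -
  define D where "D j i z = \<bar>(\<integral>Z. ker (\<kappa> j) z Z * v Z i \<partial>lborel) - v z i\<bar> * indicator U z" for j i z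
  define u where "u j z = (\<Sum>i<N. D j i z)" for j z
  have vm: "(\<lambda>z. v z i) \<in> borel_measurable borel" if "i < N" for i
    using borel_measurable_integrable[OF v[OF that]] by simp
  have Dm: "D j i \<in> borel_measurable borel" if "i < N" for j i
  proof -
    define w where "w z = v z i" for z
    have [measurable]: "w \<in> borel_measurable borel" unfolding w_def by (rule vm[OF that])
    have "(\<lambda>z. \<bar>(\<integral>Z. ker (\<kappa> j) z Z * w Z \<partial>lborel) - w z\<bar> * indicator U z) \<in> borel_measurable borel"
      by measurable
    then show ?thesis unfolding D_def[abs_def] w_def .
  qed
  have D0: "0 \<le> D j i z" for j i z by (simp add: D_def)
  have u0: "0 \<le> u j z" for j z by (simp add: u_def D0 sum_nonneg)
  have um: "u j \<in> borel_measurable borel" for j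
    unfolding u_def[abs_def] by (intro borel_measurable_sum Dm) simp
  have "(\<lambda>j. \<integral>\<^sup>+z. ennreal (D j i z) \<partial>lborel) \<longlonglongrightarrow> 0" if "i < N" for i
    using ker_approx_identity[OF v[OF that] U U1 \<kappa>]
    by (simp add: D_def ennreal_mult ennreal_indicator)
  then have "(\<lambda>j. \<Sum>i<N. \<integral>\<^sup>+z. ennreal (D j i z) \<partial>lborel) \<longlonglongrightarrow> (\<Sum>i<N. 0)"
    by (intro tendsto_sum) auto
  also have "(\<lambda>j. \<Sum>i<N. \<integral>\<^sup>+z. ennreal (D j i z) \<partial>lborel) = (\<lambda>j. \<integral>\<^sup>+z. ennreal (u j z) \<partial>lborel)"
  proof
    fix j
    have "(\<integral>\<^sup>+z. ennreal (u j z) \<partial>lborel) = (\<integral>\<^sup>+z. (\<Sum>i<N. ennreal (D j i z)) \<partial>lborel)"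
      by (simp add: u_def sum_ennreal D0)
    also have "\<dots> = (\<Sum>i<N. \<integral>\<^sup>+z. ennreal (D j i z) \<partial>lborel)"
      by (rule nn_integral_sum) (use measurable_compose[OF Dm measurable_ennreal] in simp)
    finally show "(\<Sum>i<N. \<integral>\<^sup>+z. ennreal (D j i z) \<partial>lborel) = (\<integral>\<^sup>+z. ennreal (u j z) \<partial>lborel)" ..
  qed
  finally have lim: "(\<lambda>j. \<integral>\<^sup>+z. ennreal (u j z) \<partial>lborel) \<longlonglongrightarrow> 0" by simp
  then have "eventually (\<lambda>j. (\<integral>\<^sup>+z. ennreal (u j z) \<partial>lborel) < 1) sequentially"
    by (intro order_tendstoD) auto
  then obtain J where J: "\<And>j. J \<le> j \<Longrightarrow> (\<integral>\<^sup>+z. ennreal (u j z) \<partial>lborel) < 1"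
    by (auto simp: eventually_sequentially)
  have int: "integrable lborel (u (j + J))" for j
    using order_less_trans[OF J[of "j + J"]] u0 um by (simp add: integrable_iff_bounded)
  have "(\<lambda>j. \<integral>z. norm (u (j + J) z) \<partial>lborel) \<longlonglongrightarrow> 0"
  proof -
    have "(\<lambda>j. enn2real (\<integral>\<^sup>+z. ennreal (u (j + J) z) \<partial>lborel)) \<longlonglongrightarrow> enn2real 0"
      by (rule tendsto_enn2real) (use LIMSEQ_ignore_initial_segment[OF lim, of J] in auto)
    then show ?thesis
      using u0 um by (simp add: integral_eq_nn_integral)
  qed
  from tendsto_L1_AE_subseq[OF int this]
  obtain r where r: "strict_mono r" "AE z in lborel. (\<lambda>n. u (r n + J) z) \<longlonglongrightarrow> 0" by blast
  show ?thesis
  proof (intro exI conjI)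
    show "strict_mono (\<lambda>n. r n + J)" using r(1) by (simp add: strict_mono_def)
    show "AE z in lborel. z \<in> U \<longrightarrow> (\<forall>i<N. (\<lambda>j. \<integral>Z. ker (\<kappa> (r j + J)) z Z * v Z i \<partial>lborel) \<longlonglongrightarrow> v z i)"
      using r(2)
    proof (rule AE_mp, intro AE_I2 impI allI)
      fix z i assume lim: "(\<lambda>n. u (r n + J) z) \<longlonglongrightarrow> 0" and z: "z \<in> U" and i: "i < N"
      have "\<bar>(\<integral>Z. ker (\<kappa> j) z Z * v Z i \<partial>lborel) - v z i\<bar> \<le> u j z" for j
      proof -
        have "D j i z \<le> u j z" unfolding u_def using i D0 by (intro member_le_sum) auto
        then show ?thesis using z by (simp add: D_def)
      qed
      then have "(\<lambda>n. (\<integral>Z. ker (\<kappa> (r n + J)) z Z * v Z i \<partial>lborel) - v z i) \<longlonglongrightarrow> 0"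
        by (intro Lim_null_comparison[OF _ lim]) auto
      then show "(\<lambda>j. \<integral>Z. ker (\<kappa> (r j + J)) z Z * v Z i \<partial>lborel) \<longlonglongrightarrow> v z i"
        by (simp add: LIM_zero_iff)
    qed
  qed
qed

end


section \<open>The chain of scales\<close>

text \<open>
  The time scale at the space scale \<open>j\<close> grows like \<open>\<alpha> j\<close> up to the level \<open>K\<close> and like \<open>2 j\<close> afterwards.
\<close>

definition path :: "real \<Rightarrow> nat \<Rightarrow> nat \<Rightarrow> nat" where
  "path \<alpha> K j = (if j \<le> K then nat \<lfloor>\<alpha> * real j\<rfloor> else nat \<lfloor>\<alpha> * real K\<rfloor> + 2 * (j - K))"

lemma path_0: "path \<alpha> K 0 = 0" by (simp add: path_def)

lemma nat_floor_bounds: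
  assumes "0 \<le> x"
  shows "real (nat \<lfloor>x\<rfloor>) \<le> x" "x < real (nat \<lfloor>x\<rfloor>) + 1"
  using assms by auto

lemma path_low:
  assumes "0 < \<alpha>" "j < K"
  shows "path \<alpha> K j \<le> path \<alpha> K (Suc j)" "real (path \<alpha> K (Suc j)) \<le> \<alpha> * real j + \<alpha>"
    "\<alpha> * real j - 1 \<le> real (path \<alpha> K j)"
proof -
  have 1: "path \<alpha> K j = nat \<lfloor>\<alpha> * real j\<rfloor>" "path \<alpha> K (Suc j) = nat \<lfloor>\<alpha> * real (Suc j)\<rfloor>"
    using assms by (auto simp: path_def)
  show "path \<alpha> K j \<le> path \<alpha> K (Suc j)"
    unfolding 1 using assms by (intro nat_mono floor_mono mult_left_mono) auto
  show "real (path \<alpha> K (Suc j)) \<le> \<alpha> * real j + \<alpha>"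
    unfolding 1 using nat_floor_bounds(1)[of "\<alpha> * real (Suc j)"] assms by (simp add: algebra_simps)
  show "\<alpha> * real j - 1 \<le> real (path \<alpha> K j)"
    unfolding 1 using nat_floor_bounds(2)[of "\<alpha> * real j"] assms by simp
qed

lemma path_high:
  assumes "0 < \<alpha>"
  shows "path \<alpha> K (Suc (K + i)) = path \<alpha> K (K + i) + 2"
    "real (path \<alpha> K (K + i)) \<le> \<alpha> * real K + 2 * real i" "\<alpha> * real K - 1 + 2 * real i \<le> real (path \<alpha> K (K + i))"
proof -
  have 1: "path \<alpha> K (K + i) = nat \<lfloor>\<alpha> * real K\<rfloor> + 2 * i" for i
    by (cases i) (auto simp: path_def)
  show "path \<alpha> K (Suc (K + i)) = path \<alpha> K (K + i) + 2"
    using 1[of "Suc i"] 1[of i] by simp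
  show "real (path \<alpha> K (K + i)) \<le> \<alpha> * real K + 2 * real i" "\<alpha> * real K - 1 + 2 * real i \<le> real (path \<alpha> K (K + i))"
    using nat_floor_bounds[of "\<alpha> * real K"] assms by (auto simp: 1)
qed

lemma filterlim_path:
  "filterlim (path \<alpha> K) at_top sequentially"
proof (rule filterlim_at_top_mono[OF filterlim_minus_const_nat_at_top[of K]])
  show "eventually (\<lambda>j. j - K \<le> path \<alpha> K j) sequentially"
    using eventually_gt_at_top[of K] by (rule eventually_mono) (simp add: path_def)
qed

text \<open>
  The analytic content of the estimate, freed from all measure theory: \<open>A k l\<close> stands for the average of
  \<open>h powr q\<close> over a box at a fixed point, and \<open>dst\<close> for the distance of the kernel means at two pairs of scales.

  Up to the level \<open>K\<close> the global bound gives \<open>A \<le> c powr q\<close> with \<open>c \<approx> 2 powr (i D / q)\<close>. The space step costs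
  \<open>c / 2\<^sup>i\<close> and the time steps cost \<open>2 powr (i - \<alpha> i) * c powr (p - 1)\<close>; both are \<open>2 powr (i (D / q - 1))\<close> by the
  choice of \<open>\<alpha>\<close>. Beyond \<open>K\<close> the local bound keeps \<open>c\<close> essentially equal to \<open>2 powr (K D / q)\<close>. Then every level
  gains one factor \<open>1/2\<close>, of which the growth of \<open>c\<close> due to \<open>\<delta>\<close> consumes at most half of the exponent. Here both
  bounds meet at the level \<open>K\<close> because \<open>k + l \<approx> (1 + \<alpha>) K\<close> there.
\<close>

lemma path_estimate:
  fixes dst :: "nat \<times> nat \<Rightarrow> nat \<times> nat \<Rightarrow> real" and A :: "nat \<Rightarrow> nat \<Rightarrow> real" and n :: nat
  assumes p: "1 < p" and q: "1 \<le> q" "p - 1 \<le> q" and \<alpha>: "0 < \<alpha>" and D: "D = real n + \<alpha>"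
    and rel: "\<alpha> - 2 = D / q * (p - 2)" and \<delta>: "0 < \<delta>" "\<delta> \<le> 1 / 6" and H: "1 \<le> H" and C0: "0 \<le> C0"
    and refl: "\<And>x. dst x x = 0" and tri: "\<And>x y z. dst x z \<le> dst x y + dst y z"
    and space: "\<And>k l c. 0 < c \<Longrightarrow> A k l \<le> c powr q \<Longrightarrow> dst (k, l) (Suc k, l) \<le> C0 * c / 2 ^ k"
    and time: "\<And>k l c. 0 < c \<Longrightarrow> A k l \<le> c powr q \<Longrightarrow> dst (k, l) (k, Suc l) \<le> C0 * (2 ^ k / 2 ^ l) * c powr (p - 1)"
    and A_global: "\<And>k l. A k l \<le> H * 2 ^ (k * n + l)"
    and A_local: "\<And>k l. A k l \<le> Y * 2 powr (\<delta> * (real k + real l))"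
    and K: "Y \<le> 2 powr (real K * (D - \<delta> * (1 + \<alpha>)))"
  shows "dst (0, 0) (j, path \<alpha> K j)
    \<le> (C0 * ((\<alpha> + 1) * 2 * H powr ((p - 1) / q) * 2 powr (\<alpha> * (p - 1) / q) + H powr (1 / q) * 2 powr (\<alpha> / q)) + 40 * C0)
      * (\<Sum>k\<le>K. 2 powr (real k * (D / q - 1)))"
proof -
  define d \<mu> where "d = D / q" and "\<mu> = d - 1"
  have dq: "d * q = D" using q by (simp add: d_def)
  have rel': "1 - \<alpha> + (p - 1) * d = \<mu>" using rel by (simp add: \<mu>_def d_def algebra_simps diff_divide_distrib)
  define C1 where "C1 = C0 * ((\<alpha> + 1) * 2 * H powr ((p - 1) / q) * 2 powr (\<alpha> * (p - 1) / q) + H powr (1 / q) * 2 powr (\<alpha> / q))"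
  have C1: "0 \<le> C1" using C0 \<alpha> by (simp add: C1_def)
  have pow2: "(2::real) ^ k = 2 powr real k" for k by (simp add: powr_realpow)
  have run: "dst (k, l) (k, l + m) \<le> real m * (C0 * (2 ^ k / 2 ^ l) * c powr (p - 1))"
    if "0 < c" "\<And>i. l \<le> i \<Longrightarrow> i < l + m \<Longrightarrow> A k i \<le> c powr q" for k l m c
    using that(2)
  proof (induction m)
    case (Suc m)
    have "dst (k, l + m) (k, l + Suc m) \<le> C0 * (2 ^ k / 2 ^ (l + m)) * c powr (p - 1)"
      using time[OF that(1) Suc.prems[of "l + m"]] by simp
    also have "\<dots> \<le> C0 * (2 ^ k / 2 ^ l) * c powr (p - 1)"
      using C0 by (intro mult_right_mono mult_left_mono divide_left_mono) auto
    finally show ?case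
      using tri[of "(k, l)" "(k, l + Suc m)" "(k, l + m)"] Suc by (simp add: algebra_simps add_divide_distrib)
  qed (simp add: refl)
  have step: "dst (k, l) (Suc k, l') \<le> (real l' - real l) * (C0 * (2 ^ k / 2 ^ l) * c powr (p - 1)) + C0 * c / 2 ^ k"
    if "0 < c" "l \<le> l'" "\<And>i. l \<le> i \<Longrightarrow> i \<le> l' \<Longrightarrow> A k i \<le> c powr q" for k l l' c
    using run[OF that(1), of l "l' - l" k] that tri[of "(k, l)" "(Suc k, l')" "(k, l')"] space[OF that(1), of k l']
    by (simp add: of_nat_diff)
  \<comment> \<open>The cost of the step from level \<open>i\<close> to level \<open>i + 1\<close>; \<open>3/4\<close> is a rational upper bound of \<open>2 powr (- 1 / 2)\<close>.\<close>
  define e where "e i = (if i < K then C1 * 2 powr (real i * \<mu>) else 10 * C0 * 2 powr (real K * \<mu>) * (3 / 4) ^ (i - K))" for i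
  have e0: "0 \<le> e i" for i using C0 C1 by (simp add: e_def)
  have e_step: "dst (i, path \<alpha> K i) (Suc i, path \<alpha> K (Suc i)) \<le> e i" for i
  proof (cases "i < K")
    case True
    note P = path_low[OF \<alpha> True]
    \<comment> \<open>The summand \<open>\<alpha>\<close> pays for the time scales that are passed before the next level is reached.\<close>
    define c where "c = H powr (1 / q) * 2 powr ((real i * D + \<alpha>) / q)"
    have c: "0 < c" using H by (simp add: c_def)
    have cq: "c powr q = H * 2 powr (real i * D + \<alpha>)"
      using H q by (simp add: c_def powr_mult powr_powr)
    have Ac: "A i l \<le> c powr q" if "l \<le> path \<alpha> K (Suc i)" for l
    proof -
      have "A i l \<le> H * 2 powr (real (i * n + l))" using A_global[of i l] by (simp only: pow2)
      also have "\<dots> \<le> H * 2 powr (real i * D + \<alpha>)"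
      proof (intro mult_left_mono powr_mono)
        have "real l \<le> \<alpha> * real i + \<alpha>" using that P(2) by linarith
        then show "real (i * n + l) \<le> real i * D + \<alpha>" by (simp add: D algebra_simps)
      qed (use H in auto)
      finally show ?thesis by (simp add: cq)
    qed
    have "dst (i, path \<alpha> K i) (Suc i, path \<alpha> K (Suc i)) \<le>
        (real (path \<alpha> K (Suc i)) - real (path \<alpha> K i)) * (C0 * (2 ^ i / 2 ^ path \<alpha> K i) * c powr (p - 1)) + C0 * c / 2 ^ i"
      by (rule step[OF c P(1) Ac])
    also have "\<dots> \<le> (\<alpha> + 1) * (C0 * (2 powr (real i - \<alpha> * real i + 1)) * c powr (p - 1)) + C0 * c / 2 ^ i"
    proof (intro add_right_mono mult_mono mult_left_mono)
      show "real (path \<alpha> K (Suc i)) - real (path \<alpha> K i) \<le> \<alpha> + 1" using P by linarith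
      have "(2::real) ^ i / 2 ^ path \<alpha> K i = 2 powr (real i - real (path \<alpha> K i))"
        by (simp add: pow2 powr_diff)
      also have "\<dots> \<le> 2 powr (real i - \<alpha> * real i + 1)"
        using P(3) by (intro powr_mono) auto
      finally show "(2::real) ^ i / 2 ^ path \<alpha> K i \<le> 2 powr (real i - \<alpha> * real i + 1)" .
    qed (use C0 \<alpha> in auto)
    also have "C0 * c / 2 ^ i = C0 * (H powr (1 / q) * 2 powr (\<alpha> / q)) * 2 powr (real i * \<mu>)"
    proof -
      have "(real i * D + \<alpha>) / q - real i = \<alpha> / q + real i * \<mu>"
        by (simp add: \<mu>_def d_def add_divide_distrib algebra_simps)
      then have e: "2 powr ((real i * D + \<alpha>) / q) / 2 ^ i = 2 powr (\<alpha> / q) * 2 powr (real i * \<mu>)"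
        by (simp add: pow2 powr_diff[symmetric] powr_add[symmetric])
      have "C0 * c / 2 ^ i = C0 * (H powr (1 / q) * (2 powr ((real i * D + \<alpha>) / q) / 2 ^ i))"
        by (simp add: c_def)
      then show ?thesis unfolding e by (simp only: mult.assoc)
    qed
    also have "(\<alpha> + 1) * (C0 * (2 powr (real i - \<alpha> * real i + 1)) * c powr (p - 1)) =
        C0 * ((\<alpha> + 1) * 2 * H powr ((p - 1) / q) * 2 powr (\<alpha> * (p - 1) / q)) * 2 powr (real i * \<mu>)"
    proof -
      have c1: "c powr (p - 1) = H powr ((p - 1) / q) * 2 powr ((real i * D + \<alpha>) / q * (p - 1))"
        using H by (simp add: c_def powr_mult powr_powr)
      have "(real i - \<alpha> * real i + 1) + (real i * D + \<alpha>) / q * (p - 1) = 1 + \<alpha> * (p - 1) / q + real i * \<mu>"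
        by (simp add: rel'[symmetric] d_def add_divide_distrib algebra_simps)
      then have "2 powr (real i - \<alpha> * real i + 1) * 2 powr ((real i * D + \<alpha>) / q * (p - 1))
          = 2 powr (1 + \<alpha> * (p - 1) / q + real i * \<mu>)"
        by (simp only: powr_add[symmetric])
      also have "\<dots> = 2 * 2 powr (\<alpha> * (p - 1) / q) * 2 powr (real i * \<mu>)"
        by (simp add: powr_add)
      finally show ?thesis unfolding c1 by (simp add: mult_ac)
    qed
    finally show ?thesis using True by (simp add: e_def C1_def algebra_simps)
  next
    case False
    define r where "r = i - K"
    have i: "i = K + r" using False by (simp add: r_def)
    note P = path_high[OF \<alpha>, of K r]
    \<comment> \<open>At the level \<open>K + r\<close> the sum of the two scales exceeds \<open>(1 + \<alpha>) K\<close> by at most \<open>3 r + 2\<close>.\<close>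
    define t where "t = \<delta> * (3 * real r + 2)"
    have "\<delta> * (3 * real r + 2) \<le> 1 / 6 * (3 * real r + 2)"
      by (intro mult_right_mono \<delta>(2)) simp
    also have "\<dots> \<le> real r / 2 + 1" by (simp add: field_simps)
    finally have t2: "t \<le> real r / 2 + 1" unfolding t_def .
    have t1: "0 \<le> t" unfolding t_def using \<delta>(1) by simp
    note t = t1 t2
    define c where "c = 2 powr (real K * d + t / q)"
    have c: "0 < c" by (simp add: c_def)
    have cq: "c powr q = 2 powr (real K * D + t)"
      using q dq by (simp add: c_def powr_powr distrib_right mult.assoc)
    have Ac: "A i l \<le> c powr q" if "l \<le> path \<alpha> K (Suc i)" for l
    proof -
      have "A i l \<le> Y * 2 powr (\<delta> * (real i + real l))" by (rule A_local)
      also have "\<dots> \<le> 2 powr (real K * (D - \<delta> * (1 + \<alpha>))) * 2 powr (\<delta> * (real i + real l))"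
        by (intro mult_right_mono K) simp
      also have "\<dots> = 2 powr (real K * (D - \<delta> * (1 + \<alpha>)) + \<delta> * (real i + real l))"
        by (simp add: powr_add)
      also have "\<dots> \<le> 2 powr (real K * D + t)"
      proof (rule powr_mono)
        have "real l \<le> \<alpha> * real K + 2 * real r + 2" using that P by (simp add: i)
        then have "\<delta> * (real i + real l) \<le> \<delta> * (real K + real r + (\<alpha> * real K + 2 * real r + 2))"
          using \<delta> by (intro mult_left_mono) (auto simp: i)
        then show "real K * (D - \<delta> * (1 + \<alpha>)) + \<delta> * (real i + real l) \<le> real K * D + t"
          by (simp add: t_def algebra_simps)
      qed simp
      finally show ?thesis by (simp add: cq)
    qed
    have le: "path \<alpha> K i \<le> path \<alpha> K (Suc i)" using P(1) by (simp add: i)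
    have "dst (i, path \<alpha> K i) (Suc i, path \<alpha> K (Suc i)) \<le>
        (real (path \<alpha> K (Suc i)) - real (path \<alpha> K i)) * (C0 * (2 ^ i / 2 ^ path \<alpha> K i) * c powr (p - 1)) + C0 * c / 2 ^ i"
      by (rule step[OF c le Ac])
    also have "real (path \<alpha> K (Suc i)) - real (path \<alpha> K i) = 2" using P(1) by (simp add: i)
    also have "2 * (C0 * (2 ^ i / 2 ^ path \<alpha> K i) * c powr (p - 1)) \<le> 8 * C0 * (2 powr (real K * \<mu>) * 2 powr (- (1 / 2) * real r))"
    proof -
      have c1: "c powr (p - 1) = 2 powr ((real K * d + t / q) * (p - 1))"
        by (simp only: c_def powr_powr)
      have "(2 ^ i / 2 ^ path \<alpha> K i) * c powr (p - 1) = 2 powr (real i - real (path \<alpha> K i) + (real K * d + t / q) * (p - 1))"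
        unfolding c1 by (simp only: pow2 powr_diff powr_add)
      also have "\<dots> \<le> 2 powr (2 + real K * \<mu> + - (1 / 2) * real r)"
      proof (rule powr_mono)
        have "t * ((p - 1) / q) \<le> t * 1" using t q by (intro mult_left_mono) auto
        moreover have "real i - real (path \<alpha> K i) \<le> real K + real r - (\<alpha> * real K - 1 + 2 * real r)"
          using P(3) by (simp add: i)
        ultimately have "real i - real (path \<alpha> K i) + (real K * d + t / q) * (p - 1) \<le>
            real K * (1 - \<alpha> + (p - 1) * d) + 1 - real r + t"
          by (simp add: algebra_simps)
        then show "real i - real (path \<alpha> K i) + (real K * d + t / q) * (p - 1) \<le> 2 + real K * \<mu> + - (1 / 2) * real r"
          unfolding rel' using t(2) by linarith
      qed simp
      also have "\<dots> = 4 * (2 powr (real K * \<mu>) * 2 powr (- (1 / 2) * real r))"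
        by (simp only: powr_add) simp
      finally have "(2 ^ i / 2 ^ path \<alpha> K i) * c powr (p - 1) \<le> 4 * (2 powr (real K * \<mu>) * 2 powr (- (1 / 2) * real r))" .
      from mult_left_mono[OF this C0] show ?thesis by (simp add: mult.assoc)
    qed
    also have "C0 * c / 2 ^ i \<le> 2 * C0 * (2 powr (real K * \<mu>) * 2 powr (- (1 / 2) * real r))"
    proof -
      have "c / 2 ^ i = 2 powr (real K * d + t / q - real i)"
        by (simp only: pow2 powr_diff c_def)
      also have "\<dots> \<le> 2 powr (1 + real K * \<mu> + - (1 / 2) * real r)"
      proof (rule powr_mono)
        have "t * (1 / q) \<le> t * 1" using t q by (intro mult_left_mono) auto
        then show "real K * d + t / q - real i \<le> 1 + real K * \<mu> + - (1 / 2) * real r"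
          using t(2) by (simp add: \<mu>_def i algebra_simps)
      qed simp
      also have "\<dots> = 2 * (2 powr (real K * \<mu>) * 2 powr (- (1 / 2) * real r))"
        by (simp only: powr_add) simp
      finally have "c / 2 ^ i \<le> 2 * (2 powr (real K * \<mu>) * 2 powr (- (1 / 2) * real r))" .
      from mult_left_mono[OF this C0] show ?thesis by (simp add: mult.assoc)
    qed
    also have "8 * C0 * (2 powr (real K * \<mu>) * 2 powr (- (1 / 2) * real r)) + 2 * C0 * (2 powr (real K * \<mu>) * 2 powr (- (1 / 2) * real r))
        = 10 * C0 * 2 powr (real K * \<mu>) * 2 powr (- (1 / 2) * real r)" by simp
    also have "\<dots> \<le> 10 * C0 * 2 powr (real K * \<mu>) * (3 / 4) ^ r"
    proof (intro mult_left_mono)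
      have "2 powr (- (1 / 2)) \<le> (3 / 4 :: real)"
      proof -
        have "(2 powr (- (1 / 2)))\<^sup>2 = (1 / 2 :: real)"
          unfolding power2_eq_square powr_add[symmetric] by (simp add: powr_minus)
        then have "(2 powr (- (1 / 2)))\<^sup>2 \<le> (3 / 4 :: real)\<^sup>2" by (simp add: power2_eq_square)
        then show ?thesis by (rule power2_le_imp_le) simp
      qed
      then have "(2 powr (- (1 / 2))) ^ r \<le> (3 / 4 :: real) ^ r" by (intro power_mono) auto
      also have "(2 powr (- (1 / 2))) ^ r = (2::real) powr (- (1 / 2) * real r)"
        by (simp add: powr_realpow[symmetric] powr_powr)
      finally show "(2::real) powr (- (1 / 2) * real r) \<le> (3 / 4) ^ r" .
    qed (use C0 in auto)
    finally show ?thesis using False by (simp add: e_def r_def)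
  qed
  have chain: "dst (0, 0) (j, path \<alpha> K j) \<le> (\<Sum>i<j. e i)" for j
  proof (induction j)
    case (Suc j)
    then show ?case using tri[of "(0, 0)" "(Suc j, path \<alpha> K (Suc j))" "(j, path \<alpha> K j)"] e_step[of j] by simp
  qed (simp add: refl path_0)
  define S where "S = (\<Sum>k\<le>K. 2 powr (real k * \<mu>))"
  have "dst (0, 0) (j, path \<alpha> K j) \<le> (\<Sum>i<j. e i)" by (rule chain)
  also have "\<dots> \<le> (\<Sum>i<K + j. e i)" by (intro sum_mono2) (auto simp: e0)
  also have "\<dots> = (\<Sum>i<K. e i) + (\<Sum>i<j. e (K + i))"
    by (induction j) (auto simp: add.commute add.left_commute)
  also have "(\<Sum>i<K. e i) \<le> C1 * S"
  proof -
    have "(\<Sum>i<K. e i) = C1 * (\<Sum>i<K. 2 powr (real i * \<mu>))" by (simp add: e_def sum_distrib_left)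
    also have "\<dots> \<le> C1 * S" unfolding S_def by (intro mult_left_mono sum_mono2 C1) auto
    finally show ?thesis .
  qed
  also have "(\<Sum>i<j. e (K + i)) \<le> 40 * C0 * S"
  proof -
    have "(\<Sum>i<j. e (K + i)) = 10 * C0 * 2 powr (real K * \<mu>) * (\<Sum>i<j. (3 / 4) ^ i)"
      by (simp add: e_def sum_distrib_left)
    also have "(\<Sum>i<j. (3 / 4 :: real) ^ i) = 4 * (1 - (3 / 4) ^ j)"
      by (simp add: sum_gp_strict)
    also have "\<dots> \<le> 4" by simp
    also have "2 powr (real K * \<mu>) \<le> S" unfolding S_def by (rule member_le_sum) auto
    finally show ?thesis using C0 by (simp add: mult_left_mono mult_right_mono)
  qed
  finally show ?thesis by (simp add: C1_def S_def \<mu>_def d_def distrib_right)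
qed


section \<open>Vector norms\<close>

lemma vnorm_nonneg [simp]: "0 \<le> vnorm N v" by (simp add: vnorm_def)

lemma vnorm_mono: "(\<And>i. i < N \<Longrightarrow> norm (v i) \<le> norm (w i)) \<Longrightarrow> vnorm N v \<le> vnorm N w"
  by (auto simp: vnorm_def intro!: L2_set_mono)

lemma vnorm_cong: "(\<And>i. i < N \<Longrightarrow> norm (v i) = norm (w i)) \<Longrightarrow> vnorm N v = vnorm N w"
  by (auto simp: vnorm_def intro!: L2_set_cong)

lemma vnorm_triangle: "vnorm N (\<lambda>i. v i + w i) \<le> vnorm N v + vnorm N w"
proof -
  have "vnorm N (\<lambda>i. v i + w i) \<le> L2_set (\<lambda>i. norm (v i) + norm (w i)) {..<N}"
    unfolding vnorm_def by (rule L2_set_mono) (auto intro: norm_triangle_ineq)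
  also have "\<dots> \<le> vnorm N v + vnorm N w"
    unfolding vnorm_def by (rule L2_set_triangle_ineq)
  finally show ?thesis .
qed

lemma vnorm_triangle3: "vnorm N (\<lambda>i. x i - z i) \<le> vnorm N (\<lambda>i. x i - y i) + vnorm N (\<lambda>i. y i - z i)"
  using vnorm_triangle[of N "\<lambda>i. x i - y i" "\<lambda>i. y i - z i"] by simp

lemma vnorm_minus: "vnorm N (\<lambda>i. x i - y i) = vnorm N (\<lambda>i. y i - x i)"
  by (rule vnorm_cong) (simp add: norm_minus_commute)

lemma vnorm_zero: "vnorm N (\<lambda>i. 0) = 0" by (simp add: vnorm_def L2_set_0')

lemma vnorm_scale: "vnorm N (\<lambda>i. c *\<^sub>R v i) = \<bar>c\<bar> * vnorm N v"
  using L2_set_right_distrib[of "\<bar>c\<bar>" "\<lambda>i. norm (v i)" "{..<N}"] by (simp add: vnorm_def)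

lemma norm_le_vnorm: "i < N \<Longrightarrow> norm (v i) \<le> vnorm N v"
  unfolding vnorm_def by (rule member_le_L2_set[where f="\<lambda>i. norm (v i)"]) auto

lemma vnorm_cmult_le:
  assumes "\<And>i. i < N \<Longrightarrow> norm (v i) \<le> c * norm (w i)" "0 \<le> c"
  shows "vnorm N v \<le> c * vnorm N w"
  using vnorm_mono[of N v "\<lambda>i. c *\<^sub>R w i"] assms by (simp add: vnorm_scale)

text \<open>
  Minkowski's integral inequality, proved by testing with the unit vector in the direction of the integral. It makes
  all constants independent of the number \<open>N\<close> of equations.
\<close>

lemma vnorm_integral_le:
  fixes f :: "nat \<Rightarrow> 'a \<Rightarrow> real"
  assumes f: "\<And>i. i < N \<Longrightarrow> integrable M (f i)" and B: "integrable M B"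
    and le: "AE x in M. vnorm N (\<lambda>i. f i x) \<le> B x"
  shows "vnorm N (\<lambda>i. \<integral>x. f i x \<partial>M) \<le> (\<integral>x. B x \<partial>M)"
proof -
  define d where "d i = (\<integral>x. f i x \<partial>M)" for i
  have sq: "(vnorm N d)\<^sup>2 = (\<Sum>i<N. d i * d i)"
    by (simp add: vnorm_def L2_set_def sum_nonneg power2_eq_square)
  have "(\<Sum>i<N. d i * d i) = (\<integral>x. (\<Sum>i<N. d i * f i x) \<partial>M)"
    using f by (simp add: Bochner_Integration.integral_sum d_def)
  also have "\<dots> \<le> (\<integral>x. vnorm N d * B x \<partial>M)"
  proof (rule integral_mono_AE)
    show "AE x in M. (\<Sum>i<N. d i * f i x) \<le> vnorm N d * B x"
      using le
    proof (rule AE_mp, intro AE_I2 impI)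
      fix x assume B: "vnorm N (\<lambda>i. f i x) \<le> B x"
      have "(\<Sum>i<N. d i * f i x) \<le> (\<Sum>i<N. \<bar>d i\<bar> * \<bar>f i x\<bar>)"
        by (intro sum_mono) (simp add: abs_mult[symmetric])
      also have "\<dots> \<le> vnorm N d * vnorm N (\<lambda>i. f i x)"
        using L2_set_mult_ineq[of d "\<lambda>i. f i x" "{..<N}"] by (simp add: vnorm_def L2_set_def)
      also have "\<dots> \<le> vnorm N d * B x" by (intro mult_left_mono B) simp
      finally show "(\<Sum>i<N. d i * f i x) \<le> vnorm N d * B x" .
    qed
  qed (use f B in auto)
  finally have "vnorm N d * vnorm N d \<le> vnorm N d * (\<integral>x. B x \<partial>M)"
    using sq by (simp add: power2_eq_square)
  moreover have "0 \<le> (\<integral>x. B x \<partial>M)"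
  proof (rule integral_nonneg_AE)
    show "AE x in M. 0 \<le> B x"
      using le
    proof (rule AE_mp, intro AE_I2 impI)
      fix x assume "vnorm N (\<lambda>i. f i x) \<le> B x"
      then show "0 \<le> B x" using vnorm_nonneg[of N "\<lambda>i. f i x"] by linarith
    qed
  qed
  ultimately have "vnorm N d \<le> (\<integral>x. B x \<partial>M)"
    by (cases "vnorm N d = 0") (auto simp: mult_le_cancel_left_pos order.strict_iff_order)
  then show ?thesis unfolding d_def[abs_def] .
qed

section \<open>The unit cylinder\<close>

definition unit_cyl :: "((real^'n) \<times> real) set" where
  "unit_cyl = ball 0 1 \<times> {-1<..<1}"

text \<open>
  All space coordinates get the scale \<open>k\<close> and the time coordinate gets the scale \<open>l\<close>.
\<close>

definition scales :: "nat \<Rightarrow> nat \<Rightarrow> (real^'n) \<times> real \<Rightarrow> nat" where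
  "scales k l b = (if b = (0, 1) then l else k)"

lemma Basis_vec: "(Basis :: (real^'n) set) = range (\<lambda>j. axis j 1)"
  by (auto simp: Basis_vec_def)

lemma Basis_space_time: "(Basis :: ((real^'n) \<times> real) set) = insert (0, 1) (range (\<lambda>j. (axis j 1, 0)))"
  unfolding Basis_prod_def Basis_vec by auto

lemma axis_neq_0 [simp]: "axis j (1::real) \<noteq> 0" by (simp add: axis_eq_0_iff)

lemma prod_Basis_space_time:
  "(\<Prod>b\<in>(Basis :: ((real^'n) \<times> real) set). f b) = f (0, 1) * (\<Prod>j\<in>UNIV. f (axis j 1, 0))"
proof -
  have inj: "inj (\<lambda>j::'n. (axis j (1::real), 0::real))" by (auto simp: inj_def axis_eq_axis)
  show ?thesis
    unfolding Basis_space_time by (subst prod.insert) (auto simp: prod.reindex[OF inj])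
qed

lemma weight_scales: "weight (scales k l :: (real^'n) \<times> real \<Rightarrow> nat) = 2 ^ (k * CARD('n) + l)"
  unfolding weight_def prod_Basis_space_time by (simp add: scales_def power_add power_mult)

lemma unit_cyl_coord:
  assumes "z \<in> unit_cyl" "c \<in> Basis"
  shows "\<bar>z \<bullet> c\<bar> \<le> 1"
proof -
  have "\<bar>fst z $ j\<bar> \<le> 1" for j
    using component_le_norm_cart[of "fst z" j] assms(1) by (auto simp: unit_cyl_def)
  then show ?thesis
    using assms by (auto simp: Basis_space_time inner_prod_def inner_axis unit_cyl_def)
qed

lemma open_unit_cyl: "open unit_cyl"
  unfolding unit_cyl_def by (intro open_Times) auto

lemma measurable_unit_cyl [measurable]: "unit_cyl \<in> sets borel"
  by (rule borel_open[OF open_unit_cyl])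

text \<open>
  The equation in normalised form: \<open>g\<close> is the weak spatial gradient of \<open>v\<close>, and \<open>\<partial>\<^sub>t v = div G\<close>, tested with functions
  supported in the unit cylinder only. The functions live on the whole space, so that integrals over boxes
  need no restriction.
\<close>

definition unit_solution ::
  "nat \<Rightarrow> ((real^'n) \<times> real \<Rightarrow> nat \<Rightarrow> real) \<Rightarrow> ((real^'n) \<times> real \<Rightarrow> nat \<Rightarrow> real^'n) \<Rightarrow>
    ((real^'n) \<times> real \<Rightarrow> nat \<Rightarrow> real^'n) \<Rightarrow> bool" where
  "unit_solution N v g G \<longleftrightarrow> (\<forall>i<N.
     integrable lborel (\<lambda>z. v z i) \<and> integrable lborel (\<lambda>z. g z i) \<and> integrable lborel (\<lambda>z. G z i) \<and>
     (\<forall>\<phi>. test_fun unit_cyl \<phi> \<longrightarrow>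
       (\<forall>j. (\<integral>z. v z i * frechet_derivative \<phi> (at z) (axis j 1, 0) \<partial>lborel) = - (\<integral>z. (g z i $ j) * \<phi> z \<partial>lborel)) \<and>
       (\<integral>z. v z i * frechet_derivative \<phi> (at z) (0, 1) \<partial>lborel) =
         (\<integral>z. (\<Sum>j\<in>UNIV. (G z i $ j) * frechet_derivative \<phi> (at z) (axis j 1, 0)) \<partial>lborel)))"

lemma bounded_mult_integrable:
  fixes f \<phi> :: "'a::euclidean_space \<Rightarrow> real"
  assumes "integrable lborel f" "continuous_on UNIV \<phi>" "\<And>z. \<bar>\<phi> z\<bar> \<le> c"
  shows "integrable lborel (\<lambda>z. f z * \<phi> z)"
proof (rule Bochner_Integration.integrable_bound[of _ "\<lambda>z. c * \<bar>f z\<bar>"])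
  show "AE z in lborel. norm (f z * \<phi> z) \<le> norm (c * \<bar>f z\<bar>)"
  proof (rule AE_I2)
    fix z
    have "\<bar>\<phi> z\<bar> * \<bar>f z\<bar> \<le> \<bar>c\<bar> * \<bar>f z\<bar>"
      using assms(3)[of z] by (intro mult_right_mono) auto
    then show "norm (f z * \<phi> z) \<le> norm (c * \<bar>f z\<bar>)" by (simp add: abs_mult mult.commute)
  qed
qed (use assms borel_measurable_continuous_onI[OF assms(2)] in auto)

lemma integrable_component: "integrable M f \<Longrightarrow> integrable M (\<lambda>z. f z $ j)" for f :: "'a \<Rightarrow> real^'n"
  using integrable_inner_left[of "axis j 1" M f] by (simp add: inner_axis)

section \<open>Changing one scale\<close>

context smooth_step begin

definition ker_mean :: "((real^'n) \<times> real \<Rightarrow> nat \<Rightarrow> real) \<Rightarrow> ((real^'n) \<times> real \<Rightarrow> nat) \<Rightarrow> (real^'n) \<times> real \<Rightarrow> nat \<Rightarrow> real" where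
  "ker_mean v \<kappa> z i = (\<integral>Z. ker \<kappa> z Z * v Z i \<partial>lborel)"

lemma ker_mean_cong: "(\<And>b. b \<in> Basis \<Longrightarrow> \<kappa> b = \<kappa>' b) \<Longrightarrow> ker_mean v \<kappa> = ker_mean v \<kappa>'"
  by (auto simp: ker_mean_def ker_def tensor_def fun_eq_iff)

text \<open>
  By \<open>near\<close>, the support lies in the set \<open>|X| \<le> (1 - e) |x| + 2 e s n\<close> with \<open>e = 2 powr (- k - 1)\<close>. With
  \<open>s = 1 / (8 n)\<close> the last summand is \<open>e / 4\<close>, so this set is compactly contained in the open unit ball as soon as \<open>|x| < 1\<close>. The time coordinate is treated in the same way.
\<close>

lemma prim_test_fun:
  fixes z :: "(real^'n) \<times> real"
  assumes s': "s = 1 / (8 * real CARD('n))" and z: "z \<in> unit_cyl"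
    and adj: "adj (scales k l) \<kappa>'" "\<kappa>' a = scales k l a"
  shows "test_fun unit_cyl (prim \<kappa>' a z)"
proof -
  have n: "1 \<le> real CARD('n)" by (simp add: Suc_leI)
  have s8: "s \<le> 1 / 8" unfolding s' using n by (simp add: field_simps)
  define r1 where "r1 = (1 - 1 / 2 ^ Suc k) * norm (fst z) + (1 / 2 ^ Suc k) / 4"
  define r2 where "r2 = (1 - 1 / 2 ^ Suc l) * \<bar>snd z\<bar> + (1 / 2 ^ Suc l) / 4"
  have lt: "(1 - e) * x + e / 4 < 1" if "0 < e" "e \<le> 1" "0 \<le> x" "x < 1" for e x :: real
  proof -
    have "(1 - e) * x \<le> (1 - e) * 1" using that by (intro mult_left_mono) auto
    then show ?thesis using that by simp
  qed
  have lt1: "(1 - 1 / 2 ^ Suc m) * x + (1 / 2 ^ Suc m) / 4 < 1" if "0 \<le> x" "x < 1" for m and x :: real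
    by (rule lt) (use that one_le_power[of "2::real" "Suc m"] in \<open>auto simp: field_simps\<close>)
  have r: "r1 < 1" "r2 < 1"
    unfolding r1_def r2_def by (rule lt1; use z in \<open>auto simp: unit_cyl_def\<close>)+
  have sub: "{Z. prim \<kappa>' a z Z \<noteq> 0} \<subseteq> cball 0 r1 \<times> {- r2..r2}"
  proof
    fix Z :: "(real^'n) \<times> real" assume "Z \<in> {Z. prim \<kappa>' a z Z \<noteq> 0}"
    then have near: "near (scales k l c) (z \<bullet> c) (Z \<bullet> c)" if "c \<in> Basis" for c
      using near_prim[OF _ that adj] by auto
    have "\<exists>e. 1 / 2 ^ Suc k \<le> e \<and> e \<le> 1 / 2 ^ k \<and> \<bar>fst Z $ j - (1 - e) * fst z $ j\<bar> \<le> e * s" for j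
      using near[of "(axis j 1, 0)"] unfolding near_def
      by (auto simp: Basis_space_time scales_def inner_prod_def inner_axis)
    then obtain e where e: "\<And>j. 1 / 2 ^ Suc k \<le> e j" "\<And>j. e j \<le> 1 / 2 ^ k"
      "\<And>j. \<bar>fst Z $ j - (1 - e j) * fst z $ j\<bar> \<le> e j * s" by metis
    define X where "X = (\<chi> j. (1 - e j) * fst z $ j)"
    have "norm X \<le> norm ((1 - 1 / 2 ^ Suc k) *\<^sub>R fst z)"
    proof (rule norm_le_componentwise_cart)
      fix j
      have "e j \<le> 1" using e(2)[of j] by (rule order_trans) simp
      then show "norm (X $ j) \<le> norm (((1 - 1 / 2 ^ Suc k) *\<^sub>R fst z) $ j)"
        using e(1)[of j] by (simp add: X_def abs_mult mult_right_mono)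
    qed
    also have "\<dots> = (1 - 1 / 2 ^ Suc k) * norm (fst z)"
    proof -
      have "0 \<le> 1 - 1 / (2::real) ^ Suc k" using one_le_power[of "2::real" "Suc k"] by (simp add: field_simps)
      then show ?thesis by (simp only: norm_scaleR abs_of_nonneg)
    qed
    finally have 1: "norm X \<le> (1 - 1 / 2 ^ Suc k) * norm (fst z)" .
    have "norm (fst Z - X) \<le> (\<Sum>j\<in>UNIV. \<bar>(fst Z - X) $ j\<bar>)" by (rule norm_le_l1_cart)
    also have "\<dots> \<le> (\<Sum>j\<in>(UNIV::'n set). 1 / 2 ^ k * s)"
    proof (rule sum_mono)
      fix j
      have "\<bar>(fst Z - X) $ j\<bar> \<le> e j * s" using e(3)[of j] by (simp add: X_def)
      also have "\<dots> \<le> 1 / 2 ^ k * s" using e(2)[of j] s by (intro mult_right_mono) auto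
      finally show "\<bar>(fst Z - X) $ j\<bar> \<le> 1 / 2 ^ k * s" .
    qed
    also have "\<dots> = (1 / 2 ^ Suc k) / 4" using n by (simp add: s' field_simps)
    finally have "norm (fst Z - X) \<le> (1 / 2 ^ Suc k) / 4" .
    then have "norm (fst Z) \<le> r1"
      using 1 norm_triangle_ineq[of X "fst Z - X"] unfolding r1_def by simp
    obtain e' where e': "1 / 2 ^ Suc l \<le> e'" "e' \<le> 1 / 2 ^ l" "\<bar>snd Z - (1 - e') * snd z\<bar> \<le> e' * s"
      using near[of "(0, 1)"] unfolding near_def
      by (auto simp: Basis_space_time scales_def inner_prod_def)
    have "e' \<le> 1" using e'(2) by (rule order_trans) simp
    have "\<bar>(1 - e') * snd z\<bar> \<le> (1 - 1 / 2 ^ Suc l) * \<bar>snd z\<bar>"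
      unfolding abs_mult using \<open>e' \<le> 1\<close> e'(1) by (intro mult_right_mono) auto
    moreover have "e' * s \<le> 1 / 2 ^ l * (1 / 8)"
      using e' s s8 by (intro mult_mono) auto
    ultimately have "\<bar>snd Z\<bar> \<le> r2" using e'(3) unfolding r2_def by simp
    then show "Z \<in> cball 0 r1 \<times> {- r2..r2}"
      using \<open>norm (fst Z) \<le> r1\<close> by (cases Z) auto
  qed
  have comp: "compact (cball (0::real^'n) r1 \<times> {- r2..r2})" by (intro compact_Times) auto
  have cl: "closure {Z. prim \<kappa>' a z Z \<noteq> 0} \<subseteq> cball 0 r1 \<times> {- r2..r2}"
    using sub comp by (intro closure_minimal compact_imp_closed)
  have "compact (closure {Z. prim \<kappa>' a z Z \<noteq> 0})"
    using comp cl by (metis closed_closure compact_Int_closed inf.absorb_iff2)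
  moreover have "cball (0::real^'n) r1 \<times> {- r2..r2} \<subseteq> unit_cyl"
    using r by (auto simp: unit_cyl_def)
  ultimately show ?thesis
    using cl prim_smooth by (auto simp: test_fun_def compactly_inside_def)
qed

lemma continuous_prim: "continuous_on UNIV (prim \<kappa> a z)"
  and continuous_prim_deriv: "continuous_on UNIV (\<lambda>Z. frechet_derivative (prim \<kappa> a z) (at Z) c)"
  using C_k_continuous[OF prim_smooth] C_k_continuous[OF C_k_SucD(2)[OF prim_smooth]] by auto

lemma ker_mean_diff:
  assumes v: "\<And>i. i < N \<Longrightarrow> integrable lborel (\<lambda>z. v z i)" and z: "z \<in> unit_cyl" and a: "a \<in> Basis" and i: "i < N"
  shows "ker_mean v \<kappa> z i - ker_mean v (\<kappa>(a := Suc (\<kappa> a))) z i =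
    (\<integral>Z. v Z i * frechet_derivative (prim \<kappa> a z) (at Z) a \<partial>lborel)"
  unfolding ker_mean_def prim_deriv_same[OF a]
  using integrable_ker_mult[OF v[OF i] unit_cyl_coord[OF z]]
  by (simp add: mult.commute right_diff_distrib)

lemma integrable_nbhd:
  fixes f :: "'a::euclidean_space \<Rightarrow> 'b::{banach,second_countable_topology}"
  assumes "integrable lborel f"
  shows "integrable lborel (\<lambda>Z. indicator (nbhd \<kappa> z) Z *\<^sub>R f Z)"
  by (rule integrable_mult_indicator[OF _ assms]) (simp add: nbhd_cbox)

lemma integrable_vnorm:
  fixes f :: "'a::euclidean_space \<Rightarrow> nat \<Rightarrow> 'b::euclidean_space"
  assumes "\<And>i. i < N \<Longrightarrow> integrable lborel (\<lambda>z. f z i)"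
  shows "integrable lborel (\<lambda>z. vnorm N (f z))"
proof (rule Bochner_Integration.integrable_bound[of _ "\<lambda>z. \<Sum>i<N. norm (f z i)"])
  show "(\<lambda>z. vnorm N (f z)) \<in> borel_measurable lborel"
    unfolding vnorm_def L2_set_def
    by (intro measurable_compose[OF _ borel_measurable_sqrt] borel_measurable_sum borel_measurable_power borel_measurable_norm)
      (use borel_measurable_integrable[OF assms] in auto)
  have "vnorm N (f z) \<le> (\<Sum>i<N. norm (f z i))" for z
    using L2_set_le_sum[of "{..<N}" "\<lambda>i. norm (f z i)"] by (simp add: vnorm_def)
  then show "AE z in lborel. norm (vnorm N (f z)) \<le> norm (\<Sum>i<N. norm (f z i))"
    by (intro AE_I2) (simp add: sum_nonneg)
qed (use assms in auto)

definition avg :: "((real^'n) \<times> real \<Rightarrow> real) \<Rightarrow> nat \<Rightarrow> nat \<Rightarrow> (real^'n) \<times> real \<Rightarrow> real" where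
  "avg f k l z = weight (scales k l :: (real^'n) \<times> real \<Rightarrow> nat) * (\<integral>Z. indicator (nbhd (scales k l) z) Z * f Z \<partial>lborel)"

abbreviation ker_bound_st :: "(real^'n) itself \<Rightarrow> real" where
  "ker_bound_st _ \<equiv> ker_bound TYPE((real^'n) \<times> real)"

text \<open>
  Integration by parts against \<open>prim\<close> replaces the difference of two kernel means by an integral of the gradient.
\<close>

lemma space_step1:
  fixes z :: "(real^'n) \<times> real"
  assumes sol: "unit_solution N v g G" and s': "s = 1 / (8 * real CARD('n))" and z: "z \<in> unit_cyl"
    and adj: "adj (scales k l) \<kappa>" "\<kappa> (axis j 1, 0) = k"
  shows "vnorm N (\<lambda>i. ker_mean v \<kappa> z i - ker_mean v (\<kappa>((axis j 1, 0) := Suc k)) z i)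
    \<le> ker_bound_st TYPE(real^'n) / 2 ^ k * avg (\<lambda>Z. vnorm N (g Z)) k l z"
proof -
  let ?a = "(axis j 1, 0) :: (real^'n) \<times> real"
  have a: "?a \<in> Basis" by (simp add: Basis_space_time)
  have ka: "\<kappa> ?a = scales k l ?a" "scales k l ?a = k" using adj by (auto simp: scales_def)
  note tf = prim_test_fun[OF s' z adj(1) ka(1)]
  let ?c = "ker_bound_st TYPE(real^'n) * (weight (scales k l :: (real^'n) \<times> real \<Rightarrow> nat) / 2 ^ k)"
  have c0: "0 \<le> ?c" using ker_bound_ge_1[where ?'a="(real^'n) \<times> real"] weight_pos[of "scales k l :: (real^'n) \<times> real \<Rightarrow> nat"]
    by (intro mult_nonneg_nonneg divide_nonneg_nonneg) (auto simp: less_imp_le)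
  have ple: "\<bar>prim \<kappa> ?a z Z\<bar> \<le> ?c * indicator (nbhd (scales k l) z) Z" for Z
    using prim_le[OF adj(1) ka(1) a unit_cyl_coord[OF z]] unfolding ka(2) by simp
  have ple': "\<bar>prim \<kappa> ?a z Z\<bar> \<le> ?c" for Z
  proof -
    have "\<bar>prim \<kappa> ?a z Z\<bar> \<le> ?c * indicator (nbhd (scales k l) z) Z" by (rule ple)
    also have "\<dots> \<le> ?c * 1" by (intro mult_left_mono c0) (simp add: indicator_def)
    finally show ?thesis by simp
  qed
  have gi: "integrable lborel (\<lambda>z. g z i)" "integrable lborel (\<lambda>z. v z i)" if "i < N" for i
    using sol that by (auto simp: unit_solution_def)
  have int: "integrable lborel (\<lambda>Z. (g Z i $ j) * prim \<kappa> ?a z Z)" if "i < N" for i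
    by (rule bounded_mult_integrable[OF integrable_component[OF gi(1)[OF that]] continuous_prim ple'])
  have eq: "ker_mean v \<kappa> z i - ker_mean v (\<kappa>(?a := Suc k)) z i = (\<integral>Z. - ((g Z i $ j) * prim \<kappa> ?a z Z) \<partial>lborel)" if "i < N" for i
  proof -
    have "ker_mean v \<kappa> z i - ker_mean v (\<kappa>(?a := Suc k)) z i = (\<integral>Z. v Z i * frechet_derivative (prim \<kappa> ?a z) (at Z) ?a \<partial>lborel)"
      using ker_mean_diff[OF gi(2) z a that, where \<kappa>=\<kappa>] adj(2) by simp
    then show ?thesis using sol that tf by (simp add: unit_solution_def)
  qed
  have "vnorm N (\<lambda>i. ker_mean v \<kappa> z i - ker_mean v (\<kappa>(?a := Suc k)) z i)
      = vnorm N (\<lambda>i. \<integral>Z. - ((g Z i $ j) * prim \<kappa> ?a z Z) \<partial>lborel)"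
    by (rule vnorm_cong) (simp only: eq)
  also have "\<dots> \<le> (\<integral>Z. ?c * (indicator (nbhd (scales k l) z) Z *\<^sub>R vnorm N (g Z)) \<partial>lborel)"
  proof (rule vnorm_integral_le)
    show "integrable lborel (\<lambda>Z. ?c * (indicator (nbhd (scales k l) z) Z *\<^sub>R vnorm N (g Z)))"
      by (intro integrable_mult_right integrable_nbhd integrable_vnorm gi)
    show "AE Z in lborel. vnorm N (\<lambda>i. - ((g Z i $ j) * prim \<kappa> ?a z Z)) \<le> ?c * (indicator (nbhd (scales k l) z) Z *\<^sub>R vnorm N (g Z))"
    proof (rule AE_I2)
      fix Z
      have "vnorm N (\<lambda>i. - ((g Z i $ j) * prim \<kappa> ?a z Z)) \<le> \<bar>prim \<kappa> ?a z Z\<bar> * vnorm N (g Z)"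
        by (rule vnorm_cmult_le) (auto simp: abs_mult mult.commute component_le_norm_cart intro!: mult_right_mono)
      also have "\<dots> \<le> (?c * indicator (nbhd (scales k l) z) Z) * vnorm N (g Z)"
        by (rule mult_right_mono[OF ple]) simp
      finally show "vnorm N (\<lambda>i. - ((g Z i $ j) * prim \<kappa> ?a z Z)) \<le> ?c * (indicator (nbhd (scales k l) z) Z *\<^sub>R vnorm N (g Z))"
        by (simp add: mult.assoc)
    qed
  qed (use int in auto)
  also have "\<dots> = ker_bound_st TYPE(real^'n) / 2 ^ k * avg (\<lambda>Z. vnorm N (g Z)) k l z"
    by (simp add: avg_def)
  finally show ?thesis .
qed

text \<open>
  The space coordinates are refined one at a time.
\<close>

lemma space_step:
  fixes z :: "(real^'n) \<times> real"
  assumes sol: "unit_solution N v g G" and s': "s = 1 / (8 * real CARD('n))" and z: "z \<in> unit_cyl"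
  shows "vnorm N (\<lambda>i. ker_mean v (scales k l) z i - ker_mean v (scales (Suc k) l) z i)
    \<le> real CARD('n) * (ker_bound_st TYPE(real^'n) / 2 ^ k * avg (\<lambda>Z. vnorm N (g Z)) k l z)"
proof -
  define \<kappa> :: "'n set \<Rightarrow> (real^'n) \<times> real \<Rightarrow> nat" where
    "\<kappa> J b = (if b = (0, 1) then l else if \<exists>j\<in>J. b = (axis j 1, 0) then Suc k else k)" for J b
  define B where "B = ker_bound_st TYPE(real^'n) / 2 ^ k * avg (\<lambda>Z. vnorm N (g Z)) k l z"
  have "vnorm N (\<lambda>i. ker_mean v (\<kappa> {}) z i - ker_mean v (\<kappa> J) z i) \<le> real (card J) * B" if "finite J" for J
    using that
  proof (induction J)
    case empty
    then show ?case by (simp add: vnorm_zero)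
  next
    case (insert j J)
    have adj: "adj (scales k l) (\<kappa> J)" by (auto simp: adj_def \<kappa>_def scales_def)
    have j: "\<kappa> J (axis j 1, 0) = k" using insert(2) by (auto simp: \<kappa>_def axis_eq_axis)
    have "\<kappa> (insert j J) = (\<kappa> J)((axis j 1, 0) := Suc k)"
      by (auto simp: \<kappa>_def fun_eq_iff)
    then have "vnorm N (\<lambda>i. ker_mean v (\<kappa> J) z i - ker_mean v (\<kappa> (insert j J)) z i) \<le> B"
      using space_step1[OF sol s' z adj j] by (simp add: B_def)
    then have "vnorm N (\<lambda>i. ker_mean v (\<kappa> {}) z i - ker_mean v (\<kappa> (insert j J)) z i) \<le> real (card J) * B + B"
      using vnorm_triangle3[of N "ker_mean v (\<kappa> {}) z" "ker_mean v (\<kappa> (insert j J)) z" "ker_mean v (\<kappa> J) z"] insert(3) by linarith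
    then show ?case using insert by (simp add: distrib_right add.commute)
  qed
  from this[of UNIV] have "vnorm N (\<lambda>i. ker_mean v (\<kappa> {}) z i - ker_mean v (\<kappa> UNIV) z i) \<le> real CARD('n) * B" by simp
  moreover have "ker_mean v (\<kappa> {}) = ker_mean v (scales k l)" "ker_mean v (\<kappa> UNIV) = ker_mean v (scales (Suc k) l)"
    by (rule ker_mean_cong; auto simp: \<kappa>_def scales_def Basis_space_time)+
  ultimately show ?thesis by (simp add: B_def)
qed

text \<open>
  The time derivative of \<open>prim\<close> is the difference of the kernels, and the equation converts it into space derivatives
  of \<open>prim\<close> paired with \<open>G\<close>.
\<close>

lemma time_step:
  fixes z :: "(real^'n) \<times> real"
  assumes sol: "unit_solution N v g G" and s': "s = 1 / (8 * real CARD('n))" and z: "z \<in> unit_cyl"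
  shows "vnorm N (\<lambda>i. ker_mean v (scales k l) z i - ker_mean v (scales k (Suc l)) z i)
    \<le> real CARD('n) * (ker_bound_st TYPE(real^'n) * (2 ^ k / 2 ^ l) * avg (\<lambda>Z. vnorm N (G Z)) k l z)"
proof -
  let ?a = "(0, 1) :: (real^'n) \<times> real" and ?\<kappa> = "scales k l :: (real^'n) \<times> real \<Rightarrow> nat"
  have a: "?a \<in> Basis" by (simp add: Basis_space_time)
  have adj: "adj ?\<kappa> ?\<kappa>" by (simp add: adj_def)
  have ka: "?\<kappa> ?a = l" by (simp add: scales_def)
  have upd: "?\<kappa>(?a := Suc l) = scales k (Suc l)" by (auto simp: scales_def)
  note tf = prim_test_fun[OF s' z adj HOL.refl]
  let ?c = "ker_bound_st TYPE(real^'n) * (2 ^ k * weight ?\<kappa> / 2 ^ l)"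
  let ?d = "\<lambda>j Z. frechet_derivative (prim ?\<kappa> ?a z) (at Z) (axis j 1, 0)"
  have c0: "0 \<le> ?c" using ker_bound_ge_1[where ?'a="(real^'n) \<times> real"] weight_pos[of ?\<kappa>]
    by (intro mult_nonneg_nonneg divide_nonneg_nonneg) (auto simp: less_imp_le)
  have ple: "\<bar>?d j Z\<bar> \<le> ?c * indicator (nbhd ?\<kappa> z) Z" for j Z
  proof -
    have "(axis j 1, 0) \<in> (Basis :: ((real^'n) \<times> real) set)" by (simp add: Basis_space_time)
    from prim_deriv_le[OF adj HOL.refl a this _ HOL.refl unit_cyl_coord[OF z], of Z]
    show ?thesis by (simp add: scales_def)
  qed
  have ple': "\<bar>?d j Z\<bar> \<le> ?c" for j Z
  proof -
    have "\<bar>?d j Z\<bar> \<le> ?c * indicator (nbhd ?\<kappa> z) Z" by (rule ple)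
    also have "\<dots> \<le> ?c * 1" by (intro mult_left_mono c0) (simp add: indicator_def)
    finally show ?thesis by simp
  qed
  have gi: "integrable lborel (\<lambda>z. G z i)" "integrable lborel (\<lambda>z. v z i)" if "i < N" for i
    using sol that by (auto simp: unit_solution_def)
  have int: "integrable lborel (\<lambda>Z. \<Sum>j\<in>UNIV. (G Z i $ j) * ?d j Z)" if "i < N" for i
    by (intro Bochner_Integration.integrable_sum
      bounded_mult_integrable[OF integrable_component[OF gi(1)[OF that]] continuous_prim_deriv ple'])
  have eq: "ker_mean v ?\<kappa> z i - ker_mean v (scales k (Suc l)) z i = (\<integral>Z. (\<Sum>j\<in>UNIV. (G Z i $ j) * ?d j Z) \<partial>lborel)" if "i < N" for i
  proof -
    have "ker_mean v ?\<kappa> z i - ker_mean v (scales k (Suc l)) z i = (\<integral>Z. v Z i * frechet_derivative (prim ?\<kappa> ?a z) (at Z) ?a \<partial>lborel)"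
      using ker_mean_diff[OF gi(2) z a that, where \<kappa>="?\<kappa>"] unfolding ka upd by simp
    then show ?thesis using sol that tf by (simp add: unit_solution_def)
  qed
  have "vnorm N (\<lambda>i. ker_mean v ?\<kappa> z i - ker_mean v (scales k (Suc l)) z i)
      = vnorm N (\<lambda>i. \<integral>Z. (\<Sum>j\<in>UNIV. (G Z i $ j) * ?d j Z) \<partial>lborel)"
    by (rule vnorm_cong) (simp only: eq)
  also have "\<dots> \<le> (\<integral>Z. (real CARD('n) * ?c) * (indicator (nbhd ?\<kappa> z) Z *\<^sub>R vnorm N (G Z)) \<partial>lborel)"
  proof (rule vnorm_integral_le)
    show "integrable lborel (\<lambda>Z. (real CARD('n) * ?c) * (indicator (nbhd ?\<kappa> z) Z *\<^sub>R vnorm N (G Z)))"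
      by (intro integrable_mult_right integrable_nbhd integrable_vnorm gi)
    show "AE Z in lborel. vnorm N (\<lambda>i. \<Sum>j\<in>UNIV. (G Z i $ j) * ?d j Z)
        \<le> (real CARD('n) * ?c) * (indicator (nbhd ?\<kappa> z) Z *\<^sub>R vnorm N (G Z))"
    proof (rule AE_I2)
      fix Z
      have "vnorm N (\<lambda>i. \<Sum>j\<in>UNIV. (G Z i $ j) * ?d j Z)
          \<le> (real CARD('n) * (?c * indicator (nbhd ?\<kappa> z) Z)) * vnorm N (G Z)"
      proof (rule vnorm_cmult_le)
        fix i
        have "\<bar>\<Sum>j\<in>UNIV. (G Z i $ j) * ?d j Z\<bar> \<le> (\<Sum>j\<in>(UNIV::'n set). norm (G Z i) * (?c * indicator (nbhd ?\<kappa> z) Z))"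
        proof (rule order_trans[OF sum_abs], rule sum_mono)
          fix j :: 'n
          show "\<bar>(G Z i $ j) * ?d j Z\<bar> \<le> norm (G Z i) * (?c * indicator (nbhd ?\<kappa> z) Z)"
            unfolding abs_mult by (rule mult_mono[OF component_le_norm_cart ple]) auto
        qed
        then show "norm (\<Sum>j\<in>UNIV. (G Z i $ j) * ?d j Z) \<le> (real CARD('n) * (?c * indicator (nbhd ?\<kappa> z) Z)) * norm (G Z i)"
          by (simp add: mult_ac)
      qed (intro mult_nonneg_nonneg c0; simp)
      then show "vnorm N (\<lambda>i. \<Sum>j\<in>UNIV. (G Z i $ j) * ?d j Z)
        \<le> (real CARD('n) * ?c) * (indicator (nbhd ?\<kappa> z) Z *\<^sub>R vnorm N (G Z))"
        by (simp add: mult.assoc)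
    qed
  qed (use int in auto)
  also have "\<dots> = real CARD('n) * (ker_bound_st TYPE(real^'n) * (2 ^ k / 2 ^ l) * avg (\<lambda>Z. vnorm N (G Z)) k l z)"
    by (simp add: avg_def)
  finally show ?thesis .
qed

end


section \<open>The pointwise estimate on the unit cylinder\<close>

lemma smooth_step_instance:
  assumes "0 < s" "s \<le> 1"
  obtains M I b b' where "smooth_step s M I b b'"
proof (rule smooth_step_exists[OF assms(1)])
  fix I b b' :: "real \<Rightarrow> real"
  assume *: "\<And>k. C_k k b" "\<And>x. (I has_real_derivative b x) (at x)" "\<And>x. (b has_real_derivative b' x) (at x)"
    "\<And>x. x \<le> - s \<Longrightarrow> I x = 0" "\<And>x. s \<le> x \<Longrightarrow> I x = 1"
    "\<And>x. 0 \<le> b x" "\<And>x. s < \<bar>x\<bar> \<Longrightarrow> b x = 0" "\<And>x. s < \<bar>x\<bar> \<Longrightarrow> b' x = 0" "continuous_on UNIV b'"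
  have bd: "\<exists>M. \<forall>x. \<bar>f x\<bar> \<le> M" if "continuous_on UNIV f" "\<And>x. s < \<bar>x\<bar> \<Longrightarrow> f x = 0" for f :: "real \<Rightarrow> real"
  proof -
    have "compact (f ` {- s..s})"
      using that(1) continuous_on_subset by (intro compact_continuous_image) auto
    then have "bounded (f ` {- s..s})" by (rule compact_imp_bounded)
    then obtain M where "\<forall>y\<in>f ` {- s..s}. norm y \<le> M" unfolding bounded_iff ..
    then have M: "\<bar>f x\<bar> \<le> M" if "x \<in> {- s..s}" for x using that by simp
    have "\<bar>f x\<bar> \<le> \<bar>M\<bar>" for x
    proof (cases "s < \<bar>x\<bar>")
      case False
      then have "\<bar>f x\<bar> \<le> M" by (intro M) auto
      then show ?thesis by linarith
    qed (simp add: that(2))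
    then show ?thesis by blast
  qed
  obtain M1 where M1: "\<And>x. \<bar>b x\<bar> \<le> M1" using bd[OF C_k_continuous[OF *(1)] *(7)] by blast
  obtain M2 where M2: "\<And>x. \<bar>b' x\<bar> \<le> M2" using bd[OF *(9,8)] by blast
  show thesis
  proof (rule that)
    show "smooth_step s (max 1 (max M1 M2)) I b b'"
    proof
      show "b x \<le> max 1 (max M1 M2)" for x using M1[of x] by linarith
      show "\<bar>b' x\<bar> \<le> max 1 (max M1 M2)" for x using M2[of x] by linarith
      show "1 \<le> max 1 (max M1 M2)" by simp
    qed (fact assms *)+
  qed
qed

context smooth_step begin

text \<open>
  This replaces Hoelder's inequality for the averages. It follows by integrating
  \<open>h powr t \<le> c powr t + c powr (t - q) * h powr q\<close>, where the two terms dominate for \<open>h \<le> c\<close> and for \<open>h > c\<close>.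
\<close>

lemma avg_powr_le:
  fixes f h :: "(real^'n) \<times> real \<Rightarrow> real"
  assumes h: "\<And>Z. 0 \<le> h Z" and hq: "integrable lborel (\<lambda>Z. h Z powr q)"
    and t: "0 < t" "t \<le> q" and c: "0 < c" and A: "avg (\<lambda>Z. h Z powr q) k l z \<le> c powr q"
    and f: "integrable lborel f" "AE Z in lborel. f Z \<le> B * h Z powr t" and B: "0 \<le> B"
  shows "avg f k l z \<le> B * (4 ^ (CARD('n) + 1) + 1) * c powr t"
proof -
  let ?\<kappa> = "scales k l :: (real^'n) \<times> real \<Rightarrow> nat"
  let ?P = "nbhd ?\<kappa> z"
  have mP: "measure lborel ?P = 4 ^ (CARD('n) + 1) / weight ?\<kappa>" and fP: "emeasure lborel ?P < \<infinity>"
    using emeasure_nbhd[of ?\<kappa> z] weight_pos[of ?\<kappa>] by (simp_all add: measure_def)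
  have intP: "integrable lborel (indicator ?P :: _ \<Rightarrow> real)"
    by (rule integrable_real_indicator) (use fP in \<open>auto simp: nbhd_cbox\<close>)
  have split: "h Z powr t \<le> c powr t + c powr (t - q) * h Z powr q" for Z
  proof (cases "h Z \<le> c")
    case True
    then have "h Z powr t \<le> c powr t" using t h by (intro powr_mono2) auto
    moreover have "0 \<le> c powr (t - q) * h Z powr q" by simp
    ultimately show ?thesis by linarith
  next
    case False
    have "h Z powr t = h Z powr (t - q) * h Z powr q"
      using powr_add[of "h Z" "t - q" q] by simp
    also have "\<dots> \<le> c powr (t - q) * h Z powr q"
      using False c t powr_mono2'[of "t - q" c "h Z"] by (intro mult_right_mono) auto
    moreover have "0 \<le> c powr t" by simp
    ultimately show ?thesis by linarith
  qed
  have "(\<integral>Z. indicator ?P Z * f Z \<partial>lborel)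
      \<le> (\<integral>Z. B * (c powr t * indicator ?P Z + c powr (t - q) * (indicator ?P Z * h Z powr q)) \<partial>lborel)"
  proof (rule integral_mono_AE)
    show "integrable lborel (\<lambda>Z. indicator ?P Z * f Z)"
      using integrable_nbhd[OF f(1), of ?\<kappa> z] by simp
    show "integrable lborel (\<lambda>Z. B * (c powr t * indicator ?P Z + c powr (t - q) * (indicator ?P Z * h Z powr q)))"
      using integrable_nbhd[OF hq, of ?\<kappa> z] intP by (intro integrable_mult_right Bochner_Integration.integrable_add) auto
    show "AE Z in lborel. indicator ?P Z * f Z \<le> B * (c powr t * indicator ?P Z + c powr (t - q) * (indicator ?P Z * h Z powr q))"
      using f(2)
    proof (rule AE_mp, intro AE_I2 impI)
      fix Z assume "f Z \<le> B * h Z powr t"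
      also have "\<dots> \<le> B * (c powr t + c powr (t - q) * h Z powr q)" by (intro mult_left_mono split B)
      finally show "indicator ?P Z * f Z \<le> B * (c powr t * indicator ?P Z + c powr (t - q) * (indicator ?P Z * h Z powr q))"
        by (simp add: indicator_def)
    qed
  qed
  also have "\<dots> = B * (c powr t * measure lborel ?P + c powr (t - q) * (\<integral>Z. indicator ?P Z * h Z powr q \<partial>lborel))"
    using integrable_nbhd[OF hq, of ?\<kappa> z] intP by simp
  finally have "avg f k l z \<le> weight ?\<kappa> * (B * (c powr t * measure lborel ?P + c powr (t - q) * (\<integral>Z. indicator ?P Z * h Z powr q \<partial>lborel)))"
    unfolding avg_def using weight_pos[of ?\<kappa>] by (intro mult_left_mono) auto
  also have "\<dots> = B * (c powr t * 4 ^ (CARD('n) + 1) + c powr (t - q) * avg (\<lambda>Z. h Z powr q) k l z)"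
  proof -
    have "w * (B * (x * (y / w) + u * j)) = B * (x * y + u * (w * j))" if "0 < w" for w x y u j :: real
      using that by (simp add: algebra_simps)
    then show ?thesis unfolding mP avg_def using weight_pos[of ?\<kappa>] by blast
  qed
  also have "\<dots> \<le> B * (c powr t * 4 ^ (CARD('n) + 1) + c powr (t - q) * c powr q)"
    by (intro mult_left_mono add_left_mono A B) auto
  also have "c powr (t - q) * c powr q = c powr t"
    using powr_add[of c "t - q" q] by simp
  also have "B * (c powr t * 4 ^ (CARD('n) + 1) + c powr t) = B * (4 ^ (CARD('n) + 1) + 1) * c powr t"
    by (simp add: algebra_simps)
  finally show ?thesis .
qed

lemma ennreal_avg:
  fixes f :: "(real^'n) \<times> real \<Rightarrow> real"
  assumes h: "\<And>Z. 0 \<le> f Z" and f: "integrable lborel f"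
  shows "ennreal (avg f k l z) = ennreal (weight (scales k l :: (real^'n) \<times> real \<Rightarrow> nat)) *
    (\<integral>\<^sup>+Z. ennreal (f Z) * indicator (nbhd (scales k l) z) Z \<partial>lborel)"
proof -
  have "(\<integral>\<^sup>+Z. ennreal (f Z) * indicator (nbhd (scales k l) z) Z \<partial>lborel) =
      (\<integral>\<^sup>+Z. ennreal (indicator (nbhd (scales k l) z) Z * f Z) \<partial>lborel)"
    by (intro nn_integral_cong) (simp add: indicator_def)
  also have "\<dots> = ennreal (\<integral>Z. indicator (nbhd (scales k l) z) Z * f Z \<partial>lborel)"
    using integrable_nbhd[OF f, of "scales k l" z] h by (intro nn_integral_eq_integral) auto
  finally show ?thesis
    unfolding avg_def using weight_pos[of "scales k l :: (real^'n) \<times> real \<Rightarrow> nat"] h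
    by (simp add: ennreal_mult')
qed

text \<open>
  The supremum over all pairs of scales is replaced by a sum with geometric weights. The weights lose an
  arbitrarily small power of the widths, but the integral of the sum is computed by Tonelli, and no covering argument for
  boxes of different eccentricity is necessary.
\<close>

lemma maximal_function:
  fixes f :: "(real^'n) \<times> real \<Rightarrow> real" and r :: real
  assumes f0: "\<And>Z. 0 \<le> f Z" and f: "integrable lborel f" and r: "0 < r" "r < 1"
  obtains Y where "Y \<in> borel_measurable borel" "\<And>z. 0 \<le> Y z" "integrable lborel Y"
    "(\<integral>z. Y z \<partial>lborel) \<le> 4 ^ (CARD('n) + 1) / (1 - r)\<^sup>2 * (\<integral>z. f z \<partial>lborel)"
    "AE z in lborel. \<forall>k l. r ^ k * r ^ l * avg f k l z \<le> Y z"
proof -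
  have [measurable]: "f \<in> borel_measurable borel" using f by auto
  define A where "A k l z = ennreal (weight (scales k l :: (real^'n) \<times> real \<Rightarrow> nat)) *
    (\<integral>\<^sup>+Z. ennreal (f Z) * indicator (nbhd (scales k l) z) Z \<partial>lborel)" for k l and z :: "(real^'n) \<times> real"
  have [measurable]: "(\<lambda>(z, Z). indicator (nbhd (scales k l) z) Z :: ennreal) \<in> borel_measurable (borel \<Otimes>\<^sub>M borel)"
    for k l :: nat
    using measurable_nbhd[of "scales k l"] by (auto simp: split_beta' indicator_def intro!: measurable_If)
  have Am [measurable]: "A k l \<in> borel_measurable borel" for k l
    unfolding A_def[abs_def] by measurable
  define F where "F = (\<integral>z. f z \<partial>lborel)"
  have F0: "0 \<le> F" unfolding F_def using f0 by (intro integral_nonneg_AE) auto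
  have intA: "(\<integral>\<^sup>+z. A k l z \<partial>lborel) = ennreal (4 ^ (CARD('n) + 1) * F)" for k l
    unfolding A_def using f0 F0
    by (subst nn_integral_average) (simp_all add: nn_integral_eq_integral[OF f] F_def ennreal_mult)
  define Ye where "Ye z = (\<Sum>k. \<Sum>l. ennreal (r ^ k) * (ennreal (r ^ l) * A k l z))" for z
  have [measurable]: "Ye \<in> borel_measurable borel"
    unfolding Ye_def[abs_def] by measurable
  have geo: "(\<Sum>k. ennreal (r ^ k)) = ennreal (1 / (1 - r))"
    using r suminf_geometric[of r] by (subst suminf_ennreal2) (auto simp: summable_geometric)
  have "(\<integral>\<^sup>+z. Ye z \<partial>lborel) = (\<Sum>k. \<Sum>l. ennreal (r ^ k) * (ennreal (r ^ l) * ennreal (4 ^ (CARD('n) + 1) * F)))"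
    unfolding Ye_def by (simp add: nn_integral_suminf nn_integral_cmult intA)
  also have "\<dots> = ennreal (1 / (1 - r)) * (ennreal (1 / (1 - r)) * ennreal (4 ^ (CARD('n) + 1) * F))"
    by (simp add: ennreal_suminf_cmult ennreal_suminf_multc geo)
  also have "\<dots> = ennreal (4 ^ (CARD('n) + 1) / (1 - r)\<^sup>2 * F)"
    using r F0 by (simp add: ennreal_mult[symmetric] power2_eq_square)
  finally have intY: "(\<integral>\<^sup>+z. Ye z \<partial>lborel) = ennreal (4 ^ (CARD('n) + 1) / (1 - r)\<^sup>2 * F)" .
  have fin: "AE z in lborel. Ye z \<noteq> \<infinity>"
    by (rule nn_integral_PInf_AE) (auto simp: intY)
  have nnY: "(\<integral>\<^sup>+z. ennreal (enn2real (Ye z)) \<partial>lborel) = (\<integral>\<^sup>+z. Ye z \<partial>lborel)"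
    by (rule nn_integral_cong_AE) (use fin in \<open>auto simp: top.not_eq_extremum\<close>)
  show thesis
  proof (rule that[of "\<lambda>z. enn2real (Ye z)"])
    show "integrable lborel (\<lambda>z. enn2real (Ye z))"
      by (rule integrableI_nonneg) (auto simp: nnY intY)
    show "(\<integral>z. enn2real (Ye z) \<partial>lborel) \<le> 4 ^ (CARD('n) + 1) / (1 - r)\<^sup>2 * (\<integral>z. f z \<partial>lborel)"
      using F0 by (subst integral_eq_nn_integral) (auto simp: nnY intY F_def)
    show "AE z in lborel. \<forall>k l. r ^ k * r ^ l * avg f k l z \<le> enn2real (Ye z)"
      using fin
    proof (rule AE_mp, intro AE_I2 impI allI)
      fix z k l assume fin: "Ye z \<noteq> \<infinity>"
      have "avg f k l z \<ge> 0"
        unfolding avg_def using weight_pos[of "scales k l :: (real^'n) \<times> real \<Rightarrow> nat"] f0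
        by (intro mult_nonneg_nonneg integral_nonneg_AE) auto
      then have "ennreal (r ^ k * r ^ l * avg f k l z) = ennreal (r ^ k) * (ennreal (r ^ l) * A k l z)"
        unfolding A_def using r by (simp add: ennreal_mult ennreal_avg[OF f0 f] mult.assoc)
      also have "\<dots> \<le> (\<Sum>l. ennreal (r ^ k) * (ennreal (r ^ l) * A k l z))"
        using sum_le_suminf[of "\<lambda>l. ennreal (r ^ k) * (ennreal (r ^ l) * A k l z)" "{l}"] by simp
      also have "\<dots> \<le> Ye z"
        unfolding Ye_def using sum_le_suminf[of "\<lambda>k. \<Sum>l. ennreal (r ^ k) * (ennreal (r ^ l) * A k l z)" "{k}"] by simp
      finally show "r ^ k * r ^ l * avg f k l z \<le> enn2real (Ye z)"
        using fin r by (cases "Ye z") (auto simp: ennreal_le_iff)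
    qed
  qed auto
qed

lemma vnorm_tendsto:
  fixes w :: "nat \<Rightarrow> real"
  assumes "\<And>i. i < N \<Longrightarrow> (\<lambda>j. w' j i) \<longlonglongrightarrow> w i"
  shows "(\<lambda>j. vnorm N (w' j)) \<longlonglongrightarrow> vnorm N w"
  unfolding vnorm_def L2_set_def by (intro tendsto_intros assms) auto

text \<open>
  At the coarsest scale the centre of the kernel has moved to the origin, so all points share the same kernel mean.
\<close>

lemma ker_0: "ker (scales 0 0) z = ker (scales 0 0) (z' :: (real^'n) \<times> real)"
  by (simp add: ker_def tensor_def beta_def scales_def fun_eq_iff)

text \<open>
  The level \<open>K\<close> at the point \<open>z\<close> is the least one with \<open>Y z \<le> 2 powr (K \<theta>)\<close>. Minimality gives the converse bound
  for \<open>K - 1\<close>, and this is how the integrability of \<open>Y\<close> becomes a bound for the size of the set where \<open>K\<close> is large.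
\<close>

lemma unit_estimate_aux:
  fixes p q \<alpha> D \<delta> Cg H :: real and v :: "(real^'n) \<times> real \<Rightarrow> nat \<Rightarrow> real"
  assumes s': "s = 1 / (8 * real CARD('n))"
    and p: "1 < p" and q: "1 \<le> q" "p - 1 \<le> q" and \<alpha>: "0 < \<alpha>" and D: "D = real CARD('n) + \<alpha>"
    and rel: "\<alpha> - 2 = D / q * (p - 2)" and \<delta>: "0 < \<delta>" "\<delta> \<le> 1 / 6" and \<theta>: "0 < D - \<delta> * (1 + \<alpha>)"
    and H: "1 \<le> H" and Cg: "1 \<le> Cg"
    and C0: "C0 = real CARD('n) * (ker_bound_st TYPE(real^'n) * (Cg * (4 ^ (CARD('n) + 1) + 1)))"
    and C: "C = C0 * ((\<alpha> + 1) * 2 * H powr ((p - 1) / q) * 2 powr (\<alpha> * (p - 1) / q) + H powr (1 / q) * 2 powr (\<alpha> / q)) + 40 * C0"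
    and sol: "unit_solution N v g G"
    and hm: "h \<in> borel_measurable borel" and h0: "\<And>z. 0 \<le> h z"
    and hq: "integrable lborel (\<lambda>z. h z powr q)" and hH: "(\<integral>z. h z powr q \<partial>lborel) \<le> H"
    and g: "AE z in lborel. vnorm N (g z) \<le> h z" and G: "AE z in lborel. vnorm N (G z) \<le> Cg * h z powr (p - 1)"
  shows "\<exists>Y. Y \<in> borel_measurable borel \<and> (\<forall>z. 0 \<le> Y z) \<and> integrable lborel Y \<and>
    (\<integral>z. Y z \<partial>lborel) \<le> 4 ^ (CARD('n) + 1) / (1 - 2 powr (- \<delta>))\<^sup>2 * H \<and>
    (AE z in lborel. z \<in> unit_cyl \<longrightarrow> (\<exists>K::nat.
      vnorm N (\<lambda>i. v z i - ker_mean v (scales 0 0) 0 i) \<le> C * (\<Sum>k\<le>K. 2 powr (real k * (D / q - 1))) \<and>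
      (K = 0 \<or> 2 powr ((real K - 1) * (D - \<delta> * (1 + \<alpha>))) < Y z)))"
proof -
  define r where "r = (2::real) powr (- \<delta>)"
  have r: "0 < r" "r < 1" using \<delta> by (auto simp: r_def powr_less_one)
  define f where "f z = h z powr q" for z
  have f0: "0 \<le> f z" for z by (simp add: f_def)
  have f: "integrable lborel f" unfolding f_def[abs_def] by (rule hq)
  from maximal_function[OF f0 f r] obtain Y where
    Y: "Y \<in> borel_measurable borel" "\<And>z. 0 \<le> Y z" "integrable lborel Y"
    "(\<integral>z. Y z \<partial>lborel) \<le> 4 ^ (CARD('n) + 1) / (1 - r)\<^sup>2 * (\<integral>z. f z \<partial>lborel)"
    "AE z in lborel. \<forall>k l. r ^ k * r ^ l * avg f k l z \<le> Y z" by blast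
  have vi: "integrable lborel (\<lambda>z. v z i)" "integrable lborel (\<lambda>z. g z i)" "integrable lborel (\<lambda>z. G z i)" if "i < N" for i
    using sol that by (auto simp: unit_solution_def)
  have C0_nonneg: "0 \<le> C0" unfolding C0 using Cg ker_bound_ge_1[where ?'a="(real^'n) \<times> real"]
    by (intro mult_nonneg_nonneg) auto
  \<comment> \<open>The chain depends on \<open>z\<close> only through \<open>K\<close>, so there are countably many chains and one null set serves for all of them.\<close>
  have "\<forall>K. \<exists>rr. strict_mono rr \<and> (AE z in lborel. z \<in> unit_cyl \<longrightarrow>
      (\<forall>i<N. (\<lambda>j. ker_mean v (scales (rr j) (path \<alpha> K (rr j))) z i) \<longlonglongrightarrow> v z i))"
    unfolding ker_mean_def
    by (intro allI ker_AE_subseq[OF vi(1) measurable_unit_cyl unit_cyl_coord])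
      (auto simp: scales_def Basis_space_time intro: filterlim_path filterlim_ident)
  from choice[OF this] obtain rr where "\<forall>K. strict_mono (rr K) \<and> (AE z in lborel. z \<in> unit_cyl \<longrightarrow>
      (\<forall>i<N. (\<lambda>j. ker_mean v (scales (rr K j) (path \<alpha> K (rr K j))) z i) \<longlonglongrightarrow> v z i))" ..
  then have rr: "AE z in lborel. z \<in> unit_cyl \<longrightarrow>
      (\<forall>i<N. (\<lambda>j. ker_mean v (scales (rr K j) (path \<alpha> K (rr K j))) z i) \<longlonglongrightarrow> v z i)" for K
    by (elim allE[of _ K] conjE)
  have AE_rr: "AE z in lborel. \<forall>K. z \<in> unit_cyl \<longrightarrow>
      (\<forall>i<N. (\<lambda>j. ker_mean v (scales (rr K j) (path \<alpha> K (rr K j))) z i) \<longlonglongrightarrow> v z i)"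
    by (subst AE_all_countable) (intro allI rr)
  show ?thesis
  proof (intro exI[of _ Y] conjI allI Y(1-3))
    have "4 ^ (CARD('n) + 1) / (1 - r)\<^sup>2 * (\<integral>z. f z \<partial>lborel) \<le> 4 ^ (CARD('n) + 1) / (1 - r)\<^sup>2 * H"
      using hH by (intro mult_left_mono) (auto simp: f_def)
    then show "(\<integral>z. Y z \<partial>lborel) \<le> 4 ^ (CARD('n) + 1) / (1 - 2 powr (- \<delta>))\<^sup>2 * H"
      using Y(4) by (simp add: r_def)
    show "AE z in lborel. z \<in> unit_cyl \<longrightarrow> (\<exists>K::nat.
      vnorm N (\<lambda>i. v z i - ker_mean v (scales 0 0) 0 i) \<le> C * (\<Sum>k\<le>K. 2 powr (real k * (D / q - 1))) \<and>
      (K = 0 \<or> 2 powr ((real K - 1) * (D - \<delta> * (1 + \<alpha>))) < Y z))"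
      using Y(5) AE_rr
    proof (rule AE_mp[OF AE_conjI], intro AE_I2 impI)
      fix z
      assume *: "(\<forall>k l. r ^ k * r ^ l * avg f k l z \<le> Y z) \<and> (\<forall>K. z \<in> unit_cyl \<longrightarrow>
        (\<forall>i<N. (\<lambda>j. ker_mean v (scales (rr K j) (path \<alpha> K (rr K j))) z i) \<longlonglongrightarrow> v z i))"
        and z: "z \<in> unit_cyl"
      have Yz: "r ^ k * r ^ l * avg f k l z \<le> Y z" for k l
        by (rule spec[OF spec[OF conjunct1[OF *]]])
      have lim: "(\<lambda>j. ker_mean v (scales (rr K j) (path \<alpha> K (rr K j))) z i) \<longlonglongrightarrow> v z i" if "i < N" for K i
        using spec[OF mp[OF spec[OF conjunct2[OF *], of K] z], of i] that by (rule mp)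
      define \<theta> where "\<theta> = D - \<delta> * (1 + \<alpha>)"
      have \<theta>0: "0 < \<theta>" using \<theta> by (simp add: \<theta>_def)
      have exK: "\<exists>K::nat. Y z \<le> 2 powr (real K * \<theta>)"
      proof -
        have "1 < 2 powr \<theta>" using \<theta>0 by simp
        then obtain K where "Y z < (2 powr \<theta>) ^ K" using real_arch_pow by blast
        also have "(2 powr \<theta>) ^ K = (2 powr \<theta>) powr real K"
          by (rule powr_realpow[symmetric]) simp
        also have "\<dots> = 2 powr (real K * \<theta>)"
          by (simp only: powr_powr mult.commute)
        finally show ?thesis by (intro exI[of _ K]) simp
      qed
      define K where "K = (LEAST K::nat. Y z \<le> 2 powr (real K * \<theta>))"
      have K1: "Y z \<le> 2 powr (real K * \<theta>)"
        unfolding K_def using exK by (rule LeastI_ex)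
      have K2: "K = 0 \<or> 2 powr ((real K - 1) * \<theta>) < Y z"
      proof (cases K)
        case (Suc m)
        then have "\<not> Y z \<le> 2 powr (real m * \<theta>)"
          using not_less_Least[of m "\<lambda>K. Y z \<le> 2 powr (real K * \<theta>)"] by (simp add: K_def)
        then show ?thesis using Suc by simp
      qed simp
      define dst where "dst x y = vnorm N (\<lambda>i. ker_mean v (scales (fst x) (snd x)) z i - ker_mean v (scales (fst y) (snd y)) z i)" for x y
      have bound: "dst (0, 0) (j, path \<alpha> K j) \<le> C * (\<Sum>k\<le>K. 2 powr (real k * (D / q - 1)))" for j
        unfolding C
      proof (rule path_estimate[where A="\<lambda>k l. avg f k l z" and Y="Y z" and n="CARD('n)"])
        show "dst x x = 0" for x by (simp add: dst_def vnorm_zero)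
        show "dst x y \<le> dst x w + dst w y" for x y w unfolding dst_def by (rule vnorm_triangle3)
        show "dst (k, l) (Suc k, l) \<le> C0 * c / 2 ^ k" if "0 < c" "avg f k l z \<le> c powr q" for k l c
        proof -
          have "avg (\<lambda>Z. vnorm N (g Z)) k l z \<le> 1 * (4 ^ (CARD('n) + 1) + 1) * c powr 1"
            by (rule avg_powr_le[OF h0 hq]) (use q that[unfolded f_def[abs_def]] g integrable_vnorm[OF vi(2)] h0 in simp_all)
          also have "\<dots> \<le> Cg * (4 ^ (CARD('n) + 1) + 1) * c powr 1"
            using Cg by (intro mult_right_mono) auto
          also have "c powr 1 = c" using that(1) by simp
          finally have "real CARD('n) * (ker_bound_st TYPE(real^'n) / 2 ^ k * avg (\<lambda>Z. vnorm N (g Z)) k l z)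
              \<le> real CARD('n) * (ker_bound_st TYPE(real^'n) / 2 ^ k * (Cg * (4 ^ (CARD('n) + 1) + 1) * c))"
            using ker_bound_ge_1[where ?'a="(real^'n) \<times> real"] by (intro mult_left_mono) auto
          also have "\<dots> = C0 * c / 2 ^ k" by (simp add: C0)
          finally show ?thesis using space_step[OF sol s' z, of k l] by (simp add: dst_def)
        qed
        show "dst (k, l) (k, Suc l) \<le> C0 * (2 ^ k / 2 ^ l) * c powr (p - 1)" if "0 < c" "avg f k l z \<le> c powr q" for k l c
        proof -
          have "avg (\<lambda>Z. vnorm N (G Z)) k l z \<le> Cg * (4 ^ (CARD('n) + 1) + 1) * c powr (p - 1)"
            by (rule avg_powr_le[OF h0 hq]) (use p q Cg that[unfolded f_def[abs_def]] G integrable_vnorm[OF vi(3)] in simp_all)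
          then have "real CARD('n) * (ker_bound_st TYPE(real^'n) * (2 ^ k / 2 ^ l) * avg (\<lambda>Z. vnorm N (G Z)) k l z)
              \<le> real CARD('n) * (ker_bound_st TYPE(real^'n) * (2 ^ k / 2 ^ l) * (Cg * (4 ^ (CARD('n) + 1) + 1) * c powr (p - 1)))"
            using ker_bound_ge_1[where ?'a="(real^'n) \<times> real"] by (intro mult_left_mono) auto
          also have "\<dots> = C0 * (2 ^ k / 2 ^ l) * c powr (p - 1)" by (simp add: C0)
          finally show ?thesis using time_step[OF sol s' z, of k l] by (simp add: dst_def)
        qed
        show "avg f k l z \<le> H * 2 ^ (k * CARD('n) + l)" for k l
        proof -
          have "(\<integral>Z. indicator (nbhd (scales k l) z) Z * f Z \<partial>lborel) \<le> (\<integral>Z. f Z \<partial>lborel)"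
            using integrable_nbhd[OF f, of "scales k l" z] f f0 by (intro integral_mono) (auto simp: indicator_def)
          also have "\<dots> \<le> H" using hH by (simp add: f_def)
          finally show ?thesis unfolding avg_def weight_scales by (simp add: mult.commute mult_right_mono)
        qed
        show "avg f k l z \<le> Y z * 2 powr (\<delta> * (real k + real l))" for k l
        proof -
          have rk: "r ^ m = 2 powr (- \<delta> * real m)" for m
            by (simp add: r_def powr_realpow[symmetric] powr_powr)
          have "r ^ k * r ^ l = 2 powr (- \<delta> * real k + - \<delta> * real l)"
            unfolding rk by (rule powr_add[symmetric])
          also have "- \<delta> * real k + - \<delta> * real l = - (\<delta> * (real k + real l))"
            by (simp add: distrib_left)
          finally have "2 powr (- (\<delta> * (real k + real l))) * avg f k l z \<le> Y z" using Yz[of k l] by simp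
          then have "2 powr (\<delta> * (real k + real l)) * (2 powr (- (\<delta> * (real k + real l))) * avg f k l z)
              \<le> 2 powr (\<delta> * (real k + real l)) * Y z" by (intro mult_left_mono) auto
          moreover have "2 powr x * (2 powr (- x) * y) = y" for x y :: real
            by (simp add: powr_minus)
          ultimately show ?thesis by (simp only: mult.commute[of "Y z"])
        qed
        show "Y z \<le> 2 powr (real K * (D - \<delta> * (1 + \<alpha>)))" using K1 by (simp add: \<theta>_def)
      qed (rule p q \<alpha> D rel \<delta> H C0_nonneg)+
      have "(\<lambda>j. vnorm N (\<lambda>i. ker_mean v (scales 0 0) z i - ker_mean v (scales (rr K j) (path \<alpha> K (rr K j))) z i))
          \<longlonglongrightarrow> vnorm N (\<lambda>i. ker_mean v (scales 0 0) z i - v z i)"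
        by (intro vnorm_tendsto tendsto_intros lim)
      then have "vnorm N (\<lambda>i. ker_mean v (scales 0 0) z i - v z i) \<le> C * (\<Sum>k\<le>K. 2 powr (real k * (D / q - 1)))"
      proof (rule LIMSEQ_le_const2, intro exI[of _ 0] allI impI)
        fix j
        show "vnorm N (\<lambda>i. ker_mean v (scales 0 0) z i - ker_mean v (scales (rr K j) (path \<alpha> K (rr K j))) z i)
            \<le> C * (\<Sum>k\<le>K. 2 powr (real k * (D / q - 1)))"
          using bound[of "rr K j"] by (simp only: dst_def fst_conv snd_conv)
      qed
      moreover have "ker_mean v (scales 0 0) z = ker_mean v (scales 0 0) 0"
        unfolding ker_mean_def ker_0[of z 0] ..
      ultimately have "vnorm N (\<lambda>i. v z i - ker_mean v (scales 0 0) 0 i) \<le> C * (\<Sum>k\<le>K. 2 powr (real k * (D / q - 1)))"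
        by (subst vnorm_minus) simp
      with K2 show "\<exists>K::nat.
        vnorm N (\<lambda>i. v z i - ker_mean v (scales 0 0) 0 i) \<le> C * (\<Sum>k\<le>K. 2 powr (real k * (D / q - 1))) \<and>
        (K = 0 \<or> 2 powr ((real K - 1) * (D - \<delta> * (1 + \<alpha>))) < Y z)"
        unfolding \<theta>_def by blast
    qed
  qed
qed

end

theorem unit_estimate:
  fixes p q \<alpha> D \<theta> Cg H :: real
  assumes p: "1 < p" and q: "1 \<le> q" "p - 1 \<le> q" and \<alpha>: "0 < \<alpha>" and D: "D = real CARD('n) + \<alpha>"
    and rel: "\<alpha> - 2 = D / q * (p - 2)" and \<theta>: "0 < \<theta>" "\<theta> < D"
    and H: "1 \<le> H" and Cg: "1 \<le> Cg"
  shows "\<exists>C>0. \<forall>N (v :: (real^'n) \<times> real \<Rightarrow> nat \<Rightarrow> real) g G h.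
    unit_solution N v g G \<longrightarrow> h \<in> borel_measurable borel \<longrightarrow> (\<forall>z. 0 \<le> h z) \<longrightarrow>
    integrable lborel (\<lambda>z. h z powr q) \<longrightarrow> (\<integral>z. h z powr q \<partial>lborel) \<le> H \<longrightarrow>
    (AE z in lborel. vnorm N (g z) \<le> h z) \<longrightarrow> (AE z in lborel. vnorm N (G z) \<le> Cg * h z powr (p - 1)) \<longrightarrow>
    (\<exists>a Y. Y \<in> borel_measurable borel \<and> (\<forall>z. 0 \<le> Y z) \<and> integrable lborel Y \<and> (\<integral>z. Y z \<partial>lborel) \<le> C \<and>
      (AE z in lborel. z \<in> unit_cyl \<longrightarrow> (\<exists>K::nat.
        vnorm N (\<lambda>i. v z i - a i) \<le> C * (\<Sum>k\<le>K. 2 powr (real k * (D / q - 1))) \<and> 2 powr (real K * \<theta>) \<le> Y z)))"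
proof -
  define s where "s = 1 / (8 * real CARD('n))"
  have n: "1 \<le> real CARD('n)" by (simp add: Suc_leI)
  have s: "0 < s" "s \<le> 1" unfolding s_def using n by (simp, subst divide_le_eq_1_pos) (simp, linarith)
  obtain M I b b' where ss: "smooth_step s M I b b'" using smooth_step_instance[OF s] by blast
  interpret smooth_step s M I b b' by (rule ss)
  \<comment> \<open>The loss in the maximal function reduces the exponent from \<open>D\<close> to \<open>D - \<delta> (1 + \<alpha>)\<close>, which may be kept above \<open>\<theta>\<close>.\<close>
  define \<delta> where "\<delta> = min (1 / 6) ((D - \<theta>) / (1 + \<alpha>))"
  have \<delta>: "0 < \<delta>" "\<delta> \<le> 1 / 6" using \<theta> \<alpha> by (simp add: \<delta>_def, simp only: \<delta>_def min.cobounded1)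
  have "\<delta> * (1 + \<alpha>) \<le> (D - \<theta>) / (1 + \<alpha>) * (1 + \<alpha>)" using \<alpha> by (intro mult_right_mono) (auto simp: \<delta>_def)
  then have \<theta>': "\<theta> \<le> D - \<delta> * (1 + \<alpha>)" using \<alpha> by simp
  define C0 where "C0 = real CARD('n) * (ker_bound_st TYPE(real^'n) * (Cg * (4 ^ (CARD('n) + 1) + 1)))"
  define C1 where "C1 = C0 * ((\<alpha> + 1) * 2 * H powr ((p - 1) / q) * 2 powr (\<alpha> * (p - 1) / q) + H powr (1 / q) * 2 powr (\<alpha> / q)) + 40 * C0"
  define U where "U = measure lborel (unit_cyl :: ((real^'n) \<times> real) set)"
  define C2 where "C2 = 2 powr \<theta> * (U + 4 ^ (CARD('n) + 1) / (1 - 2 powr (- \<delta>))\<^sup>2 * H)"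
  have bU: "bounded (unit_cyl :: ((real^'n) \<times> real) set)"
    unfolding unit_cyl_def by (intro bounded_Times) auto
  have finU: "emeasure lborel (unit_cyl :: ((real^'n) \<times> real) set) < \<infinity>"
    using emeasure_bounded_finite[OF bU] .
  show ?thesis
  proof (intro exI[of _ "max 1 (max C1 C2)"] conjI allI impI)
    fix N and v :: "(real^'n) \<times> real \<Rightarrow> nat \<Rightarrow> real" and g G h
    assume sol: "unit_solution N v g G" and hm: "h \<in> borel_measurable borel" and h0: "\<forall>z. 0 \<le> h z"
      and hq: "integrable lborel (\<lambda>z. h z powr q)" and hH: "(\<integral>z. h z powr q \<partial>lborel) \<le> H"
      and g: "AE z in lborel. vnorm N (g z) \<le> h z" and G: "AE z in lborel. vnorm N (G z) \<le> Cg * h z powr (p - 1)"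
    have "0 < D - \<delta> * (1 + \<alpha>)" using \<theta> \<theta>' by linarith
    note aux = unit_estimate_aux[OF s_def p q \<alpha> D rel \<delta> this H Cg C0_def C1_def sol hm h0[rule_format] hq hH g G]
    obtain Y where Y: "Y \<in> borel_measurable borel" "\<forall>z. 0 \<le> Y z" "integrable lborel Y"
      "(\<integral>z. Y z \<partial>lborel) \<le> 4 ^ (CARD('n) + 1) / (1 - 2 powr (- \<delta>))\<^sup>2 * H"
      "AE z in lborel. z \<in> unit_cyl \<longrightarrow> (\<exists>K::nat.
        vnorm N (\<lambda>i. v z i - ker_mean v (scales 0 0) 0 i) \<le> C1 * (\<Sum>k\<le>K. 2 powr (real k * (D / q - 1))) \<and>
        (K = 0 \<or> 2 powr ((real K - 1) * (D - \<delta> * (1 + \<alpha>))) < Y z))"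
      using aux by (elim exE conjE) (rule that)
    have Y0: "0 \<le> Y z" for z using Y(2) by (rule spec)
    \<comment> \<open>The factor turns the bound for \<open>K - 1\<close> into one for \<open>K\<close>, and the indicator covers the points with \<open>K = 0\<close>.\<close>
    define Y' where "Y' z = 2 powr \<theta> * (indicator unit_cyl z + Y z)" for z
    have intU: "integrable lborel (indicator (unit_cyl :: ((real^'n) \<times> real) set) :: _ \<Rightarrow> real)"
      by (rule integrable_real_indicator) (use finU in auto)
    show "\<exists>a Y. Y \<in> borel_measurable borel \<and> (\<forall>z. 0 \<le> Y z) \<and> integrable lborel Y \<and> (\<integral>z. Y z \<partial>lborel) \<le> max 1 (max C1 C2) \<and>
      (AE z in lborel. z \<in> unit_cyl \<longrightarrow> (\<exists>K::nat.
        vnorm N (\<lambda>i. v z i - a i) \<le> max 1 (max C1 C2) * (\<Sum>k\<le>K. 2 powr (real k * (D / q - 1))) \<and> 2 powr (real K * \<theta>) \<le> Y z))"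
    proof (intro exI[of _ "ker_mean v (scales 0 0) 0"] exI[of _ Y'] conjI allI)
      show "Y' \<in> borel_measurable borel" unfolding Y'_def[abs_def]
        by (intro borel_measurable_times borel_measurable_add borel_measurable_const borel_measurable_indicator Y(1) measurable_unit_cyl)
      show "0 \<le> Y' z" for z by (auto simp: Y'_def intro!: mult_nonneg_nonneg add_nonneg_nonneg Y0)
      show "integrable lborel Y'" unfolding Y'_def[abs_def]
        by (intro integrable_mult_right Bochner_Integration.integrable_add intU Y(3))
      have "(\<integral>z. Y' z \<partial>lborel) = 2 powr \<theta> * (U + (\<integral>z. Y z \<partial>lborel))"
        unfolding Y'_def using intU Y(3) by (simp add: U_def)
      also have "\<dots> \<le> C2" unfolding C2_def using Y(4) by (intro mult_left_mono) auto
      finally show "(\<integral>z. Y' z \<partial>lborel) \<le> max 1 (max C1 C2)" by simp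
      show "AE z in lborel. z \<in> unit_cyl \<longrightarrow> (\<exists>K::nat.
        vnorm N (\<lambda>i. v z i - ker_mean v (scales 0 0) 0 i) \<le> max 1 (max C1 C2) * (\<Sum>k\<le>K. 2 powr (real k * (D / q - 1))) \<and> 2 powr (real K * \<theta>) \<le> Y' z)"
        using Y(5)
      proof (rule AE_mp, intro AE_I2 impI)
        fix z
        assume ex: "z \<in> unit_cyl \<longrightarrow> (\<exists>K::nat.
            vnorm N (\<lambda>i. v z i - ker_mean v (scales 0 0) 0 i) \<le> C1 * (\<Sum>k\<le>K. 2 powr (real k * (D / q - 1))) \<and>
            (K = 0 \<or> 2 powr ((real K - 1) * (D - \<delta> * (1 + \<alpha>))) < Y z))" and z: "z \<in> unit_cyl"
        from ex[rule_format, OF z] obtain K :: nat where K: "vnorm N (\<lambda>i. v z i - ker_mean v (scales 0 0) 0 i) \<le> C1 * (\<Sum>k\<le>K. 2 powr (real k * (D / q - 1)))"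
          "K = 0 \<or> 2 powr ((real K - 1) * (D - \<delta> * (1 + \<alpha>))) < Y z" by blast
        have "2 powr (real K * \<theta>) \<le> Y' z"
        proof (cases "K = 0")
          case True
          have "1 * 1 \<le> 2 powr \<theta> * (1 + Y z)" using \<theta> Y0[of z] by (intro mult_mono ge_one_powr_ge_zero) simp_all
          then show ?thesis using True z by (simp add: Y'_def)
        next
          case False
          have "real K * \<theta> = \<theta> + (real K - 1) * \<theta>" by (simp add: algebra_simps)
          then have "2 powr (real K * \<theta>) = 2 powr \<theta> * 2 powr ((real K - 1) * \<theta>)"
            by (simp only: powr_add)
          also have "\<dots> \<le> 2 powr \<theta> * 2 powr ((real K - 1) * (D - \<delta> * (1 + \<alpha>)))"
            using False \<theta>' by (intro mult_left_mono powr_mono mult_left_mono) auto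
          also have "\<dots> \<le> 2 powr \<theta> * (1 + Y z)"
            using K(2) False by (intro mult_left_mono) auto
          finally show ?thesis using z by (simp add: Y'_def)
        qed
        moreover have "C1 * (\<Sum>k\<le>K. 2 powr (real k * (D / q - 1))) \<le> max 1 (max C1 C2) * (\<Sum>k\<le>K. 2 powr (real k * (D / q - 1)))"
          by (intro mult_right_mono sum_nonneg) auto
        ultimately show "\<exists>K::nat. vnorm N (\<lambda>i. v z i - ker_mean v (scales 0 0) 0 i)
            \<le> max 1 (max C1 C2) * (\<Sum>k\<le>K. 2 powr (real k * (D / q - 1))) \<and> 2 powr (real K * \<theta>) \<le> Y' z"
          using K(1) by (intro exI[of _ K] conjI) linarith+
      qed
    qed
  qed simp
qed


section \<open>Test functions\<close>

lemma test_fun_zero: "test_fun S \<phi> \<Longrightarrow> z \<notin> S \<Longrightarrow> \<phi> z = 0"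
  using closure_subset[of "{x. \<phi> x \<noteq> 0}"] by (auto simp: test_fun_def compactly_inside_def)

lemma test_fun_C_k: "test_fun S \<phi> \<Longrightarrow> C_k k \<phi>"
  by (simp add: test_fun_def)

lemma test_fun_continuous: "test_fun S \<phi> \<Longrightarrow> continuous_on A \<phi>"
  using C_k_continuous[OF test_fun_C_k] continuous_on_subset by blast

lemma test_fun_has_derivative:
  "test_fun S \<phi> \<Longrightarrow> (\<phi> has_derivative frechet_derivative \<phi> (at x)) (at x)"
  by (rule C_k_SucD(1)[OF test_fun_C_k])

lemma compact_closure_subset:
  fixes A :: "'a::euclidean_space set"
  assumes "compact K" "closure A \<subseteq> K"
  shows "compact (closure A)"
  using bounded_subset[OF compact_imp_bounded[OF assms(1)] assms(2)] closed_closure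
  unfolding compact_eq_bounded_closed by blast

lemma test_fun_deriv:
  assumes "test_fun S \<phi>"
  shows "test_fun S (\<lambda>z. frechet_derivative \<phi> (at z) v)"
  unfolding test_fun_def
proof (intro conjI allI)
  show "C_k k (\<lambda>z. frechet_derivative \<phi> (at z) v)" for k
    by (rule C_k_SucD(2)[OF test_fun_C_k[OF assms]])
  let ?K = "closure {z. \<phi> z \<noteq> 0}"
  have K: "compact ?K" "?K \<subseteq> S" using assms by (auto simp: test_fun_def compactly_inside_def)
  have "{z. frechet_derivative \<phi> (at z) v \<noteq> 0} \<subseteq> ?K"
  proof (intro subsetI, rule ccontr)
    fix z assume z: "z \<in> {z. frechet_derivative \<phi> (at z) v \<noteq> 0}" "z \<notin> ?K"
    have "open (- ?K)" by (rule open_Compl[OF closed_closure])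
    have "(\<phi> has_derivative (\<lambda>_. 0)) (at z)"
    proof (rule has_derivative_transform_within_open[OF has_derivative_const[of 0] \<open>open (- ?K)\<close>])
      show "z \<in> - ?K" using z by simp
      show "0 = \<phi> y" if "y \<in> - ?K" for y
        using that closure_subset[of "{z. \<phi> z \<noteq> 0}"] by auto
    qed
    then have "frechet_derivative \<phi> (at z) = (\<lambda>_. 0)" by (rule frechet_derivative_at[symmetric])
    then show False using z by simp
  qed
  then have cl: "closure {z. frechet_derivative \<phi> (at z) v \<noteq> 0} \<subseteq> ?K"
    by (rule closure_minimal) simp
  then show "compactly_inside {z. frechet_derivative \<phi> (at z) v \<noteq> 0} S"
    unfolding compactly_inside_def using K compact_closure_subset[OF K(1) cl] by auto
qed

lemma test_fun_bounded:
  assumes "test_fun S \<phi>"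
  shows "\<exists>c. \<forall>z. \<bar>\<phi> z\<bar> \<le> c"
proof -
  let ?K = "closure {z. \<phi> z \<noteq> 0}"
  have "compact ?K" using assms by (simp add: test_fun_def compactly_inside_def)
  then have "compact (\<phi> ` ?K)" by (intro compact_continuous_image test_fun_continuous[OF assms])
  then have "bounded (\<phi> ` ?K)" by (rule compact_imp_bounded)
  then obtain c where c: "\<forall>y\<in>\<phi> ` ?K. norm y \<le> c" unfolding bounded_iff ..
  have "\<bar>\<phi> z\<bar> \<le> \<bar>c\<bar>" for z
  proof (cases "\<phi> z = 0")
    case False
    then have "\<phi> z \<in> \<phi> ` ?K" using closure_subset[of "{z. \<phi> z \<noteq> 0}"] by blast
    then have "norm (\<phi> z) \<le> c" using c by blast
    then show ?thesis by simp
  qed simp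
  then show ?thesis by (intro exI allI)
qed

lemma test_fun_mono: "test_fun S \<phi> \<Longrightarrow> S \<subseteq> T \<Longrightarrow> test_fun T \<phi>"
  by (auto simp: test_fun_def compactly_inside_def)

lemma test_fun_affine:
  fixes l :: "'a::euclidean_space \<Rightarrow> 'b::euclidean_space"
  assumes \<phi>: "test_fun S \<phi>" and l: "bounded_linear l"
    and S: "\<And>x. d + l x \<in> S \<Longrightarrow> x \<in> T" and K: "\<And>K. compact K \<Longrightarrow> compact {x. d + l x \<in> K}"
  shows "test_fun T (\<lambda>x. \<phi> (d + l x))"
    and "frechet_derivative (\<lambda>x. \<phi> (d + l x)) (at x) v = frechet_derivative \<phi> (at (d + l x)) (l v)"
proof -
  have dl: "((\<lambda>x. d + l x) has_derivative l) (at x)" for x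
    using has_derivative_add[OF has_derivative_const[of d] bounded_linear_imp_has_derivative[OF l]] by simp
  from has_derivative_compose[OF dl test_fun_has_derivative[OF \<phi>]]
  have "((\<lambda>x. \<phi> (d + l x)) has_derivative (\<lambda>v. frechet_derivative \<phi> (at (d + l x)) (l v))) (at x)" .
  from frechet_derivative_at[OF this, symmetric]
  show "frechet_derivative (\<lambda>x. \<phi> (d + l x)) (at x) v = frechet_derivative \<phi> (at (d + l x)) (l v)" by simp
  let ?K = "closure {z. \<phi> z \<noteq> 0}"
  have K': "compact ?K" "?K \<subseteq> S" using \<phi> by (auto simp: test_fun_def compactly_inside_def)
  have cK: "compact {x. d + l x \<in> ?K}" by (rule K[OF K'(1)])
  have "{x. \<phi> (d + l x) \<noteq> 0} \<subseteq> {x. d + l x \<in> ?K}"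
    using closure_subset[of "{z. \<phi> z \<noteq> 0}"] by auto
  then have cl: "closure {x. \<phi> (d + l x) \<noteq> 0} \<subseteq> {x. d + l x \<in> ?K}"
    by (rule closure_minimal) (rule compact_imp_closed[OF cK])
  have "compact (closure {x. \<phi> (d + l x) \<noteq> 0})"
    by (rule compact_closure_subset[OF cK cl])
  moreover have "closure {x. \<phi> (d + l x) \<noteq> 0} \<subseteq> T"
    using cl K'(2) S by blast
  ultimately show "test_fun T (\<lambda>x. \<phi> (d + l x))"
    unfolding test_fun_def compactly_inside_def using C_k_affine[OF l test_fun_C_k[OF \<phi>]] by blast
qed

section \<open>Borel representatives\<close>

text \<open>
  The data are Lebesgue measurable on \<open>Q\<close>, whereas Fubini's theorem and the change of variables are used for Borel functions
  on the whole space. Every function is replaced by a Borel function that agrees with it almost everywhere on \<open>Q\<close> and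
  vanishes outside.
\<close>

lemma borel_representative:
  fixes f :: "'a::euclidean_space \<Rightarrow> real"
  assumes "f \<in> borel_measurable (lebesgue_on Q)" "Q \<in> sets lebesgue"
  obtains f' where "f' \<in> borel_measurable borel" "AE z in lborel. f' z = (if z \<in> Q then f z else 0)"
proof -
  have "(\<lambda>z. if z \<in> Q then f z else 0) \<in> borel_measurable lebesgue"
    using assms by (simp add: borel_measurable_if)
  from completion_ex_borel_measurable_real[OF this] obtain f' where
    "f' \<in> borel_measurable lborel" "AE z in lborel. (if z \<in> Q then f z else 0) = f' z" by blast
  then show thesis by (intro that[of f']) auto
qed

lemma representative_integral:
  fixes f f' :: "'a::euclidean_space \<Rightarrow> real"
  assumes f: "f \<in> borel_measurable (lebesgue_on Q)" and Q: "Q \<in> sets lebesgue"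
    and f': "f' \<in> borel_measurable borel" and eq: "AE z in lborel. f' z = (if z \<in> Q then f z else 0)"
  shows "integrable lborel f' \<longleftrightarrow> integrable (lebesgue_on Q) f"
    and "(\<integral>z. f' z \<partial>lborel) = (LINT z|lebesgue_on Q. f z)"
proof -
  let ?g = "\<lambda>z. indicator Q z *\<^sub>R f z"
  have g: "?g \<in> borel_measurable lebesgue"
    using f Q by (simp add: borel_measurable_restrict_space_iff)
  have f'l: "f' \<in> borel_measurable lebesgue" using f' by (simp add: measurable_completion)
  have f'b: "f' \<in> borel_measurable lborel" using f' by simp
  have ae: "AE z in lebesgue. f' z = ?g z"
    using AE_completion[OF eq] by (rule AE_mp) (simp add: indicator_def)
  have "integrable lborel f' \<longleftrightarrow> integrable lebesgue f'"
    by (rule integrable_completion[OF f'b, symmetric])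
  also have "\<dots> \<longleftrightarrow> integrable lebesgue ?g"
    by (rule integrable_cong_AE[OF f'l g ae])
  also have "\<dots> \<longleftrightarrow> integrable (lebesgue_on Q) f"
    using Q by (simp add: integrable_restrict_space)
  finally show "integrable lborel f' \<longleftrightarrow> integrable (lebesgue_on Q) f" .
  have "(\<integral>z. f' z \<partial>lborel) = (\<integral>z. f' z \<partial>lebesgue)"
    by (rule integral_completion[OF f'b, symmetric])
  also have "\<dots> = (\<integral>z. ?g z \<partial>lebesgue)"
    by (rule integral_cong_AE[OF f'l g ae])
  also have "\<dots> = (LINT z|lebesgue_on Q. f z)"
    using Q by (simp add: integral_restrict_space)
  finally show "(\<integral>z. f' z \<partial>lborel) = (LINT z|lebesgue_on Q. f z)" .
qed

lemma representative_integral_mult: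
  fixes f f' w :: "'a::euclidean_space \<Rightarrow> real"
  assumes f: "f \<in> borel_measurable (lebesgue_on Q)" and Q: "Q \<in> sets lebesgue"
    and f': "f' \<in> borel_measurable borel" and eq: "AE z in lborel. f' z = (if z \<in> Q then f z else 0)"
    and w: "continuous_on UNIV w"
  shows "(\<integral>z. f' z * w z \<partial>lborel) = (LINT z|lebesgue_on Q. f z * w z)"
proof (rule representative_integral(2)[OF _ Q])
  have wb: "w \<in> borel_measurable borel" using w by (rule borel_measurable_continuous_onI)
  then have "w \<in> borel_measurable (lebesgue_on Q)"
    by (intro measurable_restrict_space1 measurable_completion) simp
  then show "(\<lambda>z. f z * w z) \<in> borel_measurable (lebesgue_on Q)" using f by simp
  show "(\<lambda>z. f' z * w z) \<in> borel_measurable borel" using f' wb by simp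
  show "AE z in lborel. f' z * w z = (if z \<in> Q then f z * w z else 0)"
    using eq by (rule AE_mp) simp
qed

lemma integrable_powr_bound:
  fixes f g :: "'a \<Rightarrow> real"
  assumes fin: "finite_measure M" and f: "f \<in> borel_measurable M" and q: "0 < t" "t \<le> q"
    and g: "integrable M (\<lambda>x. g x powr q)" and le: "AE x in M. \<bar>f x\<bar> \<le> c * g x powr t" and g0: "\<And>x. 0 \<le> g x" and c: "0 \<le> c"
  shows "integrable M f"
proof (rule Bochner_Integration.integrable_bound[of _ "\<lambda>x. c * (1 + g x powr q)"])
  interpret finite_measure M by (rule fin)
  show "integrable M (\<lambda>x. c * (1 + g x powr q))" using g by simp
  have "g x powr t \<le> 1 + g x powr q" for x
  proof (cases "g x \<le> 1")
    case True
    then have "g x powr t \<le> 1" using powr_mono2[of t "g x" 1] g0[of x] q by simp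
    then show ?thesis using powr_ge_zero[of "g x" q] by linarith
  next
    case False
    then have "g x powr t \<le> g x powr q" using q by (intro powr_mono) auto
    then show ?thesis by linarith
  qed
  then have cg: "c * g x powr t \<le> c * (1 + g x powr q)" for x by (intro mult_left_mono c)
  show "AE x in M. norm (f x) \<le> norm (c * (1 + g x powr q))"
  proof (rule AE_mp[OF le], intro AE_I2 impI)
    fix x assume "\<bar>f x\<bar> \<le> c * g x powr t"
    also note cg[of x]
    also have "c * (1 + g x powr q) \<le> norm (c * (1 + g x powr q))" by simp
    finally show "norm (f x) \<le> norm (c * (1 + g x powr q))" by simp
  qed
qed (rule f)

section \<open>Caratheodory functions\<close>

lemma tendsto_fun_componentwise:
  fixes f :: "nat \<Rightarrow> 'i \<Rightarrow> 'b::topological_space"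
  shows "f \<longlonglongrightarrow> l \<longleftrightarrow> (\<forall>i. (\<lambda>k. f k i) \<longlonglongrightarrow> l i)"
  using limitin_componentwise[of "\<lambda>_. euclidean" UNIV f l sequentially]
  by (simp add: euclidean_product_topology)

text \<open>
  Rounding the entries down to the grid of mesh \<open>2\<^sup>-\<^sup>k\<close> makes the range countable.
\<close>

definition grid_round :: "nat \<Rightarrow> (nat \<Rightarrow> real^'n) \<Rightarrow> nat \<Rightarrow> real^'n" where
  "grid_round k \<xi> = (\<lambda>i. \<chi> j. of_int \<lfloor>2 ^ k * \<xi> i $ j\<rfloor> / 2 ^ k)"

lemma grid_round_vecs: "\<xi> \<in> vecs N \<Longrightarrow> grid_round k \<xi> \<in> vecs N"
  by (auto simp: vecs_def grid_round_def vec_eq_iff)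

lemma grid_round_tendsto: "(\<lambda>k. grid_round k \<xi>) \<longlonglongrightarrow> \<xi>"
proof -
  have "(\<lambda>k. of_int \<lfloor>2 ^ k * x\<rfloor> / 2 ^ k) \<longlonglongrightarrow> x" for x :: real
  proof (rule real_tendsto_sandwich[of "\<lambda>k. x - (1 / 2) ^ k" _ _ "\<lambda>k. x"])
    have "(\<lambda>k. x - (1 / 2) ^ k) \<longlonglongrightarrow> x - 0" by (intro tendsto_intros LIMSEQ_power_zero) simp
    then show "(\<lambda>k. x - (1 / 2) ^ k) \<longlonglongrightarrow> x" by simp
    show "\<forall>\<^sub>F k in sequentially. x - (1 / 2) ^ k \<le> of_int \<lfloor>2 ^ k * x\<rfloor> / 2 ^ k"
    proof (rule always_eventually, rule allI)
      fix k
      have "2 ^ k * x - 1 \<le> of_int \<lfloor>2 ^ k * x\<rfloor>" by linarith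
      then have "(2 ^ k * x - 1) / 2 ^ k \<le> of_int \<lfloor>2 ^ k * x\<rfloor> / 2 ^ k" by (rule divide_right_mono) simp
      then show "x - (1 / 2) ^ k \<le> of_int \<lfloor>2 ^ k * x\<rfloor> / 2 ^ k" by (simp add: diff_divide_distrib power_divide)
    qed
    show "\<forall>\<^sub>F k in sequentially. of_int \<lfloor>2 ^ k * x\<rfloor> / 2 ^ k \<le> x"
      by (rule always_eventually) (simp add: divide_le_eq mult.commute)
  qed simp
  then show ?thesis
    unfolding tendsto_fun_componentwise by (auto simp: grid_round_def intro!: vec_tendstoI)
qed

lemma grid_countable: "countable (grid_round k ` (vecs N :: (nat \<Rightarrow> real^'n) set))"
proof -
  define dec :: "(nat \<times> 'n \<Rightarrow> int) \<Rightarrow> nat \<Rightarrow> real^'n" where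
    "dec m = (\<lambda>i. if i < N then \<chi> j. of_int (m (i, j)) / 2 ^ k else 0)" for m
  have "grid_round k ` (vecs N :: (nat \<Rightarrow> real^'n) set) \<subseteq> dec ` (PiE ({..<N} \<times> UNIV) (\<lambda>_. UNIV))"
  proof
    fix a :: "nat \<Rightarrow> real^'n" assume "a \<in> grid_round k ` vecs N"
    then obtain \<xi> where \<xi>: "\<xi> \<in> vecs N" "a = grid_round k \<xi>" by blast
    let ?m = "restrict (\<lambda>(i, j). \<lfloor>2 ^ k * \<xi> i $ j\<rfloor>) ({..<N} \<times> UNIV)"
    have "a = dec ?m"
      using \<xi> by (auto simp: dec_def grid_round_def fun_eq_iff vec_eq_iff vecs_def)
    then show "a \<in> dec ` (PiE ({..<N} \<times> UNIV) (\<lambda>_. UNIV))" by (auto intro!: imageI)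
  qed
  moreover have "countable (PiE ({..<N} \<times> (UNIV :: 'n set)) (\<lambda>_. UNIV :: int set))"
    by (rule countable_PiE) auto
  ultimately show ?thesis by (meson countable_image countable_subset)
qed

text \<open>
  Composed with the rounded argument, the field is measurable because the argument has only countably many
  values. Continuity in the second variable carries this over to the limit, outside a null set.
\<close>

lemma caratheodory_measurable:
  fixes A :: "(real^'n) \<times> real \<Rightarrow> (nat \<Rightarrow> real^'n) \<Rightarrow> nat \<Rightarrow> real^'n"
  assumes A: "admissible_field p \<nu> L N S A" and S: "S \<in> sets lebesgue"
    and g: "vmeasurable N S g" and gN: "\<And>z. z \<in> S \<Longrightarrow> g z \<in> vecs N"
  shows "vmeasurable N S (\<lambda>z. A z (g z))"
  unfolding vmeasurable_def
proof (intro allI impI)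
  fix i assume i: "i < N"
  let ?M = "lebesgue_on S"
  have step: "(\<lambda>z. A z (grid_round k (g z)) i) \<in> borel_measurable ?M" for k
  proof (rule measurable_compose_countable'[where I="grid_round k ` vecs N" and f="\<lambda>a z. A z a i" and g="\<lambda>z. grid_round k (g z)"])
    show "(\<lambda>z. A z a i) \<in> borel_measurable ?M" if "a \<in> grid_round k ` vecs N" for a
    proof -
      have "a \<in> vecs N" using that grid_round_vecs by blast
      then show ?thesis using A i unfolding admissible_field_def vmeasurable_def by blast
    qed
    show "(\<lambda>z. grid_round k (g z)) \<in> measurable ?M (count_space (grid_round k ` vecs N))"
    proof (subst measurable_count_space_eq_countable[OF grid_countable], intro conjI ballI)
      show "(\<lambda>z. grid_round k (g z)) \<in> space ?M \<rightarrow> grid_round k ` vecs N"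
        using gN by auto
      fix a :: "nat \<Rightarrow> real^'n" assume a: "a \<in> grid_round k ` vecs N"
      have aN: "a \<in> vecs N" using a grid_round_vecs by blast
      have "(\<lambda>z. grid_round k (g z)) -` {a} \<inter> space ?M =
          {z \<in> space ?M. \<forall>i\<in>{..<N}. \<forall>j\<in>UNIV. of_int \<lfloor>2 ^ k * g z i $ j\<rfloor> / 2 ^ k = a i $ j}"
      proof (intro set_eqI iffI)
        fix z assume z: "z \<in> {z \<in> space ?M. \<forall>i\<in>{..<N}. \<forall>j\<in>UNIV. of_int \<lfloor>2 ^ k * g z i $ j\<rfloor> / 2 ^ k = a i $ j}"
        then have "z \<in> S" by simp
        have "grid_round k (g z) i = a i" for i
        proof (cases "i < N")
          case False
          then show ?thesis using grid_round_vecs[OF gN[OF \<open>z \<in> S\<close>], of k] aN by (simp add: vecs_def)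
        qed (use z in \<open>simp add: grid_round_def vec_eq_iff\<close>)
        then show "z \<in> (\<lambda>z. grid_round k (g z)) -` {a} \<inter> space ?M" using z by auto
      qed (auto simp: grid_round_def)
      also have "\<dots> \<in> sets ?M"
      proof (intro sets.sets_Collect_finite_All)
        fix i j assume "i \<in> {..<N}"
        then have [measurable]: "(\<lambda>z. g z i) \<in> borel_measurable ?M" using g by (simp add: vmeasurable_def)
        have [measurable]: "(\<lambda>z. g z i $ j) \<in> borel_measurable ?M"
          by (rule measurable_compose[OF _ borel_measurable_continuous_onI]) (auto intro!: continuous_intros)
        show "{z \<in> space ?M. of_int \<lfloor>2 ^ k * g z i $ j\<rfloor> / 2 ^ k = a i $ j} \<in> sets ?M"
          by measurable
      qed auto
      finally show "(\<lambda>z. grid_round k (g z)) -` {a} \<inter> space ?M \<in> sets ?M" .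
    qed
  qed (rule grid_countable)
  have "AE z in ?M. continuous_on (vecs N) (A z)"
    using A by (simp add: admissible_field_def)
  then have "AE z in ?M. (\<lambda>k. A z (grid_round k (g z)) i) \<longlonglongrightarrow> A z (g z) i"
  proof (rule AE_mp, intro AE_I2 impI)
    fix z assume z: "z \<in> space ?M" and c: "continuous_on (vecs N) (A z)"
    have "g z \<in> vecs N" using z gN by simp
    then have "(\<lambda>k. A z (grid_round k (g z))) \<longlonglongrightarrow> A z (g z)"
      by (intro continuous_on_tendsto_compose[OF c grid_round_tendsto] always_eventually allI grid_round_vecs)
    then show "(\<lambda>k. A z (grid_round k (g z)) i) \<longlonglongrightarrow> A z (g z) i"
      unfolding tendsto_fun_componentwise by blast
  qed
  then obtain Z where Z: "{z \<in> space ?M. \<not> (\<lambda>k. A z (grid_round k (g z)) i) \<longlonglongrightarrow> A z (g z) i} \<subseteq> Z"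
    "emeasure ?M Z = 0" "Z \<in> sets ?M" by (rule AE_E)
  define f where "f k z = (if z \<in> Z then 0 else A z (grid_round k (g z)) i)" for k z
  define f' where "f' z = (if z \<in> Z then 0 else A z (g z) i)" for z
  have fm: "f k \<in> borel_measurable ?M" for k
    unfolding f_def[abs_def] using Z(3) step[of k] by (intro measurable_If_set) auto
  have "f' \<in> borel_measurable ?M"
  proof (rule borel_measurable_LIMSEQ_metric[OF fm])
    fix z assume "z \<in> space ?M"
    then show "(\<lambda>k. f k z) \<longlonglongrightarrow> f' z" using Z(1) by (auto simp: f_def f'_def)
  qed
  then have "(\<lambda>z. if z \<in> S then f' z else 0) \<in> borel_measurable lebesgue"
    using S by (simp add: borel_measurable_if)
  moreover have "AE z in lebesgue. (if z \<in> S then f' z else 0) = (if z \<in> S then A z (g z) i else 0)"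
  proof -
    have ZS: "Z \<subseteq> S" using sets.sets_into_space[OF Z(3)] by simp
    have "Z \<in> sets lebesgue" using Z(3) S by (simp add: sets_restrict_space_iff)
    moreover have "emeasure lebesgue Z = 0" using Z(2) ZS S by (simp add: emeasure_restrict_space)
    ultimately have "Z \<in> null_sets lebesgue" by auto
    from AE_not_in[OF this] show ?thesis by (rule AE_mp) (simp add: f'_def)
  qed
  ultimately have "(\<lambda>z. if z \<in> S then A z (g z) i else 0) \<in> borel_measurable lebesgue"
    by (rule borel_measurable_AE)
  then show "(\<lambda>z. A z (g z) i) \<in> borel_measurable ?M"
    using S by (simp add: borel_measurable_if)
qed

section \<open>Affine changes of variables\<close>

definition aff :: "real^'n \<Rightarrow> real \<Rightarrow> real \<Rightarrow> real \<Rightarrow> (real^'n) \<times> real \<Rightarrow> (real^'n) \<times> real" where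
  "aff x r t \<sigma> z = (x + r *\<^sub>R fst z, t + \<sigma> * snd z)"

lemma aff_inverse:
  assumes "0 < r" "0 < \<sigma>"
  shows "aff (- (1 / r) *\<^sub>R x) (1 / r) (- t / \<sigma>) (1 / \<sigma>) (aff x r t \<sigma> z) = z"
    and "aff x r t \<sigma> (aff (- (1 / r) *\<^sub>R x) (1 / r) (- t / \<sigma>) (1 / \<sigma>) z) = z"
  using assms by (auto simp: aff_def prod_eq_iff algebra_simps diff_divide_distrib add_divide_distrib)

lemma continuous_aff: "continuous_on A (aff x r t \<sigma>)"
  unfolding aff_def[abs_def] by (intro continuous_intros)

lemma measurable_aff [measurable]: "aff x r t \<sigma> \<in> borel_measurable borel"
  by (rule borel_measurable_continuous_onI[OF continuous_aff])

text \<open>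
  The linear part is diagonal with entries \<open>r\<close> (\<open>n\<close> times) and \<open>\<sigma>\<close>, which gives the factor \<open>r ^ n * \<sigma>\<close>.
\<close>

lemma lborel_aff:
  fixes x :: "real^'n"
  assumes "0 < r" "0 < \<sigma>"
  shows "lborel = density (distr lborel borel (aff x r t \<sigma>)) (\<lambda>_. ennreal (r ^ CARD('n) * \<sigma>))"
proof -
  define c :: "(real^'n) \<times> real \<Rightarrow> real" where "c b = (if b = (0, 1) then \<sigma> else r)" for b
  have T: "(\<lambda>z. (x, t) + (\<Sum>j\<in>Basis. (c j * (z \<bullet> j)) *\<^sub>R j)) = aff x r t \<sigma>"
  proof
    fix z :: "(real^'n) \<times> real"
    show "(x, t) + (\<Sum>j\<in>Basis. (c j * (z \<bullet> j)) *\<^sub>R j) = aff x r t \<sigma> z"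
    proof (rule euclidean_eqI)
      fix b :: "(real^'n) \<times> real" assume b: "b \<in> Basis"
      have "((x, t) + (\<Sum>j\<in>Basis. (c j * (z \<bullet> j)) *\<^sub>R j)) \<bullet> b = (x, t) \<bullet> b + c b * (z \<bullet> b)"
        using b by (simp add: inner_add_left inner_sum_left inner_Basis if_distrib cong: if_cong)
      also have "\<dots> = aff x r t \<sigma> z \<bullet> b"
        using b by (auto simp: Basis_space_time c_def aff_def inner_prod_def inner_add_left)
      finally show "((x, t) + (\<Sum>j\<in>Basis. (c j * (z \<bullet> j)) *\<^sub>R j)) \<bullet> b = aff x r t \<sigma> z \<bullet> b" .
    qed
  qed
  have "(\<Prod>j\<in>Basis. \<bar>c j\<bar>) = r ^ CARD('n) * \<sigma>"
    unfolding prod_Basis_space_time using assms by (simp add: c_def)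
  then show ?thesis
    using lborel_affine_euclidean[of c "(x, t)"] assms unfolding T by (simp add: c_def)
qed

lemma integral_aff:
  fixes f :: "(real^'n) \<times> real \<Rightarrow> 'b::{banach, second_countable_topology}"
  assumes "0 < r" "0 < \<sigma>" and [measurable]: "f \<in> borel_measurable borel"
  shows "integrable lborel f \<longleftrightarrow> integrable lborel (\<lambda>z. f (aff x r t \<sigma> z))"
    and "(\<integral>Z. f Z \<partial>lborel) = (r ^ CARD('n) * \<sigma>) *\<^sub>R (\<integral>z. f (aff x r t \<sigma> z) \<partial>lborel)"
proof -
  have J: "0 < r ^ CARD('n) * \<sigma>" using assms by simp
  have 1: "integrable lborel f \<longleftrightarrow> integrable (distr lborel borel (aff x r t \<sigma>)) (\<lambda>z. (r ^ CARD('n) * \<sigma>) *\<^sub>R f z)"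
    by (subst lborel_aff[OF assms(1,2), of x t], subst integrable_density) (use J in auto)
  also have "\<dots> \<longleftrightarrow> integrable (distr lborel borel (aff x r t \<sigma>)) f"
  proof
    assume *: "integrable (distr lborel borel (aff x r t \<sigma>)) (\<lambda>z. (r ^ CARD('n) * \<sigma>) *\<^sub>R f z)"
    have "integrable (distr lborel borel (aff x r t \<sigma>))
        (\<lambda>z. inverse (r ^ CARD('n) * \<sigma>) *\<^sub>R ((r ^ CARD('n) * \<sigma>) *\<^sub>R f z))"
      by (rule integrable_scaleR_right[OF *])
    moreover have "inverse (r ^ CARD('n) * \<sigma>) *\<^sub>R ((r ^ CARD('n) * \<sigma>) *\<^sub>R f z) = f z" for z
      using left_inverse[of "r ^ CARD('n) * \<sigma>"] J by (simp only: scaleR_scaleR) simp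
    ultimately show "integrable (distr lborel borel (aff x r t \<sigma>)) f" by simp
  qed (rule integrable_scaleR_right)
  also have "\<dots> \<longleftrightarrow> integrable lborel (\<lambda>z. f (aff x r t \<sigma> z))"
    by (rule integrable_distr_eq) auto
  finally show "integrable lborel f \<longleftrightarrow> integrable lborel (\<lambda>z. f (aff x r t \<sigma> z))" .
  have "(\<integral>Z. f Z \<partial>lborel) = (\<integral>z. (r ^ CARD('n) * \<sigma>) *\<^sub>R f z \<partial>distr lborel borel (aff x r t \<sigma>))"
    by (subst lborel_aff[OF assms(1,2), of x t], subst integral_density) (use J in auto)
  also have "\<dots> = (r ^ CARD('n) * \<sigma>) *\<^sub>R (\<integral>z. f (aff x r t \<sigma> z) \<partial>lborel)"
    by (simp add: integral_distr)
  finally show "(\<integral>Z. f Z \<partial>lborel) = (r ^ CARD('n) * \<sigma>) *\<^sub>R (\<integral>z. f (aff x r t \<sigma> z) \<partial>lborel)" .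
qed

lemma AE_aff:
  fixes x :: "real^'n"
  assumes "0 < r" "0 < \<sigma>" "AE Z in lborel. P Z"
  shows "AE z in lborel. P (aff x r t \<sigma> z)"
proof -
  from assms(3) obtain N where N: "{Z \<in> space lborel. \<not> P Z} \<subseteq> N" "emeasure lborel N = 0" "N \<in> sets lborel"
    by (rule AE_E)
  have "AE Z in lborel. Z \<notin> N" by (rule AE_not_in) (use N in auto)
  then have "AE Z in density (distr lborel borel (aff x r t \<sigma>)) (\<lambda>_. ennreal (r ^ CARD('n) * \<sigma>)). Z \<notin> N"
    by (rule subst[OF lborel_aff[OF assms(1,2)], where P="\<lambda>M. AE Z in M. Z \<notin> N"])
  then have "AE Z in distr lborel borel (aff x r t \<sigma>). Z \<notin> N"
    using assms by (subst (asm) AE_density) auto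
  then have "AE z in lborel. aff x r t \<sigma> z \<notin> N"
    using N(3) by (subst (asm) AE_distr_iff) auto
  then show ?thesis by (rule AE_mp) (use N(1) in auto)
qed


section \<open>Weak solutions on an intrinsic cylinder\<close>

lemma measurable_vnorm:
  fixes f :: "'a \<Rightarrow> nat \<Rightarrow> 'b::euclidean_space"
  assumes "\<And>i. i < N \<Longrightarrow> (\<lambda>z. f z i) \<in> borel_measurable M"
  shows "(\<lambda>z. vnorm N (f z)) \<in> borel_measurable M"
  unfolding vnorm_def L2_set_def
  by (intro measurable_compose[OF _ borel_measurable_sqrt] borel_measurable_sum borel_measurable_power
    measurable_compose[OF assms borel_measurable_norm]) auto

lemma measurable_component:
  fixes f :: "'a \<Rightarrow> real^'n"
  assumes "f \<in> borel_measurable M"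
  shows "(\<lambda>z. f z $ j) \<in> borel_measurable M"
  by (rule measurable_compose[OF assms borel_measurable_continuous_onI]) (auto intro!: continuous_intros)

lemma AE_pair_snd:
  fixes P :: "'a::euclidean_space \<times> 'b::euclidean_space \<Rightarrow> bool"
  assumes "AE z in lborel. P z"
  shows "AE t in lborel. AE x in lborel. P (x, t)"
proof -
  from assms obtain N where N: "{z \<in> space lborel. \<not> P z} \<subseteq> N" "emeasure lborel N = 0" "N \<in> sets lborel"
    by (rule AE_E)
  have Nb [measurable]: "N \<in> sets (lborel \<Otimes>\<^sub>M lborel)" using N(3) by (simp only: lborel_prod)
  have "(\<integral>\<^sup>+t. (\<integral>\<^sup>+x. indicator N (x, t) \<partial>lborel) \<partial>lborel) = (\<integral>\<^sup>+z. indicator N z \<partial>(lborel \<Otimes>\<^sub>M lborel))"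
    by (rule lborel_pair.nn_integral_snd) (use Nb in simp)
  also have "\<dots> = 0" using N Nb by (simp add: lborel_prod)
  finally have "(\<integral>\<^sup>+t. (\<integral>\<^sup>+x. indicator N (x, t) \<partial>lborel) \<partial>lborel) = 0" .
  moreover have m: "(\<lambda>t. \<integral>\<^sup>+x. indicator N (x, t) \<partial>lborel) \<in> borel_measurable lborel"
    by measurable
  ultimately have "AE t in lborel. (\<integral>\<^sup>+x. indicator N (x, t) \<partial>lborel) = 0"
    by (simp add: nn_integral_0_iff_AE)
  moreover have "(\<integral>\<^sup>+x. indicator N (x, t) \<partial>lborel) = 0 \<longrightarrow> (AE x in lborel. P (x, t))" for t
  proof
    assume 0: "(\<integral>\<^sup>+x. indicator N (x, t) \<partial>lborel) = 0"
    have "(\<lambda>x. indicator N (x, t) :: ennreal) \<in> borel_measurable lborel"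
      by measurable
    with 0 have "AE x in lborel. (indicator N (x, t) :: ennreal) = 0"
      by (simp add: nn_integral_0_iff_AE)
    then show "AE x in lborel. P (x, t)"
      by (rule AE_mp) (use N(1) in \<open>auto simp: indicator_def\<close>)
  qed
  ultimately show ?thesis by (rule AE_mp[OF _ AE_I2])
qed

lemma integral_pair_snd:
  fixes f :: "'a::euclidean_space \<times> 'b::euclidean_space \<Rightarrow> real"
  assumes "integrable lborel f"
  shows "(\<integral>z. f z \<partial>lborel) = (\<integral>t. (\<integral>x. f (x, t) \<partial>lborel) \<partial>lborel)"
  using lborel_pair.integral_snd[of "\<lambda>x t. f (x, t)"] assms by (simp add: lborel_prod)

lemma integrable_pair_snd:
  fixes f :: "'a::euclidean_space \<times> 'b::euclidean_space \<Rightarrow> real"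
  assumes "integrable lborel f"
  shows "integrable lborel (\<lambda>t. \<integral>x. f (x, t) \<partial>lborel)"
  using lborel_pair.integrable_snd[of "\<lambda>x t. f (x, t)"] assms by (simp add: lborel_prod)

lemma test_fun_const_0: "test_fun S (\<lambda>z. 0)"
  by (simp add: test_fun_def compactly_inside_def C_k_const)

locale intrinsic_solution =
  fixes p q L \<gamma> :: real and N :: nat and \<nu> :: real and \<Omega> :: "(real^'n) set" and T :: real
    and A :: "(real^'n) \<times> real \<Rightarrow> (nat \<Rightarrow> real^'n) \<Rightarrow> (nat \<Rightarrow> real^'n)"
    and F :: "(real^'n) \<times> real \<Rightarrow> nat \<Rightarrow> real^'n" and u :: "(real^'n) \<times> real \<Rightarrow> nat \<Rightarrow> real"
    and Du :: "(real^'n) \<times> real \<Rightarrow> nat \<Rightarrow> real^'n" and lam \<rho> :: real and x0 :: "real^'n" and t0 :: real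
  assumes p1: "1 < p" and q1: "1 \<le> q" and qp: "p - 1 \<le> q"
    and setting: "intrinsic_setting p q L \<gamma> N \<nu> \<Omega> T A F u Du lam \<rho> x0 t0"
begin

abbreviation "Q \<equiv> cylinder p lam \<rho> x0 t0"
abbreviation "S \<equiv> \<Omega> \<times> {0<..<T}"
definition "\<sigma> = lam powr (2 - p) * \<rho>\<^sup>2"
text \<open>
  The equation says that \<open>\<partial>\<^sub>t u\<close> is the divergence of \<open>Gf\<close>; its size is controlled by \<open>hf\<close>.
\<close>

definition "Gf z i = A z (Du z) i - vnorm N (F z) powr (p - 2) *\<^sub>R F z i"
definition "hf z = vnorm N (Du z) + vnorm N (F z)"

lemma basic: "0 < \<rho>" "1 \<le> lam" "0 < lam" "0 < \<sigma>" "0 < L" "1 < \<gamma>" "0 < q"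
  using setting q1 by (auto simp: intrinsic_setting_def \<sigma>_def)

lemma Q_eq: "Q = ball x0 \<rho> \<times> {t0 - \<sigma><..<t0 + \<sigma>}"
  by (simp add: cylinder_def \<sigma>_def)

lemma closure_Q: "closure Q = cball x0 \<rho> \<times> {t0 - \<sigma>..t0 + \<sigma>}"
  unfolding Q_eq closure_Times using basic by simp

lemma closure_Q_sub: "cball x0 \<rho> \<subseteq> \<Omega>" "{t0 - \<sigma>..t0 + \<sigma>} \<subseteq> {0<..<T}" "closure Q \<subseteq> S" "compact (closure Q)"
proof -
  have c: "compact (closure Q)" "closure Q \<subseteq> S"
    using setting by (auto simp: intrinsic_setting_def compactly_inside_def)
  have ne: "x0 \<in> cball x0 \<rho>" "t0 \<in> {t0 - \<sigma>..t0 + \<sigma>}" using basic by auto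
  show "cball x0 \<rho> \<subseteq> \<Omega>"
  proof
    fix x assume "x \<in> cball x0 \<rho>"
    then have "(x, t0) \<in> S" using c(2) ne unfolding closure_Q by blast
    then show "x \<in> \<Omega>" by simp
  qed
  show "{t0 - \<sigma>..t0 + \<sigma>} \<subseteq> {0<..<T}"
  proof
    fix t assume "t \<in> {t0 - \<sigma>..t0 + \<sigma>}"
    then have "(x0, t) \<in> S" using c(2) ne unfolding closure_Q by blast
    then show "t \<in> {0<..<T}" by simp
  qed
  show "closure Q \<subseteq> S" "compact (closure Q)" by (rule c)+
qed

lemma Q_sub: "Q \<subseteq> S" using closure_Q_sub(3) closure_subset by blast

lemma open_Q: "open Q" unfolding Q_eq by (intro open_Times) auto

lemma Q_borel: "Q \<in> sets borel" by (rule borel_open[OF open_Q])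
lemma Q_sets: "Q \<in> sets lebesgue" using Q_borel by simp

lemma open_S: "open S" using setting by (auto simp: intrinsic_setting_def intro: open_Times)
lemma S_sets: "S \<in> sets lebesgue" using borel_open[OF open_S] by simp

lemma Q_lmeasurable: "Q \<in> lmeasurable"
  using bounded_subset[OF compact_imp_bounded[OF closure_Q_sub(4)] closure_subset] Q_sets
  by (rule bounded_set_imp_lmeasurable)

lemma finite_Q: "finite_measure (lebesgue_on Q)"
  by (rule finite_measure_lebesgue_on[OF Q_lmeasurable])

lemma measurable_S_Q: "f \<in> borel_measurable (lebesgue_on S) \<Longrightarrow> f \<in> borel_measurable (lebesgue_on Q)"
  using Q_sub by (rule measurable_restrict_mono[rotated])

lemma AE_S_Q: "AE z in lebesgue_on S. P z \<Longrightarrow> AE z in lebesgue_on Q. P z"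
proof -
  assume "AE z in lebesgue_on S. P z"
  then have "AE z in lebesgue. z \<in> S \<longrightarrow> P z" using S_sets by (simp add: AE_restrict_space_iff)
  then have "AE z in lebesgue. z \<in> Q \<longrightarrow> P z" by (rule AE_mp) (use Q_sub in auto)
  then show ?thesis using Q_sets by (simp add: AE_restrict_space_iff)
qed

lemma vecs_Du: "z \<in> S \<Longrightarrow> Du z \<in> vecs N"
  and vmeas: "vmeasurable N S u" "vmeasurable N S Du" "vmeasurable N S F"
  using setting by (auto simp: intrinsic_setting_def parabolic_sobolev_loc_def)

lemma admissible: "admissible_field p \<nu> L N S A"
  using setting by (simp add: intrinsic_setting_def)

lemma meas_u: "i < N \<Longrightarrow> (\<lambda>z. u z i) \<in> borel_measurable (lebesgue_on Q)"
  and meas_Du: "i < N \<Longrightarrow> (\<lambda>z. Du z i) \<in> borel_measurable (lebesgue_on Q)"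
  and meas_F: "i < N \<Longrightarrow> (\<lambda>z. F z i) \<in> borel_measurable (lebesgue_on Q)"
  and meas_A: "i < N \<Longrightarrow> (\<lambda>z. A z (Du z) i) \<in> borel_measurable (lebesgue_on Q)"
  using vmeas caratheodory_measurable[OF admissible S_sets vmeas(2) vecs_Du]
  by (auto simp: vmeasurable_def intro: measurable_S_Q)

lemma meas_vnorm: "(\<lambda>z. vnorm N (u z)) \<in> borel_measurable (lebesgue_on Q)"
  "(\<lambda>z. vnorm N (Du z)) \<in> borel_measurable (lebesgue_on Q)"
  "(\<lambda>z. vnorm N (F z)) \<in> borel_measurable (lebesgue_on Q)"
  by (intro measurable_vnorm meas_u meas_Du meas_F; assumption)+

lemma meas_hf: "hf \<in> borel_measurable (lebesgue_on Q)"
  unfolding hf_def[abs_def] using meas_vnorm by simp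

lemma meas_FF: "i < N \<Longrightarrow> (\<lambda>z. vnorm N (F z) powr (p - 2) *\<^sub>R F z i) \<in> borel_measurable (lebesgue_on Q)"
  using meas_F meas_vnorm(3) by (intro borel_measurable_scaleR powr_real_measurable) auto

lemma meas_Gf: "i < N \<Longrightarrow> (\<lambda>z. Gf z i) \<in> borel_measurable (lebesgue_on Q)"
  unfolding Gf_def by (intro borel_measurable_diff meas_A meas_FF)

lemma hf_nonneg: "0 \<le> hf z" by (simp add: hf_def)

lemma ball_inside: "compactly_inside (ball x0 \<rho>) \<Omega>"
  using closure_Q_sub(1) basic by (simp add: compactly_inside_def)

lemma sobolev:
  "AE t in lebesgue_on {t0 - \<sigma><..<t0 + \<sigma>}. sobolev_W1 q N (ball x0 \<rho>) (\<lambda>x. u (x, t)) (\<lambda>x. Du (x, t))"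
  "integrable (lebesgue_on Q) (\<lambda>z. vnorm N (u z) powr q + vnorm N (Du z) powr q)"
proof -
  have "0 < t0 - \<sigma>" "t0 - \<sigma> < t0 + \<sigma>" "t0 + \<sigma> < T"
    using closure_Q_sub(2) basic by (auto simp: subset_iff)
  then have *: "open (ball x0 \<rho>) \<and> compactly_inside (ball x0 \<rho>) \<Omega> \<and> 0 < t0 - \<sigma> \<and> t0 - \<sigma> < t0 + \<sigma> \<and> t0 + \<sigma> < T"
    using ball_inside by auto
  have "parabolic_sobolev_loc q N \<Omega> T u Du" using setting by (simp add: intrinsic_setting_def)
  then have "\<forall>\<Omega>' t1 t2. open \<Omega>' \<and> compactly_inside \<Omega>' \<Omega> \<and> 0 < t1 \<and> t1 < t2 \<and> t2 < T \<longrightarrow>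
        (AE t in lebesgue_on {t1<..<t2}. sobolev_W1 q N \<Omega>' (\<lambda>x. u (x, t)) (\<lambda>x. Du (x, t))) \<and>
        integrable (lebesgue_on (\<Omega>' \<times> {t1<..<t2}))
          (\<lambda>z. vnorm N (u z) powr q + vnorm N (Du z) powr q)"
    unfolding parabolic_sobolev_loc_def by blast
  from this[rule_format, OF *]
  show "AE t in lebesgue_on {t0 - \<sigma><..<t0 + \<sigma>}. sobolev_W1 q N (ball x0 \<rho>) (\<lambda>x. u (x, t)) (\<lambda>x. Du (x, t))"
    "integrable (lebesgue_on Q) (\<lambda>z. vnorm N (u z) powr q + vnorm N (Du z) powr q)"
    unfolding Q_eq by auto
qed

lemma int_u_q: "integrable (lebesgue_on Q) (\<lambda>z. vnorm N (u z) powr q)"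
  and int_Du_q: "integrable (lebesgue_on Q) (\<lambda>z. vnorm N (Du z) powr q)"
  using meas_vnorm by (auto intro!: Bochner_Integration.integrable_bound[OF sobolev(2)] powr_real_measurable)

lemma int_F_q: "integrable (lebesgue_on Q) (\<lambda>z. vnorm N (F z) powr q)"
proof -
  have "Lq_loc q N S F" using setting by (simp add: intrinsic_setting_def)
  then have *: "integrable (lebesgue_on (closure Q)) (\<lambda>z. vnorm N (F z) powr q)"
    using closure_Q_sub(3,4) by (auto simp: Lq_loc_def Lq_on_def)
  have cl: "closure Q \<in> sets lebesgue" by (simp add: borel_closed)
  have "integrable lebesgue (\<lambda>z. indicator (closure Q) z *\<^sub>R vnorm N (F z) powr q)"
    using * cl by (simp add: integrable_restrict_space)
  from integrable_mult_indicator[OF Q_sets this]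
  have "integrable lebesgue (\<lambda>z. indicator Q z *\<^sub>R (indicator (closure Q) z *\<^sub>R vnorm N (F z) powr q))" .
  also have "(\<lambda>z. indicator Q z *\<^sub>R (indicator (closure Q) z *\<^sub>R vnorm N (F z) powr q)) = (\<lambda>z. indicator Q z *\<^sub>R vnorm N (F z) powr q)"
    using closure_subset[of Q] by (auto simp: indicator_def fun_eq_iff)
  finally show ?thesis using Q_sets by (simp add: integrable_restrict_space)
qed

lemma int_hf_q: "integrable (lebesgue_on Q) (\<lambda>z. hf z powr q)"
proof (rule Bochner_Integration.integrable_bound)
  show "integrable (lebesgue_on Q) (\<lambda>z. 2 powr q * (vnorm N (Du z) powr q + vnorm N (F z) powr q))"
    by (intro integrable_mult_right Bochner_Integration.integrable_add int_Du_q int_F_q)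
  show "(\<lambda>z. hf z powr q) \<in> borel_measurable (lebesgue_on Q)" using meas_hf by (intro powr_real_measurable) auto
  show "AE z in lebesgue_on Q. norm (hf z powr q) \<le> norm (2 powr q * (vnorm N (Du z) powr q + vnorm N (F z) powr q))"
  proof (rule AE_I2)
    fix z
    define a b where "a = vnorm N (Du z)" and "b = vnorm N (F z)"
    have ab: "0 \<le> a" "0 \<le> b" by (auto simp: a_def b_def)
    have "(a + b) powr q \<le> (2 * max a b) powr q" using ab basic by (intro powr_mono2) auto
    also have "\<dots> = 2 powr q * max a b powr q" using ab by (simp add: powr_mult)
    also have "\<dots> \<le> 2 powr q * (a powr q + b powr q)" by (intro mult_left_mono) (auto simp: max_def)
    finally show "norm (hf z powr q) \<le> norm (2 powr q * (vnorm N (Du z) powr q + vnorm N (F z) powr q))"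
      by (simp add: hf_def a_def b_def)
  qed
qed

lemma FF_le: "vnorm N (\<lambda>i. vnorm N (F z) powr (p - 2) *\<^sub>R F z i) \<le> hf z powr (p - 1)"
proof -
  have "vnorm N (\<lambda>i. vnorm N (F z) powr (p - 2) *\<^sub>R F z i) = vnorm N (F z) powr (p - 2) * vnorm N (F z)"
    by (simp add: vnorm_scale)
  also have "\<dots> = vnorm N (F z) powr (p - 1)"
  proof (cases "vnorm N (F z) = 0")
    case False
    then have "0 < vnorm N (F z)" by (simp add: order.strict_iff_order)
    then have "vnorm N (F z) powr (p - 2) * vnorm N (F z) powr 1 = vnorm N (F z) powr (p - 1)"
      by (simp only: powr_add[symmetric]) simp
    then show ?thesis using \<open>0 < _\<close> by simp
  qed (use p1 in simp)
  also have "\<dots> \<le> hf z powr (p - 1)" using p1 by (intro powr_mono2) (auto simp: hf_def)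
  finally show ?thesis .
qed

lemma A_le: "AE z in lebesgue_on Q. vnorm N (A z (Du z)) \<le> L * hf z powr (p - 1)"
proof -
  have "AE z in lebesgue_on S. \<forall>\<xi>\<in>vecs N. \<nu> * vnorm N \<xi> powr p \<le> vinner N (A z \<xi>) \<xi> \<and> vnorm N (A z \<xi>) \<le> L * vnorm N \<xi> powr (p - 1)"
    using admissible by (simp add: admissible_field_def)
  from AE_S_Q[OF this] show ?thesis
  proof (rule AE_mp, intro AE_I2 impI)
    fix z assume z: "z \<in> space (lebesgue_on Q)"
      and *: "\<forall>\<xi>\<in>vecs N. \<nu> * vnorm N \<xi> powr p \<le> vinner N (A z \<xi>) \<xi> \<and> vnorm N (A z \<xi>) \<le> L * vnorm N \<xi> powr (p - 1)"
    have "Du z \<in> vecs N" using z Q_sub by (intro vecs_Du) auto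
    then have "vnorm N (A z (Du z)) \<le> L * vnorm N (Du z) powr (p - 1)" using * by blast
    also have "\<dots> \<le> L * hf z powr (p - 1)"
      using basic p1 by (intro mult_left_mono powr_mono2) (auto simp: hf_def)
    finally show "vnorm N (A z (Du z)) \<le> L * hf z powr (p - 1)" .
  qed
qed

lemma Gf_le: "AE z in lebesgue_on Q. vnorm N (Gf z) \<le> (L + 1) * hf z powr (p - 1)"
  using A_le
proof (rule AE_mp, intro AE_I2 impI)
  fix z assume *: "vnorm N (A z (Du z)) \<le> L * hf z powr (p - 1)"
  have "vnorm N (Gf z) \<le> vnorm N (A z (Du z)) + vnorm N (\<lambda>i. - (vnorm N (F z) powr (p - 2) *\<^sub>R F z i))"
    using vnorm_triangle[of N "A z (Du z)" "\<lambda>i. - (vnorm N (F z) powr (p - 2) *\<^sub>R F z i)"] by (simp add: Gf_def[abs_def])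
  also have "vnorm N (\<lambda>i. - (vnorm N (F z) powr (p - 2) *\<^sub>R F z i)) = vnorm N (\<lambda>i. vnorm N (F z) powr (p - 2) *\<^sub>R F z i)"
    by (rule vnorm_cong) simp
  finally show "vnorm N (Gf z) \<le> (L + 1) * hf z powr (p - 1)"
    using * FF_le[of z] by (simp add: distrib_right)
qed

lemma component_le_vnorm: "i < N \<Longrightarrow> \<bar>w i $ j\<bar> \<le> vnorm N w" for w :: "nat \<Rightarrow> real^'n"
  using component_le_norm_cart[of "w i" j] norm_le_vnorm[of i N w] by linarith

lemma int_u:
  assumes "i < N"
  shows "integrable (lebesgue_on Q) (\<lambda>z. u z i)"
proof (rule integrable_powr_bound[OF finite_Q meas_u[OF assms] _ q1 int_u_q, where c=1])
  show "AE z in lebesgue_on Q. \<bar>u z i\<bar> \<le> 1 * vnorm N (u z) powr 1"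
    using norm_le_vnorm[OF assms, of "u _"] by (intro AE_I2) simp
qed auto

lemma int_Du:
  assumes "i < N"
  shows "integrable (lebesgue_on Q) (\<lambda>z. Du z i $ j)"
proof (rule integrable_powr_bound[OF finite_Q measurable_component[OF meas_Du[OF assms]] _ q1 int_Du_q, where c=1])
  show "AE z in lebesgue_on Q. \<bar>Du z i $ j\<bar> \<le> 1 * vnorm N (Du z) powr 1"
    using component_le_vnorm[OF assms] by (intro AE_I2) simp
qed auto

lemma int_A:
  assumes "i < N"
  shows "integrable (lebesgue_on Q) (\<lambda>z. A z (Du z) i $ j)"
proof (rule integrable_powr_bound[OF finite_Q measurable_component[OF meas_A[OF assms]] _ qp int_hf_q _ hf_nonneg, where c=L])
  show "AE z in lebesgue_on Q. \<bar>A z (Du z) i $ j\<bar> \<le> L * hf z powr (p - 1)"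
    using A_le by (rule AE_mp) (intro AE_I2 impI order_trans[OF component_le_vnorm[OF assms]])
qed (use p1 basic in auto)

lemma int_FF:
  assumes "i < N"
  shows "integrable (lebesgue_on Q) (\<lambda>z. (vnorm N (F z) powr (p - 2) *\<^sub>R F z i) $ j)"
proof (rule integrable_powr_bound[OF finite_Q measurable_component[OF meas_FF[OF assms]] _ qp int_hf_q _ hf_nonneg, where c=1])
  show "AE z in lebesgue_on Q. \<bar>(vnorm N (F z) powr (p - 2) *\<^sub>R F z i) $ j\<bar> \<le> 1 * hf z powr (p - 1)"
  proof (rule AE_I2)
    fix z
    show "\<bar>(vnorm N (F z) powr (p - 2) *\<^sub>R F z i) $ j\<bar> \<le> 1 * hf z powr (p - 1)"
      using order_trans[OF component_le_vnorm[OF assms, of "\<lambda>i. vnorm N (F z) powr (p - 2) *\<^sub>R F z i" j] FF_le[of z]] by simp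
  qed
qed (use p1 in auto)

lemma int_Gf: "i < N \<Longrightarrow> integrable (lebesgue_on Q) (\<lambda>z. Gf z i $ j)"
  unfolding Gf_def vector_minus_component by (intro Bochner_Integration.integrable_diff int_A int_FF)

lemma int_mult_test:
  assumes f: "integrable (lebesgue_on Q) f" and \<phi>: "test_fun R \<phi>"
  shows "integrable (lebesgue_on Q) (\<lambda>z. f z * \<phi> z)"
proof -
  obtain c where "\<forall>z. \<bar>\<phi> z\<bar> \<le> c" using test_fun_bounded[OF \<phi>] ..
  note c = spec[OF this]
  have "\<phi> \<in> borel_measurable borel" by (rule borel_measurable_continuous_onI[OF test_fun_continuous[OF \<phi>]])
  then have m: "\<phi> \<in> borel_measurable (lebesgue_on Q)"
    by (intro measurable_restrict_space1 measurable_completion) simp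
  show ?thesis
  proof (rule Bochner_Integration.integrable_bound[of _ "\<lambda>z. c * f z"])
    show "AE z in lebesgue_on Q. norm (f z * \<phi> z) \<le> norm (c * f z)"
    proof (rule AE_I2)
      fix z
      have "\<bar>\<phi> z\<bar> * \<bar>f z\<bar> \<le> \<bar>c\<bar> * \<bar>f z\<bar>" using c[of z] by (intro mult_right_mono) auto
      then show "norm (f z * \<phi> z) \<le> norm (c * f z)" by (simp add: abs_mult mult.commute)
    qed
  qed (use f m in auto)
qed

lemma LINT_S_Q:
  fixes f :: "(real^'n) \<times> real \<Rightarrow> real"
  assumes "\<And>z. z \<notin> Q \<Longrightarrow> f z = 0"
  shows "(LINT z|lebesgue_on S. f z) = (LINT z|lebesgue_on Q. f z)"
proof -
  have "(LINT z|lebesgue_on S. f z) = (LINT z|lebesgue_on S. (if z \<in> Q then f z else 0))"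
    using assms by (intro Bochner_Integration.integral_cong) auto
  also have "\<dots> = (LINT z|lebesgue_on Q. f z)"
    by (rule integral_restrict[OF Q_sub Q_sets S_sets])
  finally show ?thesis .
qed

text \<open>
  The system is tested with a vector field that has a single nonzero component.
\<close>

lemma weak_time:
  assumes \<phi>: "test_fun Q \<phi>" and i: "i < N"
  shows "(LINT z|lebesgue_on Q. u z i * frechet_derivative \<phi> (at z) (0, 1)) =
    (LINT z|lebesgue_on Q. (\<Sum>j\<in>UNIV. (Gf z i $ j) * frechet_derivative \<phi> (at z) (axis j 1, 0)))"
proof -
  define \<Phi> where "\<Phi> z i' = (if i' = i then \<phi> z else 0)" for z i'
  let ?d = "\<lambda>j z. frechet_derivative \<phi> (at z) (axis j 1, 0)" and ?t = "\<lambda>z. frechet_derivative \<phi> (at z) (0, 1)"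
  have dz: "frechet_derivative \<phi> (at z) v = 0" if "z \<notin> Q" for z v
    by (rule test_fun_zero[OF test_fun_deriv[OF \<phi>] that])
  have "\<Phi> z \<in> vecs N" for z using i by (auto simp: vecs_def \<Phi>_def)
  moreover have "test_fun S (\<lambda>z. \<Phi> z i')" for i'
    using test_fun_mono[OF \<phi> Q_sub] test_fun_const_0 by (cases "i' = i") (auto simp: \<Phi>_def)
  moreover have "weak_solution p N S A F u Du" using setting by (simp add: intrinsic_setting_def)
  ultimately have eq: "(LINT z|lebesgue_on S. - vinner N (u z) (time_deriv \<Phi> z) + vinner N (A z (Du z)) (space_grad \<Phi> z)) =
        (LINT z|lebesgue_on S. vinner N (\<lambda>i. vnorm N (F z) powr (p - 2) *\<^sub>R F z i) (space_grad \<Phi> z))"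
    unfolding weak_solution_def by blast
  have t: "time_deriv \<Phi> z = (\<lambda>i'. if i' = i then ?t z else 0)" for z
    by (auto simp: time_deriv_def \<Phi>_def fun_eq_iff)
  have s: "space_grad \<Phi> z = (\<lambda>i'. if i' = i then (\<chi> j. ?d j z) else 0)" for z
    by (auto simp: space_grad_def \<Phi>_def fun_eq_iff vec_eq_iff)
  have vt: "vinner N (w :: nat \<Rightarrow> real) (time_deriv \<Phi> z) = w i * ?t z" for w z
    unfolding vinner_def t using i by (simp add: if_distrib cong: if_cong)
  have vs: "vinner N w (space_grad \<Phi> z) = (\<Sum>j\<in>UNIV. (w i $ j) * ?d j z)" for w z
    unfolding vinner_def s using i by (simp add: if_distrib inner_vec_def cong: if_cong)
  have "(LINT z|lebesgue_on Q. - (u z i * ?t z) + (\<Sum>j\<in>UNIV. (A z (Du z) i $ j) * ?d j z)) =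
      (LINT z|lebesgue_on Q. (\<Sum>j\<in>UNIV. ((vnorm N (F z) powr (p - 2) *\<^sub>R F z i) $ j) * ?d j z))"
    using eq unfolding vt vs by (subst (1 2) LINT_S_Q[symmetric]) (auto simp: dz)
  moreover have 1: "integrable (lebesgue_on Q) (\<lambda>z. u z i * ?t z)"
    by (rule int_mult_test[OF int_u[OF i] test_fun_deriv[OF \<phi>]])
  moreover have 2: "integrable (lebesgue_on Q) (\<lambda>z. \<Sum>j\<in>UNIV. (A z (Du z) i $ j) * ?d j z)"
    by (intro Bochner_Integration.integrable_sum int_mult_test[OF int_A[OF i] test_fun_deriv[OF \<phi>]])
  moreover have 3: "integrable (lebesgue_on Q) (\<lambda>z. \<Sum>j\<in>UNIV. ((vnorm N (F z) powr (p - 2) *\<^sub>R F z i) $ j) * ?d j z)"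
    by (intro Bochner_Integration.integrable_sum int_mult_test[OF int_FF[OF i] test_fun_deriv[OF \<phi>]])
  moreover note Bochner_Integration.integral_add[OF integrable_minus[OF 1] 2] Bochner_Integration.integral_diff[OF 2 3]
    integral_minus[of "lebesgue_on Q" "\<lambda>z. u z i * ?t z"]
  ultimately have "(LINT z|lebesgue_on Q. u z i * ?t z) =
      (LINT z|lebesgue_on Q. (\<Sum>j\<in>UNIV. (A z (Du z) i $ j) * ?d j z) -
        (\<Sum>j\<in>UNIV. ((vnorm N (F z) powr (p - 2) *\<^sub>R F z i) $ j) * ?d j z))"
    by linarith
  also have "(\<lambda>z. (\<Sum>j\<in>UNIV. (A z (Du z) i $ j) * ?d j z) - (\<Sum>j\<in>UNIV. ((vnorm N (F z) powr (p - 2) *\<^sub>R F z i) $ j) * ?d j z))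
      = (\<lambda>z. \<Sum>j\<in>UNIV. (Gf z i $ j) * ?d j z)"
    unfolding Gf_def vector_minus_component left_diff_distrib sum_subtractf ..
  finally show ?thesis .
qed

text \<open>
  The weak gradient is given on almost every time slice. A test function on the cylinder restricts to test functions
  on the slices, and Fubini's theorem adds up the identities.
\<close>

lemma weak_space:
  assumes \<phi>: "test_fun Q \<phi>" and i: "i < N"
  shows "(LINT z|lebesgue_on Q. u z i * frechet_derivative \<phi> (at z) (axis j 1, 0)) =
    - (LINT z|lebesgue_on Q. (Du z i $ j) * \<phi> z)"
proof -
  let ?B = "ball x0 \<rho>" and ?I = "{t0 - \<sigma><..<t0 + \<sigma>}"
  define \<psi> where "\<psi> z = frechet_derivative \<phi> (at z) (axis j 1, 0)" for z
  have \<psi>: "test_fun Q \<psi>" unfolding \<psi>_def[abs_def] by (rule test_fun_deriv[OF \<phi>])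
  obtain c\<phi> where c\<phi>: "\<forall>z. \<bar>\<phi> z\<bar> \<le> c\<phi>" using test_fun_bounded[OF \<phi>] ..
  obtain c\<psi> where c\<psi>: "\<forall>z. \<bar>\<psi> z\<bar> \<le> c\<psi>" using test_fun_bounded[OF \<psi>] ..
  note c = spec[OF c\<phi>] spec[OF c\<psi>]
  obtain u' where u': "u' \<in> borel_measurable borel" "AE z in lborel. u' z = (if z \<in> Q then u z i else 0)"
    by (rule borel_representative[OF meas_u[OF i] Q_sets])
  have md: "(\<lambda>z. Du z i $ j) \<in> borel_measurable (lebesgue_on Q)"
    by (rule measurable_component[OF meas_Du[OF i]])
  obtain d' where d': "d' \<in> borel_measurable borel" "AE z in lborel. d' z = (if z \<in> Q then Du z i $ j else 0)"
    by (rule borel_representative[OF md Q_sets])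
  have iu: "integrable lborel (\<lambda>z. u' z * \<psi> z)"
    using representative_integral(1)[OF meas_u[OF i] Q_sets u'] int_u[OF i]
    by (intro bounded_mult_integrable[OF _ test_fun_continuous[OF \<psi>] c(2)]) simp
  have id: "integrable lborel (\<lambda>z. d' z * \<phi> z)"
    using representative_integral(1)[OF md Q_sets d'] int_Du[OF i]
    by (intro bounded_mult_integrable[OF _ test_fun_continuous[OF \<phi>] c(1)]) simp
  have Bs: "?B \<in> sets lebesgue" by simp
  have finB: "finite_measure (lebesgue_on ?B)"
    by (rule finite_measure_lebesgue_on) (simp add: bounded_set_imp_lmeasurable)
  have slice: "(\<integral>x. u' (x, t) * \<psi> (x, t) \<partial>lborel) = - (\<integral>x. d' (x, t) * \<phi> (x, t) \<partial>lborel)"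
    if sob: "t \<in> ?I \<longrightarrow> sobolev_W1 q N ?B (\<lambda>x. u (x, t)) (\<lambda>x. Du (x, t))"
      and au: "AE x in lborel. u' (x, t) = (if (x, t) \<in> Q then u (x, t) i else 0)"
      and ad: "AE x in lborel. d' (x, t) = (if (x, t) \<in> Q then Du (x, t) i $ j else 0)" for t
  proof (cases "t \<in> ?I")
    case False
    then have "\<phi> (x, t) = 0" "\<psi> (x, t) = 0" for x
      using test_fun_zero[OF \<phi>] test_fun_zero[OF \<psi>] by (auto simp: Q_eq)
    then show ?thesis by simp
  next
    case True
    define \<eta> where "\<eta> x = \<phi> (x, t)" for x
    define w g where "w x = u (x, t) i" and "g x = Du (x, t) i" for x
    have sob: "sobolev_W1 q N ?B (\<lambda>x. u (x, t)) (\<lambda>x. Du (x, t))" using sob True by blast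
    have l: "bounded_linear (\<lambda>x::real^'n. (x, 0::real))" by (rule bounded_linear_Pair[OF bounded_linear_ident bounded_linear_zero])
    have comp: "compact {x. (0, t) + (x, 0) \<in> K}" if "compact K" for K :: "((real^'n) \<times> real) set"
    proof -
      have "{x. (0, t) + (x, 0) \<in> K} = fst ` (K \<inter> UNIV \<times> {t})"
        by force
      moreover have "compact (K \<inter> UNIV \<times> {t})"
        using that by (intro compact_Int_closed closed_Times) auto
      ultimately show ?thesis by (auto intro!: compact_continuous_image continuous_intros)
    qed
    have S': "x \<in> ?B" if "(0, t) + (x, 0) \<in> Q" for x using that by (simp add: Q_eq)
    have \<eta>: "test_fun ?B \<eta>"
      using test_fun_affine(1)[OF \<phi> l S' comp] by (simp add: \<eta>_def[abs_def])
    have grad: "frechet_derivative \<eta> (at x) v = frechet_derivative \<phi> (at (x, t)) (v, 0)" for x v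
      using test_fun_affine(2)[OF \<phi> l S' comp, of x v] by (simp add: \<eta>_def[abs_def])
    have gradj: "grad \<eta> x $ j = \<psi> (x, t)" for x by (simp add: grad_def grad \<psi>_def)
    have wm: "w \<in> borel_measurable (lebesgue_on ?B)" and gm: "g \<in> borel_measurable (lebesgue_on ?B)"
      and wq: "integrable (lebesgue_on ?B) (\<lambda>x. vnorm N (u (x, t)) powr q)"
      and gq: "integrable (lebesgue_on ?B) (\<lambda>x. vnorm N (Du (x, t)) powr q)"
      using sob i by (auto simp: sobolev_W1_def Lq_on_def vmeasurable_def w_def[abs_def] g_def[abs_def])
    have wi: "integrable (lebesgue_on ?B) w"
      by (rule integrable_powr_bound[OF finB wm _ _ wq, where t=1 and c=1])
        (use q1 norm_le_vnorm[OF i, of "u (_, t)"] in \<open>auto simp: w_def\<close>)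
    have gi: "integrable (lebesgue_on ?B) (\<lambda>x. norm (g x))"
      by (rule integrable_powr_bound[OF finB measurable_compose[OF gm borel_measurable_norm] _ _ gq, where t=1 and c=1])
        (use q1 norm_le_vnorm[OF i, of "Du (_, t)"] in \<open>auto simp: g_def\<close>)
    have gi': "integrable (lebesgue_on ?B) g" using gi gm by (simp add: integrable_norm_iff)
    have mB: "f \<in> borel_measurable (lebesgue_on ?B)" if "continuous_on UNIV f" for f :: "real^'n \<Rightarrow> real"
      using borel_measurable_continuous_onI[OF that] by (intro measurable_restrict_space1 measurable_completion) simp
    have dk: "test_fun ?B (\<lambda>x. grad \<eta> x $ k)" for k
      using test_fun_deriv[OF \<eta>] by (simp add: grad_def)
    have mg: "grad \<eta> \<in> borel_measurable (lebesgue_on ?B)"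
    proof -
      have "continuous_on UNIV (\<lambda>x. \<chi> k. grad \<eta> x $ k)"
        by (intro continuous_on_vec_lambda test_fun_continuous[OF dk])
      then have "continuous_on UNIV (grad \<eta>)" by simp
      from borel_measurable_continuous_onI[OF this] show ?thesis
        by (intro measurable_restrict_space1 measurable_completion) simp
    qed
    have "\<exists>C. \<forall>k x. \<bar>grad \<eta> x $ k\<bar> \<le> C"
    proof -
      have "\<forall>k. \<exists>C. \<forall>x. \<bar>grad \<eta> x $ k\<bar> \<le> C"
        by (intro allI test_fun_bounded[OF dk])
      from choice[OF this] obtain C where C: "\<forall>k x. \<bar>grad \<eta> x $ k\<bar> \<le> C k" ..
      have "\<bar>grad \<eta> x $ k\<bar> \<le> (\<Sum>k\<in>UNIV. \<bar>C k\<bar>)" for k x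
      proof -
        have "\<bar>grad \<eta> x $ k\<bar> \<le> \<bar>C k\<bar>" using C[rule_format, of x k] by simp
        also have "\<dots> \<le> (\<Sum>k\<in>UNIV. \<bar>C k\<bar>)" by (rule member_le_sum) auto
        finally show ?thesis .
      qed
      then show ?thesis by blast
    qed
    then obtain C where C: "\<forall>k x. \<bar>grad \<eta> x $ k\<bar> \<le> C" ..
    have ng: "norm (grad \<eta> x) \<le> real CARD('n) * C" for x
    proof -
      have "norm (grad \<eta> x) \<le> (\<Sum>k\<in>UNIV. \<bar>grad \<eta> x $ k\<bar>)" by (rule norm_le_l1_cart)
      also have "\<dots> \<le> (\<Sum>k\<in>(UNIV::'n set). C)" using C by (intro sum_mono) simp
      finally show ?thesis by simp
    qed
    have i1: "integrable (lebesgue_on ?B) (\<lambda>x. w x *\<^sub>R grad \<eta> x)"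
    proof (rule Bochner_Integration.integrable_bound[of _ "\<lambda>x. (real CARD('n) * C) * w x"])
      show "AE x in lebesgue_on ?B. norm (w x *\<^sub>R grad \<eta> x) \<le> norm ((real CARD('n) * C) * w x)"
      proof (rule AE_I2)
        fix x
        have "norm (grad \<eta> x) * \<bar>w x\<bar> \<le> \<bar>real CARD('n) * C\<bar> * \<bar>w x\<bar>"
          using ng[of x] by (intro mult_right_mono) auto
        then show "norm (w x *\<^sub>R grad \<eta> x) \<le> norm ((real CARD('n) * C) * w x)" by (simp add: abs_mult mult.commute)
      qed
    qed (use wi wm mg in auto)
    have i2: "integrable (lebesgue_on ?B) (\<lambda>x. \<eta> x *\<^sub>R g x)"
    proof (rule Bochner_Integration.integrable_bound[of _ "\<lambda>x. c\<phi> * norm (g x)"])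
      show "AE x in lebesgue_on ?B. norm (\<eta> x *\<^sub>R g x) \<le> norm (c\<phi> * norm (g x))"
      proof (rule AE_I2)
        fix x
        have "\<bar>\<eta> x\<bar> * norm (g x) \<le> \<bar>c\<phi>\<bar> * norm (g x)"
          using c(1)[of "(x, t)"] by (intro mult_right_mono) (auto simp: \<eta>_def)
        then show "norm (\<eta> x *\<^sub>R g x) \<le> norm (c\<phi> * norm (g x))" by (simp add: abs_mult)
      qed
    qed (use gi gm mB[OF test_fun_continuous[OF \<eta>]] in auto)
    have "(LINT x|lebesgue_on ?B. w x *\<^sub>R grad \<eta> x) = - (LINT x|lebesgue_on ?B. \<eta> x *\<^sub>R g x)"
      using sob i \<eta> by (auto simp: sobolev_W1_def weak_gradient_def w_def[abs_def] g_def[abs_def])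
    then have "(LINT x|lebesgue_on ?B. w x *\<^sub>R grad \<eta> x) \<bullet> axis j 1 = - ((LINT x|lebesgue_on ?B. \<eta> x *\<^sub>R g x) \<bullet> axis j 1)"
      by simp
    then have main: "(LINT x|lebesgue_on ?B. w x * \<psi> (x, t)) = - (LINT x|lebesgue_on ?B. (g x $ j) * \<phi> (x, t))"
      unfolding integral_inner_left[OF i1, symmetric] integral_inner_left[OF i2, symmetric]
      by (simp add: inner_axis gradj \<eta>_def mult.commute)
    have cont: "continuous_on UNIV (\<lambda>x. \<psi> (x, t))" "continuous_on UNIV (\<lambda>x. \<phi> (x, t))"
      by (rule continuous_on_compose2[OF test_fun_continuous[of Q _ UNIV]]; use \<phi> \<psi> in \<open>auto intro!: continuous_intros\<close>)+
    have slm: "(\<lambda>x. f (x, t)) \<in> borel_measurable borel" if "f \<in> borel_measurable borel" for f :: "(real^'n) \<times> real \<Rightarrow> real"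
      by (rule measurable_compose[OF borel_measurable_continuous_onI that]) (auto intro!: continuous_intros)
    have au': "AE x in lborel. u' (x, t) = (if x \<in> ?B then w x else 0)"
      using au by (rule AE_mp) (use True in \<open>simp add: Q_eq w_def\<close>)
    have ad': "AE x in lborel. d' (x, t) = (if x \<in> ?B then g x $ j else 0)"
      using ad by (rule AE_mp) (use True in \<open>simp add: Q_eq g_def\<close>)
    have "(\<integral>x. u' (x, t) * \<psi> (x, t) \<partial>lborel) = (LINT x|lebesgue_on ?B. w x * \<psi> (x, t))"
      by (rule representative_integral_mult[OF wm Bs slm[OF u'(1)] au' cont(1)])
    moreover have "(\<integral>x. d' (x, t) * \<phi> (x, t) \<partial>lborel) = (LINT x|lebesgue_on ?B. (g x $ j) * \<phi> (x, t))"
      by (rule representative_integral_mult[OF measurable_component[OF gm] Bs slm[OF d'(1)] ad' cont(2)])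
    ultimately show ?thesis using main by simp
  qed
  have sob: "AE t in lborel. t \<in> ?I \<longrightarrow> sobolev_W1 q N ?B (\<lambda>x. u (x, t)) (\<lambda>x. Du (x, t))"
    using sobolev(1) by (simp add: AE_restrict_space_iff AE_completion_iff)
  have "AE t in lborel. (\<integral>x. u' (x, t) * \<psi> (x, t) \<partial>lborel) = - (\<integral>x. d' (x, t) * \<phi> (x, t) \<partial>lborel)"
    using sob AE_pair_snd[OF u'(2)] AE_pair_snd[OF d'(2)] by eventually_elim (rule slice)
  then have "(\<integral>t. (\<integral>x. u' (x, t) * \<psi> (x, t) \<partial>lborel) \<partial>lborel) = (\<integral>t. - (\<integral>x. d' (x, t) * \<phi> (x, t) \<partial>lborel) \<partial>lborel)"
  proof (rule integral_cong_AE[rotated 2])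
    have "integrable lborel (\<lambda>t. \<integral>x. u' (x, t) * \<psi> (x, t) \<partial>lborel)"
      by (rule integrable_pair_snd[OF iu])
    then show "(\<lambda>t. \<integral>x. u' (x, t) * \<psi> (x, t) \<partial>lborel) \<in> borel_measurable lborel" by (rule borel_measurable_integrable)
    have "integrable lborel (\<lambda>t. \<integral>x. d' (x, t) * \<phi> (x, t) \<partial>lborel)"
      by (rule integrable_pair_snd[OF id])
    then show "(\<lambda>t. - (\<integral>x. d' (x, t) * \<phi> (x, t) \<partial>lborel)) \<in> borel_measurable lborel"
      by (intro borel_measurable_uminus borel_measurable_integrable)
  qed
  then have "(\<integral>z. u' z * \<psi> z \<partial>lborel) = - (\<integral>z. d' z * \<phi> z \<partial>lborel)"
    using integral_pair_snd[OF iu] integral_pair_snd[OF id] by simp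
  then show ?thesis
    using representative_integral_mult[OF meas_u[OF i] Q_sets u' test_fun_continuous[OF \<psi>]]
      representative_integral_mult[OF md Q_sets d' test_fun_continuous[OF \<phi>]]
    by (simp add: \<psi>_def)
qed

end


section \<open>Rescaling to the unit cylinder\<close>

lemma integrable_vec:
  fixes f :: "'a \<Rightarrow> real^'n"
  assumes "\<And>j. integrable M (\<lambda>z. f z $ j)"
  shows "integrable M f"
proof -
  have "integrable M (\<lambda>z. \<Sum>j\<in>UNIV. (f z $ j) *\<^sub>R (axis j 1 :: real^'n))"
    by (intro Bochner_Integration.integrable_sum integrable_scaleR_left assms)
  also have "(\<lambda>z. \<Sum>j\<in>UNIV. (f z $ j) *\<^sub>R (axis j 1 :: real^'n)) = f"
    using basis_expansion[of "f _"] by (simp add: fun_eq_iff scalar_mult_eq_scaleR)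
  finally show ?thesis .
qed

lemma emeasure_unit_cyl: "emeasure lborel (unit_cyl :: ((real^'n) \<times> real) set) < \<infinity>"
  unfolding unit_cyl_def by (intro emeasure_bounded_finite bounded_Times) auto

text \<open>
  Every term is at most \<open>2 powr (k \<theta>)\<close>, so the last term of a geometric series dominates the sum.
\<close>

lemma geometric_sum_le:
  fixes \<theta> \<mu> :: real
  assumes "0 < \<theta>" "\<mu> \<le> \<theta>"
  shows "(\<Sum>k\<le>K. 2 powr (real k * \<mu>)) \<le> 1 / (1 - 2 powr (- \<theta>)) * 2 powr (real K * \<theta>)"
proof -
  have lt: "2 powr (- \<theta>) < 1" using assms by (simp add: powr_less_one)
  define c where "c = 1 / (1 - 2 powr (- \<theta>))"
  have "1 + 1 / (1 - x) * x = 1 / (1 - x)" if "x < 1" for x :: real using that by (simp add: field_simps)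
  from this[OF lt] have c: "1 + c * 2 powr (- \<theta>) = c" by (simp only: c_def)
  have "(\<Sum>k\<le>K. 2 powr (real k * \<theta>)) \<le> c * 2 powr (real K * \<theta>)"
  proof (induction K)
    case 0
    show ?case using lt by (simp add: c_def)
  next
    case (Suc K)
    have "real K * \<theta> = real (Suc K) * \<theta> + - \<theta>" by (simp add: algebra_simps)
    then have e: "2 powr (real K * \<theta>) = 2 powr (real (Suc K) * \<theta>) * 2 powr (- \<theta>)"
      by (simp only: powr_add)
    have "(\<Sum>k\<le>Suc K. 2 powr (real k * \<theta>)) \<le> c * 2 powr (real K * \<theta>) + 2 powr (real (Suc K) * \<theta>)"
      using Suc by simp
    also have "\<dots> = (1 + c * 2 powr (- \<theta>)) * 2 powr (real (Suc K) * \<theta>)"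
    proof -
      have "c * (x * y) + x = (1 + c * y) * x" for x y by (simp add: algebra_simps)
      then show ?thesis unfolding e .
    qed
    finally show ?case unfolding c .
  qed
  moreover have "(\<Sum>k\<le>K. 2 powr (real k * \<mu>)) \<le> (\<Sum>k\<le>K. 2 powr (real k * \<theta>))"
    using assms by (intro sum_mono powr_mono mult_left_mono) auto
  ultimately show ?thesis unfolding c_def by linarith
qed

context intrinsic_solution begin

text \<open>
  The affine map from the unit cylinder onto \<open>Q\<close>, its inverse and its Jacobian.
\<close>

definition sc :: "(real^'n) \<times> real \<Rightarrow> (real^'n) \<times> real" where "sc = aff x0 \<rho> t0 \<sigma>"
definition cs :: "(real^'n) \<times> real \<Rightarrow> (real^'n) \<times> real" where "cs = aff (- (1 / \<rho>) *\<^sub>R x0) (1 / \<rho>) (- t0 / \<sigma>) (1 / \<sigma>)"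
definition J :: real where "J = \<rho> ^ CARD('n) * \<sigma>"

lemma cs_sc: "cs (sc z) = z" and sc_cs: "sc (cs z) = z"
  unfolding sc_def cs_def by (rule aff_inverse[OF basic(1,4)])+

lemma J_pos: "0 < J" using basic by (simp add: J_def)

lemma sc_Q: "sc z \<in> Q \<longleftrightarrow> z \<in> unit_cyl"
proof -
  have "norm (\<rho> *\<^sub>R fst z) < \<rho> \<longleftrightarrow> norm (fst z) < 1" using basic by simp
  moreover have "t0 - \<sigma> < t0 + \<sigma> * snd z \<longleftrightarrow> \<sigma> * -1 < \<sigma> * snd z" "t0 + \<sigma> * snd z < t0 + \<sigma> \<longleftrightarrow> \<sigma> * snd z < \<sigma> * 1" by auto
  moreover have "\<sigma> * -1 < \<sigma> * snd z \<longleftrightarrow> -1 < snd z" "\<sigma> * snd z < \<sigma> * 1 \<longleftrightarrow> snd z < 1"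
    using basic(4) by (auto simp only: mult_less_cancel_left_pos)
  ultimately show ?thesis
    by (simp add: Q_eq sc_def aff_def unit_cyl_def dist_norm mem_Times_iff)
qed

lemma measurable_sc [measurable]: "sc \<in> borel_measurable borel" unfolding sc_def by (rule measurable_aff)

lemma AE_sc: "AE Z in lborel. P Z \<Longrightarrow> AE z in lborel. P (sc z)"
  unfolding sc_def by (rule AE_aff[OF basic(1,4)])

lemma AE_cs: "AE z in lborel. P z \<Longrightarrow> AE Z in lborel. P (cs Z)"
  unfolding cs_def by (rule AE_aff) (use basic in auto)

lemma integral_sc:
  fixes f :: "(real^'n) \<times> real \<Rightarrow> real"
  assumes "f \<in> borel_measurable borel"
  shows "integrable lborel f \<longleftrightarrow> integrable lborel (\<lambda>z. f (sc z))" "(\<integral>Z. f Z \<partial>lborel) = J * (\<integral>z. f (sc z) \<partial>lborel)"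
  using integral_aff[OF basic(1,4) assms, of x0 t0] by (auto simp: sc_def J_def)

lemma measure_Q: "measure lebesgue Q = J * measure lborel (unit_cyl :: ((real^'n) \<times> real) set)"
proof -
  have "measure lebesgue Q = (\<integral>Z. indicator Q Z \<partial>lborel)"
    using Q_borel by (simp add: measure_completion)
  also have "\<dots> = J * (\<integral>z. indicator Q (sc z) \<partial>lborel)"
    by (rule integral_sc(2)) (use Q_borel in simp)
  also have "(\<lambda>z. indicator Q (sc z)) = (indicator unit_cyl :: _ \<Rightarrow> real)"
    by (auto simp: indicator_def sc_Q)
  finally show ?thesis by simp
qed

lemma unit_measure_pos: "0 < measure lborel (unit_cyl :: ((real^'n) \<times> real) set)"
proof -
  have "unit_cyl \<noteq> ({} :: ((real^'n) \<times> real) set)" by (auto simp: unit_cyl_def intro!: exI[of _ 0])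
  then have "emeasure lborel (unit_cyl :: ((real^'n) \<times> real) set) \<noteq> 0"
    using open_unit_cyl open_not_negligible[of "unit_cyl :: ((real^'n) \<times> real) set"]
    by (auto simp: negligible_iff_emeasure0)
  then show ?thesis using emeasure_unit_cyl by (simp add: measure_def enn2real_positive_iff zero_less_iff_neq_zero)
qed

lemma measure_Q_pos: "0 < measure lebesgue Q"
  using measure_Q J_pos unit_measure_pos by simp

definition lin :: "(real^'n) \<times> real \<Rightarrow> (real^'n) \<times> real" where "lin v = ((1 / \<rho>) *\<^sub>R fst v, snd v / \<sigma>)"

lemma cs_lin: "cs Z = (- (1 / \<rho>) *\<^sub>R x0, - t0 / \<sigma>) + lin Z"
  by (simp add: cs_def aff_def lin_def)

lemma bounded_linear_lin: "bounded_linear lin"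
  unfolding lin_def[abs_def]
  by (intro bounded_linear_Pair bounded_linear_scaleR_right[THEN bounded_linear_compose] bounded_linear_fst
    bounded_linear_divide[THEN bounded_linear_compose] bounded_linear_snd)

lemma test_fun_cs:
  assumes "test_fun unit_cyl \<phi>"
  shows "test_fun Q (\<lambda>Z. \<phi> (cs Z))" "frechet_derivative (\<lambda>Z. \<phi> (cs Z)) (at Z) v = frechet_derivative \<phi> (at (cs Z)) (lin v)"
proof -
  have U: "Z \<in> Q" if "(- (1 / \<rho>) *\<^sub>R x0, - t0 / \<sigma>) + lin Z \<in> unit_cyl" for Z
    using sc_Q[of "cs Z"] that unfolding sc_cs cs_lin[symmetric] by simp
  have K: "compact {Z. (- (1 / \<rho>) *\<^sub>R x0, - t0 / \<sigma>) + lin Z \<in> K}" if "compact K" for K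
  proof -
    have "{Z. cs Z \<in> K} = sc ` K"
    proof (intro set_eqI iffI)
      fix Z assume "Z \<in> {Z. cs Z \<in> K}"
      then show "Z \<in> sc ` K" by (intro image_eqI[of _ _ "cs Z"]) (simp_all add: sc_cs)
    qed (auto simp: cs_sc)
    then show ?thesis
      unfolding cs_lin[symmetric] using compact_continuous_image[OF continuous_aff that] by (simp add: sc_def)
  qed
  from test_fun_affine[OF assms bounded_linear_lin U K]
  show "test_fun Q (\<lambda>Z. \<phi> (cs Z))" "frechet_derivative (\<lambda>Z. \<phi> (cs Z)) (at Z) v = frechet_derivative \<phi> (at (cs Z)) (lin v)"
    unfolding cs_lin by auto
qed

lemma test_fun_cs_deriv:
  assumes \<phi>: "test_fun unit_cyl \<phi>"
  shows "frechet_derivative (\<lambda>Z. \<phi> (cs Z)) (at Z) (axis j 1, 0) = (1 / \<rho>) * frechet_derivative \<phi> (at (cs Z)) (axis j 1, 0)"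
    "frechet_derivative (\<lambda>Z. \<phi> (cs Z)) (at Z) (0, 1) = (1 / \<sigma>) * frechet_derivative \<phi> (at (cs Z)) (0, 1)"
proof -
  have l: "linear (frechet_derivative \<phi> (at z))" for z
    by (rule bounded_linear.linear[OF has_derivative_bounded_linear[OF test_fun_has_derivative[OF \<phi>]]])
  have "lin (axis j 1, 0) = (1 / \<rho>) *\<^sub>R (axis j 1, 0)" "lin (0, 1) = (1 / \<sigma>) *\<^sub>R (0, 1)"
    by (auto simp: lin_def)
  then show "frechet_derivative (\<lambda>Z. \<phi> (cs Z)) (at Z) (axis j 1, 0) = (1 / \<rho>) * frechet_derivative \<phi> (at (cs Z)) (axis j 1, 0)"
    "frechet_derivative (\<lambda>Z. \<phi> (cs Z)) (at Z) (0, 1) = (1 / \<sigma>) * frechet_derivative \<phi> (at (cs Z)) (0, 1)"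
    by (simp_all only: test_fun_cs(2)[OF \<phi>] linear_scale[OF l] real_scaleR_def)
qed

lemma continuous_cs: "continuous_on R cs" unfolding cs_def by (rule continuous_aff)

text \<open>
  Borel representatives, extended by zero outside \<open>Q\<close>.
\<close>

definition rep :: "((real^'n) \<times> real \<Rightarrow> real) \<Rightarrow> ((real^'n) \<times> real \<Rightarrow> real) \<Rightarrow> bool" where
  "rep f f' \<longleftrightarrow> f' \<in> borel_measurable borel \<and> (AE z in lborel. f' z = (if z \<in> Q then f z else 0))"

lemma rep_ex: "f \<in> borel_measurable (lebesgue_on Q) \<Longrightarrow> \<exists>f'. rep f f'"
proof -
  assume "f \<in> borel_measurable (lebesgue_on Q)"
  then obtain f' where "f' \<in> borel_measurable borel" "AE z in lborel. f' z = (if z \<in> Q then f z else 0)"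
    by (rule borel_representative[OF _ Q_sets])
  then have "rep f f'" unfolding rep_def by (rule conjI)
  then show ?thesis by (rule exI[of _ f'])
qed

lemma rep_integrable:
  assumes "rep f f'" "integrable (lebesgue_on Q) f"
  shows "integrable lborel (\<lambda>z. f' (sc z))"
  using representative_integral(1)[OF borel_measurable_integrable[OF assms(2)] Q_sets, of f'] assms integral_sc(1)[of f']
  by (auto simp: rep_def)

lemma rep_integral:
  assumes f: "rep f f'" "integrable (lebesgue_on Q) f" and w: "continuous_on UNIV w"
  shows "(LINT z|lebesgue_on Q. f z * w (cs z)) = J * (\<integral>z. f' (sc z) * w z \<partial>lborel)"
proof -
  have c: "continuous_on UNIV (\<lambda>z. w (cs z))" by (rule continuous_on_compose2[OF w continuous_cs]) auto
  have "(LINT z|lebesgue_on Q. f z * w (cs z)) = (\<integral>z. f' z * w (cs z) \<partial>lborel)"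
    using f by (intro representative_integral_mult[OF _ Q_sets _ _ c, symmetric]) (auto simp: rep_def)
  also have "\<dots> = J * (\<integral>z. f' (sc z) * w (cs (sc z)) \<partial>lborel)"
    using f borel_measurable_continuous_onI[OF c] by (intro integral_sc(2)) (auto simp: rep_def)
  finally show ?thesis by (simp add: cs_sc)
qed

lemma sigma_eq: "\<sigma> / \<rho>\<^sup>2 = lam powr (2 - p)" using basic by (simp add: \<sigma>_def)

lemma average_hf: "0 \<le> average Q (\<lambda>z. hf z powr q)" "average Q (\<lambda>z. hf z powr q) \<le> lam powr q"
  "lam \<le> \<gamma> * data_mean q N Du F Q"
proof -
  show 0: "0 \<le> average Q (\<lambda>z. hf z powr q)"
    unfolding average_def by (intro divide_nonneg_nonneg integral_nonneg_AE) auto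
  have dm: "data_mean q N Du F Q = average Q (\<lambda>z. hf z powr q) powr (1 / q)"
    by (simp add: data_mean_def hf_def)
  have "data_mean q N Du F Q \<le> lam" "lam / \<gamma> \<le> data_mean q N Du F Q"
    using setting by (auto simp: intrinsic_setting_def)
  then show "lam \<le> \<gamma> * data_mean q N Du F Q" using basic by (simp add: field_simps)
  have "(average Q (\<lambda>z. hf z powr q) powr (1 / q)) powr q \<le> lam powr q"
    using \<open>data_mean q N Du F Q \<le> lam\<close> basic unfolding dm by (intro powr_mono2) auto
  then show "average Q (\<lambda>z. hf z powr q) \<le> lam powr q"
    using 0 basic by (simp add: powr_powr)
qed

text \<open>
  Dividing \<open>u\<close> by \<open>\<rho> * lam\<close>, its gradient by \<open>lam\<close> and the flux by \<open>lam powr (p - 1)\<close> gives a solution in normalised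
  form.
\<close>

lemma unit_transform:
  "\<exists>v g G h. unit_solution N v g G \<and> h \<in> borel_measurable borel \<and> (\<forall>z. 0 \<le> h z) \<and>
    integrable lborel (\<lambda>z. h z powr q) \<and> (\<integral>z. h z powr q \<partial>lborel) \<le> measure lborel (unit_cyl :: ((real^'n) \<times> real) set) \<and>
    (AE z in lborel. vnorm N (g z) \<le> h z) \<and> (AE z in lborel. vnorm N (G z) \<le> (L + 1) * h z powr (p - 1)) \<and>
    (AE z in lborel. z \<in> Q \<longrightarrow> (\<forall>i<N. v (cs z) i = u z i / (\<rho> * lam)))"
proof -
  have "\<forall>i. \<exists>f'. i < N \<longrightarrow> rep (\<lambda>z. u z i) f'"
  proof
    fix i show "\<exists>f'. i < N \<longrightarrow> rep (\<lambda>z. u z i) f'"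
      by (cases "i < N") (use rep_ex[OF meas_u[of i]] in simp_all)
  qed
  from choice[OF this] obtain U where U: "\<forall>i. i < N \<longrightarrow> rep (\<lambda>z. u z i) (U i)" ..
  have "\<forall>ij. \<exists>f'. fst ij < N \<longrightarrow> rep (\<lambda>z. Du z (fst ij) $ snd ij) f'"
  proof
    fix ij :: "nat \<times> 'n" show "\<exists>f'. fst ij < N \<longrightarrow> rep (\<lambda>z. Du z (fst ij) $ snd ij) f'"
      by (cases "fst ij < N") (use rep_ex[OF measurable_component[OF meas_Du[of "fst ij"]]] in simp_all)
  qed
  from choice[OF this] obtain Dg where Dg0: "\<forall>ij. fst ij < N \<longrightarrow> rep (\<lambda>z. Du z (fst ij) $ snd ij) (Dg ij)" ..
  have Dg: "rep (\<lambda>z. Du z i $ j) (Dg (i, j))" if "i < N" for i j using spec[OF Dg0, of "(i, j)"] that by simp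
  have "\<forall>ij. \<exists>f'. fst ij < N \<longrightarrow> rep (\<lambda>z. Gf z (fst ij) $ snd ij) f'"
  proof
    fix ij :: "nat \<times> 'n" show "\<exists>f'. fst ij < N \<longrightarrow> rep (\<lambda>z. Gf z (fst ij) $ snd ij) f'"
      by (cases "fst ij < N") (use rep_ex[OF measurable_component[OF meas_Gf[of "fst ij"]]] in simp_all)
  qed
  from choice[OF this] obtain GG where GG0: "\<forall>ij. fst ij < N \<longrightarrow> rep (\<lambda>z. Gf z (fst ij) $ snd ij) (GG ij)" ..
  have GG: "rep (\<lambda>z. Gf z i $ j) (GG (i, j))" if "i < N" for i j using spec[OF GG0, of "(i, j)"] that by simp
  obtain h' where h': "rep hf h'" using rep_ex[OF meas_hf] ..
  define v where "v z i = U i (sc z) / (\<rho> * lam)" for z i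
  define g where "g z i = (\<chi> j. Dg (i, j) (sc z) / lam)" for z i
  define G where "G z i = (\<chi> j. GG (i, j) (sc z) / lam powr (p - 1))" for z i
  define h where "h z = max 0 (h' (sc z)) / lam" for z
  have h'm [measurable]: "h' \<in> borel_measurable borel" using h' by (simp add: rep_def)
  have hm: "h \<in> borel_measurable borel" unfolding h_def[abs_def] by measurable
  have h0: "0 \<le> h z" for z using basic by (simp add: h_def)
  have us: "unit_solution N v g G"
    unfolding unit_solution_def
  proof (intro allI impI conjI)
    fix i assume i: "i < N"
    note Ui = U[rule_format, OF i]
    show "integrable lborel (\<lambda>z. v z i)" unfolding v_def
      by (rule integrable_divide[OF rep_integrable[OF Ui int_u[OF i]]])
    show "integrable lborel (\<lambda>z. g z i)" unfolding g_def
      by (rule integrable_vec) (simp add: integrable_divide[OF rep_integrable[OF Dg[OF i] int_Du[OF i]]])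
    show "integrable lborel (\<lambda>z. G z i)" unfolding G_def
      by (rule integrable_vec) (simp add: integrable_divide[OF rep_integrable[OF GG[OF i] int_Gf[OF i]]])
    fix \<phi> :: "(real^'n) \<times> real \<Rightarrow> real" assume \<phi>: "test_fun unit_cyl \<phi>"
    note \<phi>' = test_fun_cs(1)[OF \<phi>]
    have dc: "continuous_on UNIV (\<lambda>z. frechet_derivative \<phi> (at z) w)" for w
      by (rule test_fun_continuous[OF test_fun_deriv[OF \<phi>]])
    show "(\<integral>z. v z i * frechet_derivative \<phi> (at z) (axis j 1, 0) \<partial>lborel) = - (\<integral>z. (g z i $ j) * \<phi> z \<partial>lborel)" for j
    proof -
      let ?d = "\<lambda>z. frechet_derivative \<phi> (at z) (axis j 1, 0)"
      have "(LINT z|lebesgue_on Q. u z i * ((1 / \<rho>) * ?d (cs z))) = - (LINT z|lebesgue_on Q. (Du z i $ j) * \<phi> (cs z))"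
        using weak_space[OF \<phi>' i, of j] unfolding test_fun_cs_deriv[OF \<phi>] .
      also have "(\<lambda>z. u z i * ((1 / \<rho>) * ?d (cs z))) = (\<lambda>z. (1 / \<rho>) * (u z i * ?d (cs z)))"
        by (simp only: mult.left_commute)
      finally have * : "(1 / \<rho>) * (J * (\<integral>z. U i (sc z) * ?d z \<partial>lborel)) = - (J * (\<integral>z. Dg (i, j) (sc z) * \<phi> z \<partial>lborel))"
        unfolding integral_mult_right_zero rep_integral[OF Ui int_u[OF i] dc]
          rep_integral[OF Dg[OF i] int_Du[OF i] test_fun_continuous[OF \<phi>]] .
      have eq: "(\<integral>z. U i (sc z) * ?d z \<partial>lborel) / \<rho> = - (\<integral>z. Dg (i, j) (sc z) * \<phi> z \<partial>lborel)"
      proof -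
        have "x / \<rho> = - y" if "(1 / \<rho>) * (J * x) = - (J * y)" for x y
        proof -
          have "J * (x / \<rho>) = J * - y" using that by (simp add: algebra_simps)
          then show ?thesis using J_pos by (simp only: mult_cancel_left) simp
        qed
        from this[OF *] show ?thesis .
      qed
      have "(\<integral>z. v z i * ?d z \<partial>lborel) = (\<integral>z. U i (sc z) * ?d z \<partial>lborel) / \<rho> / lam"
        by (simp add: v_def)
      also have "\<dots> = - (\<integral>z. (g z i $ j) * \<phi> z \<partial>lborel)"
        unfolding eq by (simp add: g_def)
      finally show ?thesis .
    qed
    let ?t = "\<lambda>z. frechet_derivative \<phi> (at z) (0, 1)" and ?d = "\<lambda>j z. frechet_derivative \<phi> (at z) (axis j 1, 0)"
    have idj: "integrable lborel (\<lambda>z. GG (i, j) (sc z) * ?d j z)" for j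
    proof -
      obtain B where "\<forall>z. \<bar>?d j z\<bar> \<le> B" using test_fun_bounded[OF test_fun_deriv[OF \<phi>]] ..
      then show ?thesis
        by (intro bounded_mult_integrable[OF rep_integrable[OF GG[OF i] int_Gf[OF i]] dc]) (rule spec)
    qed
    have iq: "integrable (lebesgue_on Q) (\<lambda>z. (Gf z i $ j) * ((1 / \<rho>) * ?d j (cs z)))" for j
      using int_mult_test[OF int_Gf[OF i] test_fun_deriv[OF \<phi>'], of j "(axis j 1, 0)"] unfolding test_fun_cs_deriv[OF \<phi>] .
    have "(LINT z|lebesgue_on Q. u z i * ((1 / \<sigma>) * ?t (cs z))) = (LINT z|lebesgue_on Q. (\<Sum>j\<in>UNIV. (Gf z i $ j) * ((1 / \<rho>) * ?d j (cs z))))"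
      using weak_time[OF \<phi>' i] unfolding test_fun_cs_deriv[OF \<phi>] .
    also have "\<dots> = (\<Sum>j\<in>UNIV. (LINT z|lebesgue_on Q. (Gf z i $ j) * ((1 / \<rho>) * ?d j (cs z))))"
      by (rule Bochner_Integration.integral_sum) (rule iq)
    also have "\<dots> = (\<Sum>j\<in>UNIV. (1 / \<rho>) * (LINT z|lebesgue_on Q. (Gf z i $ j) * ?d j (cs z)))"
      by (simp only: mult.left_commute[of _ "1 / \<rho>"] integral_mult_right_zero)
    also have "\<dots> = (\<Sum>j\<in>UNIV. (1 / \<rho>) * (J * (\<integral>z. GG (i, j) (sc z) * ?d j z \<partial>lborel)))"
      by (simp only: rep_integral[OF GG[OF i] int_Gf[OF i] dc])
    also have "(\<lambda>z. u z i * ((1 / \<sigma>) * ?t (cs z))) = (\<lambda>z. (1 / \<sigma>) * (u z i * ?t (cs z)))"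
      by (simp only: mult.left_commute)
    finally have * : "(1 / \<sigma>) * (J * (\<integral>z. U i (sc z) * ?t z \<partial>lborel)) = J * ((1 / \<rho>) * (\<Sum>j\<in>UNIV. \<integral>z. GG (i, j) (sc z) * ?d j z \<partial>lborel))"
      unfolding integral_mult_right_zero rep_integral[OF Ui int_u[OF i] dc]
      by (simp only: sum_distrib_left mult.left_commute[of J])
    have eq: "(\<integral>z. U i (sc z) * ?t z \<partial>lborel) = (\<sigma> / \<rho>) * (\<Sum>j\<in>UNIV. \<integral>z. GG (i, j) (sc z) * ?d j z \<partial>lborel)"
    proof -
      have "x = (\<sigma> / \<rho>) * y" if "(1 / \<sigma>) * (J * x) = J * ((1 / \<rho>) * y)" for x y
      proof -
        have "J * (x / \<sigma>) = J * (y / \<rho>)" using that by (simp add: algebra_simps)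
        then have "x / \<sigma> = y / \<rho>" using J_pos by (simp only: mult_cancel_left) simp
        then show ?thesis using basic by (simp add: field_simps)
      qed
      from this[OF *] show ?thesis .
    qed
    \<comment> \<open>This identity is the reason for the factor \<open>lam powr (2 - p)\<close> in the duration of the cylinder.\<close>
    have lam: "(\<sigma> / \<rho>) / (\<rho> * lam) = 1 / lam powr (p - 1)"
    proof -
      have "(\<sigma> / \<rho>) / (\<rho> * lam) = (\<sigma> / \<rho>\<^sup>2) / lam" by (simp add: power2_eq_square)
      also have "\<dots> = lam powr (2 - p) / lam powr 1" using basic by (simp add: sigma_eq)
      also have "\<dots> = lam powr (- (p - 1))" by (simp only: powr_diff[symmetric]) simp
      also have "\<dots> = 1 / lam powr (p - 1)" by (rule powr_minus_divide)
      finally show ?thesis .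
    qed
    have "(\<integral>z. v z i * ?t z \<partial>lborel) = (\<integral>z. U i (sc z) * ?t z \<partial>lborel) / (\<rho> * lam)"
      by (simp add: v_def)
    also have "\<dots> = ((\<sigma> / \<rho>) / (\<rho> * lam)) * (\<Sum>j\<in>UNIV. \<integral>z. GG (i, j) (sc z) * ?d j z \<partial>lborel)"
      unfolding eq by simp
    also have "\<dots> = (\<Sum>j\<in>UNIV. \<integral>z. (G z i $ j) * ?d j z \<partial>lborel)"
      unfolding lam by (simp add: G_def sum_divide_distrib)
    also have "\<dots> = (\<integral>z. (\<Sum>j\<in>UNIV. (G z i $ j) * ?d j z) \<partial>lborel)"
      using idj by (intro Bochner_Integration.integral_sum[symmetric]) (simp add: G_def)
    finally show "(\<integral>z. v z i * ?t z \<partial>lborel) = (\<integral>z. (\<Sum>j\<in>UNIV. (G z i $ j) * ?d j z) \<partial>lborel)" .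
  qed
  have repq: "rep (\<lambda>z. hf z powr q) (\<lambda>z. max 0 (h' z) powr q)"
    unfolding rep_def
  proof
    show "(\<lambda>z. max 0 (h' z) powr q) \<in> borel_measurable borel" by measurable
    have "AE z in lborel. h' z = (if z \<in> Q then hf z else 0)" using h' by (simp add: rep_def)
    then show "AE z in lborel. max 0 (h' z) powr q = (if z \<in> Q then hf z powr q else 0)"
      by (rule AE_mp) (use hf_nonneg in \<open>auto simp: max_def\<close>)
  qed
  have hq: "h z powr q = (1 / lam powr q) * max 0 (h' (sc z)) powr q" for z
    using basic by (simp add: h_def powr_divide)
  have ihq: "integrable lborel (\<lambda>z. h z powr q)"
    unfolding hq by (intro integrable_mult_right rep_integrable[OF repq int_hf_q])
  have "(\<integral>z. h z powr q \<partial>lborel) = (1 / lam powr q) * (\<integral>z. max 0 (h' (sc z)) powr q \<partial>lborel)"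
    unfolding hq by simp
  also have "J * (\<integral>z. max 0 (h' (sc z)) powr q \<partial>lborel) = (LINT z|lebesgue_on Q. hf z powr q)"
    using rep_integral[OF repq int_hf_q continuous_on_const[of _ 1]] by simp
  then have "(\<integral>z. max 0 (h' (sc z)) powr q \<partial>lborel) = (LINT z|lebesgue_on Q. hf z powr q) / J"
    using J_pos by (simp add: field_simps)
  also have "(LINT z|lebesgue_on Q. hf z powr q) = average Q (\<lambda>z. hf z powr q) * measure lebesgue Q"
    using measure_Q_pos by (simp add: average_def)
  also have "(1 / lam powr q) * (average Q (\<lambda>z. hf z powr q) * measure lebesgue Q / J) =
      (average Q (\<lambda>z. hf z powr q) / lam powr q) * measure lborel (unit_cyl :: ((real^'n) \<times> real) set)"
    using J_pos by (simp add: measure_Q)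
  also have "\<dots> \<le> 1 * measure lborel (unit_cyl :: ((real^'n) \<times> real) set)"
    using average_hf(2) basic by (intro mult_right_mono) auto
  finally have hH: "(\<integral>z. h z powr q \<partial>lborel) \<le> measure lborel (unit_cyl :: ((real^'n) \<times> real) set)" by simp
  have aeU: "AE z in lborel. \<forall>i. i < N \<longrightarrow> U i z = (if z \<in> Q then u z i else 0)"
    unfolding AE_all_countable using U by (auto simp: rep_def)
  have aeD: "AE z in lborel. \<forall>i j. i < N \<longrightarrow> Dg (i, j) z = (if z \<in> Q then Du z i $ j else 0)"
    unfolding AE_all_countable using Dg by (auto simp: rep_def)
  have aeG: "AE z in lborel. \<forall>i j. i < N \<longrightarrow> GG (i, j) z = (if z \<in> Q then Gf z i $ j else 0)"
    unfolding AE_all_countable using GG by (auto simp: rep_def)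
  have aeh: "AE z in lborel. h' z = (if z \<in> Q then hf z else 0)" using h' by (simp add: rep_def)
  have aeb: "AE z in lborel. z \<in> Q \<longrightarrow> vnorm N (Gf z) \<le> (L + 1) * hf z powr (p - 1)"
    using Gf_le Q_sets by (simp add: AE_restrict_space_iff AE_completion_iff)
  have gle: "AE z in lborel. vnorm N (g z) \<le> h z"
    using AE_sc[OF aeD] AE_sc[OF aeh]
  proof eventually_elim
    case (elim z)
    show ?case
    proof (cases "sc z \<in> Q")
      case True
      have "vnorm N (g z) = vnorm N (\<lambda>i. (1 / lam) *\<^sub>R Du (sc z) i)"
        using elim(1) True by (intro vnorm_cong arg_cong[where f=norm]) (simp add: g_def vec_eq_iff)
      also have "\<dots> = vnorm N (Du (sc z)) / lam" using basic by (simp add: vnorm_scale)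
      also have "\<dots> \<le> hf (sc z) / lam" using basic by (intro divide_right_mono) (auto simp: hf_def)
      finally show ?thesis using elim(2) True hf_nonneg[of "sc z"] by (simp add: h_def)
    next
      case False
      have "vnorm N (g z) = vnorm N (\<lambda>i. 0 :: real^'n)"
        using elim(1) False by (intro vnorm_cong arg_cong[where f=norm]) (simp add: g_def vec_eq_iff)
      then show ?thesis using h0[of z] by (simp add: vnorm_zero)
    qed
  qed
  have Gle: "AE z in lborel. vnorm N (G z) \<le> (L + 1) * h z powr (p - 1)"
    using AE_sc[OF aeG] AE_sc[OF aeh] AE_sc[OF aeb]
  proof eventually_elim
    case (elim z)
    show ?case
    proof (cases "sc z \<in> Q")
      case True
      have "vnorm N (G z) = vnorm N (\<lambda>i. (1 / lam powr (p - 1)) *\<^sub>R Gf (sc z) i)"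
        using elim(1) True by (intro vnorm_cong arg_cong[where f=norm]) (simp add: G_def vec_eq_iff)
      also have "\<dots> = vnorm N (Gf (sc z)) / lam powr (p - 1)" using basic by (simp add: vnorm_scale)
      also have "\<dots> \<le> (L + 1) * hf (sc z) powr (p - 1) / lam powr (p - 1)"
        using elim(3) True by (intro divide_right_mono) auto
      also have "\<dots> = (L + 1) * h z powr (p - 1)"
        using elim(2) True hf_nonneg[of "sc z"] basic by (simp add: h_def powr_divide)
      finally show ?thesis .
    next
      case False
      have "vnorm N (G z) = vnorm N (\<lambda>i. 0 :: real^'n)"
        using elim(1) False by (intro vnorm_cong arg_cong[where f=norm]) (simp add: G_def vec_eq_iff)
      then show ?thesis using basic by (simp add: vnorm_zero)
    qed
  qed
  have vU: "AE z in lborel. z \<in> Q \<longrightarrow> (\<forall>i<N. v (cs z) i = u z i / (\<rho> * lam))"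
    using aeU by (rule AE_mp) (auto simp: v_def sc_cs)
  show ?thesis
    by (intro exI[of _ v] exI[of _ g] exI[of _ G] exI[of _ h] conjI allI us hm h0 ihq hH gle Gle vU)
qed

end

text \<open>
  The constant of \<open>unit_estimate\<close> has to be replaced by the mean of \<open>u\<close>. The mean differs from it by at most the
  average of the sum over \<open>k \<le> K\<close>, which is bounded by the average of \<open>2 powr (K \<theta>) \<le> Y\<close> because \<open>D / q - 1 \<le> \<theta>\<close>; and
  such a constant is absorbed since the sum is at least one.
\<close>

theorem master_estimate:
  fixes p q \<alpha> D \<theta> L \<gamma> :: real
  assumes p: "1 < p" and q: "1 \<le> q" "p - 1 \<le> q" and \<alpha>: "0 < \<alpha>" and D: "D = real CARD('n) + \<alpha>"
    and rel: "\<alpha> - 2 = D / q * (p - 2)" and \<theta>: "0 < \<theta>" "\<theta> < D" "D / q - 1 \<le> \<theta>"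
  shows "\<exists>C>0. \<forall>N \<nu> (\<Omega>::(real^'n) set) T A F u Du lam \<rho> x0 t0.
    intrinsic_setting p q L \<gamma> N \<nu> \<Omega> T A F u Du lam \<rho> x0 t0 \<longrightarrow>
    0 < \<rho> \<and> 0 < data_mean q N Du F (cylinder p lam \<rho> x0 t0) \<and>
    oscillation N u (cylinder p lam \<rho> x0 t0) \<in> borel_measurable (lebesgue_on (cylinder p lam \<rho> x0 t0)) \<and>
    (\<exists>Y. (\<forall>z. 0 \<le> Y z) \<and> integrable (lebesgue_on (cylinder p lam \<rho> x0 t0)) Y \<and> average (cylinder p lam \<rho> x0 t0) Y \<le> C \<and>
      (AE z in lebesgue_on (cylinder p lam \<rho> x0 t0). \<exists>K::nat.
        oscillation N u (cylinder p lam \<rho> x0 t0) z \<le> C * (\<rho> * data_mean q N Du F (cylinder p lam \<rho> x0 t0)) *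
          (\<Sum>k\<le>K. 2 powr (real k * (D / q - 1))) \<and> 2 powr (real K * \<theta>) \<le> Y z))"
proof -
  define mU where "mU = measure lborel (unit_cyl :: ((real^'n) \<times> real) set)"
  define c3 where "c3 = 1 / (1 - 2 powr (- \<theta>))"
  have c3: "0 < c3" using \<theta> by (simp add: c3_def powr_less_one)
  have "\<exists>C>0. \<forall>N (v :: (real^'n) \<times> real \<Rightarrow> nat \<Rightarrow> real) g G h.
    unit_solution N v g G \<longrightarrow> h \<in> borel_measurable borel \<longrightarrow> (\<forall>z. 0 \<le> h z) \<longrightarrow>
    integrable lborel (\<lambda>z. h z powr q) \<longrightarrow> (\<integral>z. h z powr q \<partial>lborel) \<le> max 1 mU \<longrightarrow>
    (AE z in lborel. vnorm N (g z) \<le> h z) \<longrightarrow> (AE z in lborel. vnorm N (G z) \<le> max 1 (L + 1) * h z powr (p - 1)) \<longrightarrow>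
    (\<exists>a Y. Y \<in> borel_measurable borel \<and> (\<forall>z. 0 \<le> Y z) \<and> integrable lborel Y \<and> (\<integral>z. Y z \<partial>lborel) \<le> C \<and>
      (AE z in lborel. z \<in> unit_cyl \<longrightarrow> (\<exists>K::nat.
        vnorm N (\<lambda>i. v z i - a i) \<le> C * (\<Sum>k\<le>K. 2 powr (real k * (D / q - 1))) \<and> 2 powr (real K * \<theta>) \<le> Y z)))"
    by (rule unit_estimate[OF p q \<alpha> D rel \<theta>(1,2)]) auto
  then obtain C where C: "0 < C" and main: "\<And>N (v :: (real^'n) \<times> real \<Rightarrow> nat \<Rightarrow> real) g G h.
    unit_solution N v g G \<Longrightarrow> h \<in> borel_measurable borel \<Longrightarrow> (\<forall>z. 0 \<le> h z) \<Longrightarrow>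
    integrable lborel (\<lambda>z. h z powr q) \<Longrightarrow> (\<integral>z. h z powr q \<partial>lborel) \<le> max 1 mU \<Longrightarrow>
    (AE z in lborel. vnorm N (g z) \<le> h z) \<Longrightarrow> (AE z in lborel. vnorm N (G z) \<le> max 1 (L + 1) * h z powr (p - 1)) \<Longrightarrow>
    \<exists>a Y. Y \<in> borel_measurable borel \<and> (\<forall>z. 0 \<le> Y z) \<and> integrable lborel Y \<and> (\<integral>z. Y z \<partial>lborel) \<le> C \<and>
      (AE z in lborel. z \<in> unit_cyl \<longrightarrow> (\<exists>K::nat.
        vnorm N (\<lambda>i. v z i - a i) \<le> C * (\<Sum>k\<le>K. 2 powr (real k * (D / q - 1))) \<and> 2 powr (real K * \<theta>) \<le> Y z))"
    by (elim exE conjE) (rule that, assumption, simp)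
  \<comment> \<open>The first summand bounds the distance to the constant \<open>a\<close>, the second the distance between \<open>a\<close> and the mean.\<close>
  define C4 where "C4 = C + C * c3 * (C / mU)"
  define C5 where "C5 = max 1 (max (C / mU) (C4 * \<gamma>))"
  show ?thesis
  proof (intro exI[of _ C5] conjI[of "0 < C5"] allI impI)
    show "0 < C5" by (simp add: C5_def)
    fix N \<nu> and \<Omega> :: "(real^'n) set" and T A F u Du lam \<rho> x0 t0
    assume set: "intrinsic_setting p q L \<gamma> N \<nu> \<Omega> T A F u Du lam \<rho> x0 t0"
    interpret intrinsic_solution p q L \<gamma> N \<nu> \<Omega> T A F u Du lam \<rho> x0 t0
      by unfold_locales (use p q set in auto)
    have mU: "0 < mU" unfolding mU_def by (rule unit_measure_pos)
    from unit_transform obtain v g G h where us: "unit_solution N v g G" and hm: "h \<in> borel_measurable borel" and h0: "\<forall>z. 0 \<le> h z"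
      and hq: "integrable lborel (\<lambda>z. h z powr q)" and hH: "(\<integral>z. h z powr q \<partial>lborel) \<le> measure lborel (unit_cyl :: ((real^'n) \<times> real) set)"
      and gle: "AE z in lborel. vnorm N (g z) \<le> h z" and Gle: "AE z in lborel. vnorm N (G z) \<le> (L + 1) * h z powr (p - 1)"
      and vU: "AE z in lborel. z \<in> Q \<longrightarrow> (\<forall>i<N. v (cs z) i = u z i / (\<rho> * lam))"
      by (elim exE conjE) (rule that)
    have "(\<integral>z. h z powr q \<partial>lborel) \<le> max 1 mU" using hH unfolding mU_def by linarith
    moreover have "max 1 (L + 1) = L + 1" using basic by simp
    ultimately have "\<exists>a Y. Y \<in> borel_measurable borel \<and> (\<forall>z. 0 \<le> Y z) \<and> integrable lborel Y \<and> (\<integral>z. Y z \<partial>lborel) \<le> C \<and>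
      (AE z in lborel. z \<in> unit_cyl \<longrightarrow> (\<exists>K::nat.
        vnorm N (\<lambda>i. v z i - a i) \<le> C * (\<Sum>k\<le>K. 2 powr (real k * (D / q - 1))) \<and> 2 powr (real K * \<theta>) \<le> Y z))"
      using Gle by (intro main[OF us hm h0 hq _ gle]) simp_all
    then obtain a Y where Ym: "Y \<in> borel_measurable borel" and Y0: "\<forall>z. 0 \<le> Y z" and Yi: "integrable lborel Y" and YC: "(\<integral>z. Y z \<partial>lborel) \<le> C"
      and AEz: "AE z in lborel. z \<in> unit_cyl \<longrightarrow> (\<exists>K::nat.
        vnorm N (\<lambda>i. v z i - a i) \<le> C * (\<Sum>k\<le>K. 2 powr (real k * (D / q - 1))) \<and> 2 powr (real K * \<theta>) \<le> Y z)"
      by (elim exE conjE) (rule that)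
    define r where "r = \<rho> * lam"
    have r: "0 < r" using basic by (simp add: r_def)
    then have nz: "lam \<noteq> 0" "\<rho> \<noteq> 0" by (auto simp: r_def)
    define a' where "a' i = r * a i" for i
    define Y' where "Y' z = Y (cs z)" for z
    have Y'0: "0 \<le> Y' z" for z unfolding Y'_def by (rule spec[OF Y0])
    have Y'm: "Y' \<in> borel_measurable borel"
      unfolding Y'_def[abs_def] by (rule measurable_compose[OF borel_measurable_continuous_onI[OF continuous_cs] Ym])
    have Y'i: "integrable lborel Y'" using integral_sc(1)[OF Y'm] Yi by (simp add: Y'_def cs_sc)
    have Y'int: "(\<integral>z. Y' z \<partial>lborel) = J * (\<integral>z. Y z \<partial>lborel)"
      using integral_sc(2)[OF Y'm] by (simp add: Y'_def cs_sc)
    have Y'l: "integrable lebesgue Y'" using Y'i Y'm by (subst integrable_completion) auto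
    have Y'Q: "integrable (lebesgue_on Q) Y'"
      using integrable_mult_indicator[OF Q_sets Y'l] Q_sets by (simp add: integrable_restrict_space)
    have "(LINT z|lebesgue_on Q. Y' z) = (LINT z|lebesgue. indicator Q z *\<^sub>R Y' z)"
      using Q_sets by (simp add: integral_restrict_space)
    also have "\<dots> \<le> (LINT z|lebesgue. Y' z)"
      using Y'0 by (intro integral_mono integrable_mult_indicator[OF Q_sets Y'l] Y'l) (auto simp: indicator_def)
    also have "\<dots> = (\<integral>z. Y' z \<partial>lborel)" using Y'm by (intro integral_completion) simp
    also have "\<dots> \<le> J * C" unfolding Y'int using YC J_pos by (intro mult_left_mono) auto
    finally have "average Q Y' \<le> J * C / measure lebesgue Q"
      unfolding average_def using measure_Q_pos by (intro divide_right_mono) auto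
    also have "\<dots> = C / mU" using J_pos by (simp add: measure_Q mU_def)
    finally have avY: "average Q Y' \<le> C / mU" .
    have "AE z in lborel. z \<in> Q \<longrightarrow> (\<exists>K::nat. vnorm N (\<lambda>i. u z i - a' i) \<le> r * (C * (\<Sum>k\<le>K. 2 powr (real k * (D / q - 1)))) \<and> 2 powr (real K * \<theta>) \<le> Y' z)"
      using AE_cs[OF AEz] vU
    proof eventually_elim
      case (elim z)
      show ?case
      proof
        assume z: "z \<in> Q"
        then have "cs z \<in> unit_cyl" using sc_Q[of "cs z"] by (simp add: sc_cs)
        with elim(1) obtain K :: nat where K: "vnorm N (\<lambda>i. v (cs z) i - a i) \<le> C * (\<Sum>k\<le>K. 2 powr (real k * (D / q - 1)))"
          "2 powr (real K * \<theta>) \<le> Y (cs z)" by blast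
        have "vnorm N (\<lambda>i. u z i - a' i) = vnorm N (\<lambda>i. r *\<^sub>R (v (cs z) i - a i))"
          using elim(2) z nz by (intro vnorm_cong arg_cong[where f=norm]) (simp add: a'_def r_def right_diff_distrib)
        also have "\<dots> = r * vnorm N (\<lambda>i. v (cs z) i - a i)" using r by (simp only: vnorm_scale; simp)
        also have "\<dots> \<le> r * (C * (\<Sum>k\<le>K. 2 powr (real k * (D / q - 1))))" using K(1) r by (intro mult_left_mono) auto
        finally show "\<exists>K::nat. vnorm N (\<lambda>i. u z i - a' i) \<le> r * (C * (\<Sum>k\<le>K. 2 powr (real k * (D / q - 1)))) \<and> 2 powr (real K * \<theta>) \<le> Y' z"
          using K(2) by (intro exI[of _ K]) (simp add: Y'_def)
      qed
    qed
    then have AEQ: "AE z in lebesgue_on Q. \<exists>K::nat. vnorm N (\<lambda>i. u z i - a' i) \<le> r * (C * (\<Sum>k\<le>K. 2 powr (real k * (D / q - 1)))) \<and> 2 powr (real K * \<theta>) \<le> Y' z"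
      using Q_sets by (simp add: AE_restrict_space_iff AE_completion_iff)
    have ua: "AE z in lebesgue_on Q. vnorm N (\<lambda>i. u z i - a' i) \<le> r * C * c3 * Y' z"
      using AEQ
    proof eventually_elim
      case (elim z)
      then obtain K :: nat where K: "vnorm N (\<lambda>i. u z i - a' i) \<le> r * (C * (\<Sum>k\<le>K. 2 powr (real k * (D / q - 1))))" "2 powr (real K * \<theta>) \<le> Y' z" by blast
      have "(\<Sum>k\<le>K. 2 powr (real k * (D / q - 1))) \<le> c3 * 2 powr (real K * \<theta>)"
        unfolding c3_def by (rule geometric_sum_le[OF \<theta>(1,3)])
      also have "\<dots> \<le> c3 * Y' z" using K(2) c3 by (intro mult_left_mono) auto
      finally have "r * (C * (\<Sum>k\<le>K. 2 powr (real k * (D / q - 1)))) \<le> r * (C * (c3 * Y' z))"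
        using r C by (intro mult_left_mono) auto
      then show ?case using K(1) by (simp add: mult.assoc)
    qed
    define m where "m = measure lebesgue Q"
    have m: "0 < m" unfolding m_def by (rule measure_Q_pos)
    interpret fin: finite_measure "lebesgue_on Q" by (rule finite_Q)
    have mres: "measure (lebesgue_on Q) (space (lebesgue_on Q)) = m"
      using Q_sets by (simp add: m_def measure_restrict_space)
    have mean: "vnorm N (\<lambda>i. vaverage Q u i - a' i) \<le> r * C * c3 * (C / mU)"
    proof -
      have "vnorm N (\<lambda>i. vaverage Q u i - a' i) = vnorm N (\<lambda>i. (1 / m) *\<^sub>R (LINT z|lebesgue_on Q. u z i - a' i))"
      proof (rule vnorm_cong, rule arg_cong[where f=norm])
        fix i assume i: "i < N"
        have "(LINT z|lebesgue_on Q. u z i - a' i) = (LINT z|lebesgue_on Q. u z i) - m * a' i"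
          using int_u[OF i] mres by simp
        then show "vaverage Q u i - a' i = (1 / m) *\<^sub>R (LINT z|lebesgue_on Q. u z i - a' i)"
          using m by (simp add: vaverage_def average_def m_def field_simps)
      qed
      also have "\<dots> = (1 / m) * vnorm N (\<lambda>i. LINT z|lebesgue_on Q. u z i - a' i)"
        using m by (simp only: vnorm_scale; simp)
      also have "\<dots> \<le> (1 / m) * (LINT z|lebesgue_on Q. r * C * c3 * Y' z)"
        using m by (intro mult_left_mono vnorm_integral_le[OF _ _ ua]) (auto intro!: int_u Y'Q)
      also have "\<dots> = r * C * c3 * average Q Y'" by (simp add: average_def m_def)
      also have "\<dots> \<le> r * C * c3 * (C / mU)" using r C c3 by (intro mult_left_mono avY) auto
      finally show ?thesis .
    qed
    have dm: "r \<le> \<rho> * (\<gamma> * data_mean q N Du F Q)" unfolding r_def using average_hf(3) basic by (intro mult_left_mono) auto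
    have C4: "0 < C4" unfolding C4_def using C c3 mU by (intro add_pos_nonneg) auto
    have dm0: "0 < data_mean q N Du F Q"
    proof -
      have "0 < \<gamma> * data_mean q N Du F Q" using average_hf(3) basic by linarith
      then show ?thesis using basic by (simp add: zero_less_mult_iff)
    qed
    have osc: "AE z in lebesgue_on Q. \<exists>K::nat. oscillation N u Q z \<le> C5 * (\<rho> * data_mean q N Du F Q) * (\<Sum>k\<le>K. 2 powr (real k * (D / q - 1))) \<and> 2 powr (real K * \<theta>) \<le> Y' z"
      using AEQ
    proof eventually_elim
      case (elim z)
      then obtain K :: nat where K: "vnorm N (\<lambda>i. u z i - a' i) \<le> r * (C * (\<Sum>k\<le>K. 2 powr (real k * (D / q - 1))))" "2 powr (real K * \<theta>) \<le> Y' z" by blast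
      define \<Sigma> where "\<Sigma> = (\<Sum>k\<le>K. 2 powr (real k * (D / q - 1)))"
      have "(\<Sum>k\<in>{0}. 2 powr (real k * (D / q - 1))) \<le> \<Sigma>" unfolding \<Sigma>_def by (rule sum_mono2) auto
      then have \<Sigma>: "1 \<le> \<Sigma>" by simp
      have "oscillation N u Q z \<le> vnorm N (\<lambda>i. u z i - a' i) + vnorm N (\<lambda>i. a' i - vaverage Q u i)"
        unfolding oscillation_def by (rule vnorm_triangle3)
      also have "vnorm N (\<lambda>i. a' i - vaverage Q u i) = vnorm N (\<lambda>i. vaverage Q u i - a' i)" by (rule vnorm_minus)
      also have "vnorm N (\<lambda>i. u z i - a' i) + \<dots> \<le> r * (C * \<Sigma>) + r * C * c3 * (C / mU) * 1"
        using K(1) mean by (simp add: \<Sigma>_def)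
      also have "\<dots> \<le> r * (C * \<Sigma>) + r * C * c3 * (C / mU) * \<Sigma>"
        using \<Sigma> r C c3 mU by (intro add_left_mono mult_left_mono) auto
      also have "\<dots> = r * (C4 * \<Sigma>)" by (simp add: C4_def algebra_simps)
      also have "\<dots> \<le> \<rho> * (\<gamma> * data_mean q N Du F Q) * (C4 * \<Sigma>)"
        using C4 \<Sigma> by (intro mult_right_mono dm) auto
      also have "\<dots> = (C4 * \<gamma>) * ((\<rho> * data_mean q N Du F Q) * \<Sigma>)" by (simp only: mult_ac)
      also have "\<dots> \<le> C5 * ((\<rho> * data_mean q N Du F Q) * \<Sigma>)"
        using basic dm0 \<Sigma> by (intro mult_right_mono) (auto simp: C5_def)
      finally show ?case using K(2) by (intro exI[of _ K]) (simp add: \<Sigma>_def mult.assoc)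
    qed
    have om: "oscillation N u Q \<in> borel_measurable (lebesgue_on Q)"
      unfolding oscillation_def[abs_def] by (intro measurable_vnorm borel_measurable_diff borel_measurable_integrable[OF int_u]) auto
    show "0 < \<rho> \<and> 0 < data_mean q N Du F Q \<and>
      oscillation N u Q \<in> borel_measurable (lebesgue_on Q) \<and>
      (\<exists>Y. (\<forall>z. 0 \<le> Y z) \<and> integrable (lebesgue_on Q) Y \<and> average Q Y \<le> C5 \<and>
      (AE z in lebesgue_on Q. \<exists>K::nat.
        oscillation N u Q z \<le> C5 * (\<rho> * data_mean q N Du F Q) * (\<Sum>k\<le>K. 2 powr (real k * (D / q - 1))) \<and> 2 powr (real K * \<theta>) \<le> Y z))"
      using avY by (intro conjI basic(1) dm0 om exI[of _ Y'] allI Y'0 Y'Q osc) (simp add: C5_def)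
  qed
qed


section \<open>Integrability, exponential integrability and boundedness\<close>

lemma average_le:
  fixes f Y :: "'a::euclidean_space \<Rightarrow> real"
  assumes f: "f \<in> borel_measurable (lebesgue_on Q)" and f0: "\<And>z. 0 \<le> f z"
    and le: "AE z in lebesgue_on Q. f z \<le> B * Y z" and Y: "integrable (lebesgue_on Q) Y" and B: "0 \<le> B"
    and C: "average Q Y \<le> C"
  shows "integrable (lebesgue_on Q) f" "average Q f \<le> B * C"
proof -
  have BY: "integrable (lebesgue_on Q) (\<lambda>z. B * Y z)" using Y by simp
  show int: "integrable (lebesgue_on Q) f"
  proof (rule Bochner_Integration.integrable_bound[OF BY f])
    show "AE z in lebesgue_on Q. norm (f z) \<le> norm (B * Y z)"
      using le by (rule AE_mp) (use f0 in \<open>auto intro!: AE_I2\<close>)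
  qed
  have "(LINT z|lebesgue_on Q. f z) \<le> B * (LINT z|lebesgue_on Q. Y z)"
    using integral_mono_AE[OF int BY le] by simp
  then have "average Q f \<le> B * average Q Y"
    unfolding average_def times_divide_eq_right by (rule divide_right_mono) simp
  also have "\<dots> \<le> B * C" by (intro mult_left_mono C B)
  finally show "average Q f \<le> B * C" .
qed

text \<open>
  The equation \<open>\<alpha> - 2 = (D / q) (p - 2)\<close> with \<open>D = n + \<alpha>\<close> is linear in \<open>\<alpha>\<close>, and this is its solution. Positivity of the
  numerator is the lower bound \<open>q > (2 - p) n / 2\<close> of the singular case.
\<close>

lemma scaling_exponents:
  fixes p q n \<alpha> D :: real
  assumes "1 < p" "1 \<le> q" "p - 1 \<le> q" "1 \<le> n" "0 < 2 * q + n * (p - 2)"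
    and \<alpha>: "\<alpha> = (2 * q + n * (p - 2)) / (q - p + 2)" and D: "D = n + \<alpha>"
  shows "0 < \<alpha>" "\<alpha> - 2 = D / q * (p - 2)" "0 < D" "D / q - 1 = (n + p - q) / (q - p + 2)"
    "D = q * (n + 2) / (q - p + 2)"
proof -
  have m: "0 < q - p + 2" using assms by simp
  show a: "0 < \<alpha>" unfolding \<alpha> using m assms by simp
  show D0: "0 < D" using a assms(4) D by linarith
  show D1: "D = q * (n + 2) / (q - p + 2)" unfolding D \<alpha> using m by (simp add: field_simps)
  have D2: "D / q = (n + 2) / (q - p + 2)" unfolding D1 using assms by simp
  show "D / q - 1 = (n + p - q) / (q - p + 2)" unfolding D2 using m by (simp add: field_simps)
  show "\<alpha> - 2 = D / q * (p - 2)" unfolding D2 \<alpha> using m by (simp add: field_simps)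
qed

text \<open>
  For \<open>D / q > 1\<close> the sum over \<open>k \<le> K\<close> is comparable to \<open>2 powr (K (D / q - 1))\<close>. Its power \<open>qs\<close> is \<open>2 powr (K \<theta>)\<close> with
  \<open>\<theta> = qs (D / q - 1)\<close>, and \<open>\<theta> < D\<close> is the upper bound for \<open>qs\<close>.
\<close>

lemma higher_integrability:
  fixes p q qs L \<gamma> :: real
  assumes p: "1 < p" and q: "1 \<le> q" "p - 1 \<le> q" and pos: "0 < 2 * q + real CARD('n) * (p - 2)"
    and qn: "q < real CARD('n) + p" and qs: "q \<le> qs" "qs < q * (real CARD('n) + 2) / (real CARD('n) + p - q)"
  shows "\<exists>c>0. (\<forall>N \<nu> (\<Omega>::(real^'n) set) T A F u Du lam \<rho> x0 t0.
          intrinsic_setting p q L \<gamma> N \<nu> \<Omega> T A F u Du lam \<rho> x0 t0 \<longrightarrow>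
          (let Q = cylinder p lam \<rho> x0 t0 in
             integrable (lebesgue_on Q) (\<lambda>z. oscillation N u Q z powr qs / \<rho> powr qs) \<and>
             average Q (\<lambda>z. oscillation N u Q z powr qs / \<rho> powr qs) powr (1 / qs)
               \<le> c * data_mean q N Du F Q))"
proof -
  define n where "n = real CARD('n)"
  have n: "1 \<le> n" by (simp add: n_def Suc_leI)
  define \<alpha> where "\<alpha> = (2 * q + n * (p - 2)) / (q - p + 2)"
  define D where "D = n + \<alpha>"
  note E = scaling_exponents[OF p q n pos[folded n_def] \<alpha>_def D_def]
  define \<mu> where "\<mu> = D / q - 1"
  define \<theta> where "\<theta> = qs * \<mu>"
  have m: "0 < q - p + 2" using q by simp
  have \<mu>: "0 < \<mu>" unfolding \<mu>_def E(4) using qn m by (simp add: n_def)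
  have qs1: "1 \<le> qs" using q qs by simp
  have "\<theta> < D"
  proof -
    have "qs * (n + p - q) < q * (n + 2)" using qs(2) qn by (simp add: n_def pos_less_divide_eq)
    then show ?thesis unfolding \<theta>_def \<mu>_def E(4) unfolding E(5) using m
      by (simp add: divide_strict_right_mono)
  qed
  moreover have "\<mu> \<le> \<theta>" unfolding \<theta>_def using qs1 \<mu> by simp
  moreover have "0 < \<theta>" unfolding \<theta>_def using qs1 \<mu> by simp
  ultimately have \<theta>: "0 < \<theta>" "\<theta> < D" "D / q - 1 \<le> \<theta>" by (auto simp: \<mu>_def)
  from master_estimate[OF p q E(1) D_def[unfolded n_def] E(2) \<theta>, of L \<gamma>]
  obtain C where C: "0 < C" and main: "\<forall>N \<nu> (\<Omega>::(real^'n) set) T A F u Du lam \<rho> x0 t0.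
    intrinsic_setting p q L \<gamma> N \<nu> \<Omega> T A F u Du lam \<rho> x0 t0 \<longrightarrow>
    0 < \<rho> \<and> 0 < data_mean q N Du F (cylinder p lam \<rho> x0 t0) \<and>
    oscillation N u (cylinder p lam \<rho> x0 t0) \<in> borel_measurable (lebesgue_on (cylinder p lam \<rho> x0 t0)) \<and>
    (\<exists>Y. (\<forall>z. 0 \<le> Y z) \<and> integrable (lebesgue_on (cylinder p lam \<rho> x0 t0)) Y \<and> average (cylinder p lam \<rho> x0 t0) Y \<le> C \<and>
      (AE z in lebesgue_on (cylinder p lam \<rho> x0 t0). \<exists>K::nat.
        oscillation N u (cylinder p lam \<rho> x0 t0) z \<le> C * (\<rho> * data_mean q N Du F (cylinder p lam \<rho> x0 t0)) *
          (\<Sum>k\<le>K. 2 powr (real k * (D / q - 1))) \<and> 2 powr (real K * \<theta>) \<le> Y z))"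
    by (elim exE conjE) (rule that)
  define c3 where "c3 = 1 / (1 - 2 powr (- \<mu>))"
  have c3: "0 < c3" using \<mu> by (simp add: c3_def powr_less_one)
  define c where "c = C * c3 * C powr (1 / qs)"
  show ?thesis
  proof (intro exI[of _ c] conjI allI impI)
    show "0 < c" using C c3 by (simp add: c_def)
    fix N \<nu> and \<Omega> :: "(real^'n) set" and T A F u Du lam \<rho> x0 t0
    assume "intrinsic_setting p q L \<gamma> N \<nu> \<Omega> T A F u Du lam \<rho> x0 t0"
    note M = main[rule_format, OF this]
    define Q where "Q = cylinder p lam \<rho> x0 t0"
    define dm where "dm = data_mean q N Du F Q"
    from M[folded Q_def, folded dm_def] obtain Y where \<rho>: "0 < \<rho>" and dm: "0 < dm"
      and om: "oscillation N u Q \<in> borel_measurable (lebesgue_on Q)"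
      and Y0: "\<forall>z. 0 \<le> Y z" and Y: "integrable (lebesgue_on Q) Y" "average Q Y \<le> C"
      and ae: "AE z in lebesgue_on Q. \<exists>K::nat. oscillation N u Q z \<le> C * (\<rho> * dm) * (\<Sum>k\<le>K. 2 powr (real k * (D / q - 1))) \<and> 2 powr (real K * \<theta>) \<le> Y z"
      by (elim exE conjE) (rule that)
    define B where "B = (C * dm * c3) powr qs"
    define f where "f z = oscillation N u Q z powr qs / \<rho> powr qs" for z
    have fm: "f \<in> borel_measurable (lebesgue_on Q)"
      unfolding f_def[abs_def] using om by (intro borel_measurable_divide powr_real_measurable) auto
    have fle: "AE z in lebesgue_on Q. f z \<le> B * Y z"
      using ae
    proof (rule AE_mp, intro AE_I2 impI)
      fix z assume "\<exists>K::nat. oscillation N u Q z \<le> C * (\<rho> * dm) * (\<Sum>k\<le>K. 2 powr (real k * (D / q - 1))) \<and> 2 powr (real K * \<theta>) \<le> Y z"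
      then obtain K :: nat where K: "oscillation N u Q z \<le> C * (\<rho> * dm) * (\<Sum>k\<le>K. 2 powr (real k * (D / q - 1)))" "2 powr (real K * \<theta>) \<le> Y z" by blast
      have "(\<Sum>k\<le>K. 2 powr (real k * (D / q - 1))) \<le> c3 * 2 powr (real K * \<mu>)"
        unfolding c3_def \<mu>_def[symmetric] by (rule geometric_sum_le[OF \<mu> order_refl])
      then have "C * (\<rho> * dm) * (\<Sum>k\<le>K. 2 powr (real k * (D / q - 1))) \<le> C * (\<rho> * dm) * (c3 * 2 powr (real K * \<mu>))"
        using C \<rho> dm by (intro mult_left_mono) auto
      then have "oscillation N u Q z \<le> \<rho> * ((C * dm * c3) * 2 powr (real K * \<mu>))"
        using K(1) by (simp add: mult_ac)
      then have "oscillation N u Q z powr qs \<le> (\<rho> * ((C * dm * c3) * 2 powr (real K * \<mu>))) powr qs"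
        using qs1 by (intro powr_mono2) (auto simp: oscillation_def)
      also have "\<dots> = \<rho> powr qs * (B * 2 powr (real K * \<theta>))"
        using \<rho> C dm c3 by (simp add: powr_mult B_def powr_powr \<theta>_def mult_ac)
      also have "\<dots> \<le> \<rho> powr qs * (B * Y z)"
        using K(2) by (intro mult_left_mono) (auto simp: B_def)
      finally show "f z \<le> B * Y z" using \<rho> by (simp add: f_def divide_le_eq mult.commute)
    qed
    have f0: "0 \<le> f z" for z by (simp add: f_def)
    have B0: "0 \<le> B" by (simp add: B_def)
    note av = average_le[OF fm f0 fle Y(1) B0 Y(2)]
    have "average Q f powr (1 / qs) \<le> (B * C) powr (1 / qs)"
    proof (rule powr_mono2)
      show "0 \<le> average Q f" unfolding average_def using f0 by (intro divide_nonneg_nonneg integral_nonneg_AE) auto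
    qed (use qs1 av(2) in auto)
    also have "\<dots> = c * dm"
      using C dm c3 qs1 by (simp add: B_def powr_mult powr_powr c_def mult_ac)
    finally show "let Q = cylinder p lam \<rho> x0 t0 in
             integrable (lebesgue_on Q) (\<lambda>z. oscillation N u Q z powr qs / \<rho> powr qs) \<and>
             average Q (\<lambda>z. oscillation N u Q z powr qs / \<rho> powr qs) powr (1 / qs)
               \<le> c * data_mean q N Du F Q"
      using av(1) unfolding Let_def Q_def[symmetric] dm_def[symmetric] f_def[abs_def] by blast
  qed
qed

text \<open>
  For \<open>D = q\<close> the oscillation is at most a multiple of \<open>K + 1\<close>, while \<open>2 powr (K \<theta>)\<close> is integrable. Hence even the exponential
  with the full power \<open>\<beta> = 1\<close> is integrable, and powers \<open>\<beta> \<le> 1\<close> follow from \<open>x powr \<beta> \<le> 1 + x\<close>.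
\<close>

lemma exponential_integrability:
  fixes p q L \<gamma> :: real
  assumes p: "1 < p" and q: "q = real CARD('n) + p"
  shows "\<exists>c>0. (\<forall>N \<nu> (\<Omega>::(real^'n) set) T A F u Du lam \<rho> x0 t0 \<beta>.
          0 < \<beta> \<and> \<beta> \<le> 1 \<and> intrinsic_setting p q L \<gamma> N \<nu> \<Omega> T A F u Du lam \<rho> x0 t0 \<longrightarrow>
          (let Q = cylinder p lam \<rho> x0 t0 in
             integrable (lebesgue_on Q)
               (\<lambda>z. exp ((oscillation N u Q z / (c * \<rho> * data_mean q N Du F Q)) powr \<beta>)) \<and>
             average Q
               (\<lambda>z. exp ((oscillation N u Q z / (c * \<rho> * data_mean q N Du F Q)) powr \<beta>)) \<le> c))"
proof -
  define n where "n = real CARD('n)"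
  have n: "1 \<le> n" by (simp add: n_def Suc_leI)
  have q1: "1 \<le> q" "p - 1 \<le> q" using q n p by (auto simp: n_def)
  have pos: "0 < 2 * q + n * (p - 2)"
  proof -
    have "2 * q + n * (p - 2) = n * p + 2 * p" using q by (simp add: n_def algebra_simps)
    then show ?thesis using p n by (simp add: add_pos_pos)
  qed
  define \<alpha> where "\<alpha> = (2 * q + n * (p - 2)) / (q - p + 2)"
  define D where "D = n + \<alpha>"
  note E = scaling_exponents[OF p q1 n pos \<alpha>_def D_def]
  have \<mu>: "D / q - 1 = 0" unfolding E(4) using q by (simp add: n_def)
  define \<theta> where "\<theta> = D / 2"
  have \<theta>: "0 < \<theta>" "\<theta> < D" "D / q - 1 \<le> \<theta>" using E(3) \<mu> by (auto simp: \<theta>_def)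
  from master_estimate[OF p q1 E(1) D_def[unfolded n_def] E(2) \<theta>, of L \<gamma>]
  obtain C where C: "0 < C" and main: "\<forall>N \<nu> (\<Omega>::(real^'n) set) T A F u Du lam \<rho> x0 t0.
    intrinsic_setting p q L \<gamma> N \<nu> \<Omega> T A F u Du lam \<rho> x0 t0 \<longrightarrow>
    0 < \<rho> \<and> 0 < data_mean q N Du F (cylinder p lam \<rho> x0 t0) \<and>
    oscillation N u (cylinder p lam \<rho> x0 t0) \<in> borel_measurable (lebesgue_on (cylinder p lam \<rho> x0 t0)) \<and>
    (\<exists>Y. (\<forall>z. 0 \<le> Y z) \<and> integrable (lebesgue_on (cylinder p lam \<rho> x0 t0)) Y \<and> average (cylinder p lam \<rho> x0 t0) Y \<le> C \<and>
      (AE z in lebesgue_on (cylinder p lam \<rho> x0 t0). \<exists>K::nat.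
        oscillation N u (cylinder p lam \<rho> x0 t0) z \<le> C * (\<rho> * data_mean q N Du F (cylinder p lam \<rho> x0 t0)) *
          (\<Sum>k\<le>K. 2 powr (real k * (D / q - 1))) \<and> 2 powr (real K * \<theta>) \<le> Y z))"
    by (elim exE conjE) (rule that)
  define B where "B = exp 1 * 2 powr \<theta>"
  \<comment> \<open>The first entry makes the exponent at most \<open>(K + 1) \<theta> ln 2\<close>, up to an additive constant.\<close>
  define c where "c = max (C / (\<theta> * ln 2)) (B * C)"
  have B0: "0 \<le> B" by (simp add: B_def)
  have c: "0 < c" using C by (simp add: c_def B_def less_max_iff_disj)
  have Cc: "C \<le> \<theta> * ln 2 * c"
  proof -
    have "\<theta> * ln 2 * (C / (\<theta> * ln 2)) \<le> \<theta> * ln 2 * c" using \<theta> by (intro mult_left_mono) (auto simp: c_def)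
    then show ?thesis using \<theta> by simp
  qed
  show ?thesis
  proof (intro exI[of _ c] conjI[of "0 < c"] allI impI c)
    fix N \<nu> and \<Omega> :: "(real^'n) set" and T A F u Du lam \<rho> x0 t0 and \<beta> :: real
    assume *: "0 < \<beta> \<and> \<beta> \<le> 1 \<and> intrinsic_setting p q L \<gamma> N \<nu> \<Omega> T A F u Du lam \<rho> x0 t0"
    then have \<beta>: "0 < \<beta>" "\<beta> \<le> 1" and set: "intrinsic_setting p q L \<gamma> N \<nu> \<Omega> T A F u Du lam \<rho> x0 t0" by blast+
    note M = main[rule_format, OF set]
    define Q where "Q = cylinder p lam \<rho> x0 t0"
    define dm where "dm = data_mean q N Du F Q"
    from M[folded Q_def, folded dm_def] obtain Y where \<rho>: "0 < \<rho>" and dm: "0 < dm"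
      and om: "oscillation N u Q \<in> borel_measurable (lebesgue_on Q)"
      and Y0: "\<forall>z. 0 \<le> Y z" and Y: "integrable (lebesgue_on Q) Y" "average Q Y \<le> C"
      and ae: "AE z in lebesgue_on Q. \<exists>K::nat. oscillation N u Q z \<le> C * (\<rho> * dm) * (\<Sum>k\<le>K. 2 powr (real k * (D / q - 1))) \<and> 2 powr (real K * \<theta>) \<le> Y z"
      by (elim exE conjE) (rule that)
    define f where "f z = exp ((oscillation N u Q z / (c * \<rho> * dm)) powr \<beta>)" for z
    have fm: "f \<in> borel_measurable (lebesgue_on Q)"
      unfolding f_def[abs_def] using om
      by (intro measurable_compose[OF _ borel_measurable_exp] borel_measurable_divide powr_real_measurable) auto
    have fle: "AE z in lebesgue_on Q. f z \<le> B * Y z"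
      using ae
    proof (rule AE_mp, intro AE_I2 impI)
      fix z assume "\<exists>K::nat. oscillation N u Q z \<le> C * (\<rho> * dm) * (\<Sum>k\<le>K. 2 powr (real k * (D / q - 1))) \<and> 2 powr (real K * \<theta>) \<le> Y z"
      then obtain K :: nat where K: "oscillation N u Q z \<le> C * (\<rho> * dm) * (\<Sum>k\<le>K. 2 powr (real k * (D / q - 1)))" "2 powr (real K * \<theta>) \<le> Y z" by blast
      define x where "x = oscillation N u Q z / (c * \<rho> * dm)"
      have x0: "0 \<le> x" using c \<rho> dm by (simp add: x_def oscillation_def)
      have "oscillation N u Q z \<le> C * (\<rho> * dm) * (real K + 1)" using K(1) by (simp add: \<mu> add.commute)
      also have "\<dots> = C * ((\<rho> * dm) * (real K + 1))" by simp
      also have "\<dots> \<le> (\<theta> * ln 2 * c) * ((\<rho> * dm) * (real K + 1))"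
        using \<rho> dm by (intro mult_right_mono Cc) auto
      finally have "oscillation N u Q z \<le> (\<theta> * ln 2 * (real K + 1)) * (c * \<rho> * dm)" by (simp only: mult_ac)
      then have x: "x \<le> \<theta> * ln 2 * (real K + 1)"
        unfolding x_def using c \<rho> dm by (simp add: pos_divide_le_eq)
      have "x powr \<beta> \<le> 1 + x"
      proof (cases "x \<le> 1")
        case True
        then show ?thesis using powr_mono2[of \<beta> x 1] x0 \<beta> by simp
      next
        case False
        then have "x powr \<beta> \<le> x powr 1" using \<beta> by (intro powr_mono) auto
        then show ?thesis using False by simp
      qed
      then have "f z \<le> exp (1 + (\<theta> + real K * \<theta>) * ln 2)"
        unfolding f_def x_def[symmetric] using x by (simp add: algebra_simps)
      also have "\<dots> = exp 1 * 2 powr (\<theta> + real K * \<theta>)"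
        by (simp add: powr_def exp_add)
      also have "\<dots> = B * 2 powr (real K * \<theta>)"
        by (simp add: B_def powr_add)
      also have "\<dots> \<le> B * Y z" using K(2) B0 by (intro mult_left_mono) auto
      finally show "f z \<le> B * Y z" .
    qed
    have f0: "0 \<le> f z" for z by (simp add: f_def)
    note av = average_le[OF fm f0 fle Y(1) B0 Y(2)]
    have "average Q f \<le> c" using av(2) by (simp add: c_def)
    then show "let Q = cylinder p lam \<rho> x0 t0 in
             integrable (lebesgue_on Q)
               (\<lambda>z. exp ((oscillation N u Q z / (c * \<rho> * data_mean q N Du F Q)) powr \<beta>)) \<and>
             average Q
               (\<lambda>z. exp ((oscillation N u Q z / (c * \<rho> * data_mean q N Du F Q)) powr \<beta>)) \<le> c"
      using av(1) unfolding Let_def Q_def[symmetric] dm_def[symmetric] f_def[abs_def] by blast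
  qed
qed

text \<open>
  For \<open>D / q < 1\<close> the sum over \<open>k \<le> K\<close> is bounded by a convergent geometric series, whatever \<open>K\<close> is.
\<close>

lemma boundedness:
  fixes p q L \<gamma> :: real
  assumes p: "1 < p" and q: "real CARD('n) + p < q"
  shows "\<exists>c>0. (\<forall>N \<nu> (\<Omega>::(real^'n) set) T A F u Du lam \<rho> x0 t0.
          intrinsic_setting p q L \<gamma> N \<nu> \<Omega> T A F u Du lam \<rho> x0 t0 \<longrightarrow>
          (let Q = cylinder p lam \<rho> x0 t0 in
             esssup (lebesgue_on Q) (\<lambda>z. ereal (oscillation N u Q z / \<rho>))
               \<le> ereal (c * data_mean q N Du F Q)))"
proof -
  define n where "n = real CARD('n)"
  have n: "1 \<le> n" by (simp add: n_def Suc_leI)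
  have q1: "1 \<le> q" "p - 1 \<le> q" using q n p by (auto simp: n_def)
  have pos: "0 < 2 * q + n * (p - 2)"
  proof -
    have "0 \<le> n * p" using p n by simp
    moreover have "2 * q + n * (p - 2) = 2 * q + n * p - 2 * n" by (simp add: algebra_simps)
    ultimately show ?thesis using q p unfolding n_def by linarith
  qed
  define \<alpha> where "\<alpha> = (2 * q + n * (p - 2)) / (q - p + 2)"
  define D where "D = n + \<alpha>"
  note E = scaling_exponents[OF p q1 n pos \<alpha>_def D_def]
  have \<mu>: "D / q - 1 < 0" unfolding E(4) using q q1 by (simp add: n_def divide_neg_pos)
  define \<theta> where "\<theta> = D / 2"
  have \<theta>: "0 < \<theta>" "\<theta> < D" "D / q - 1 \<le> \<theta>" unfolding \<theta>_def using E(3) \<mu> by linarith+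
  from master_estimate[OF p q1 E(1) D_def[unfolded n_def] E(2) \<theta>, of L \<gamma>]
  obtain C where C: "0 < C" and main: "\<forall>N \<nu> (\<Omega>::(real^'n) set) T A F u Du lam \<rho> x0 t0.
    intrinsic_setting p q L \<gamma> N \<nu> \<Omega> T A F u Du lam \<rho> x0 t0 \<longrightarrow>
    0 < \<rho> \<and> 0 < data_mean q N Du F (cylinder p lam \<rho> x0 t0) \<and>
    oscillation N u (cylinder p lam \<rho> x0 t0) \<in> borel_measurable (lebesgue_on (cylinder p lam \<rho> x0 t0)) \<and>
    (\<exists>Y. (\<forall>z. 0 \<le> Y z) \<and> integrable (lebesgue_on (cylinder p lam \<rho> x0 t0)) Y \<and> average (cylinder p lam \<rho> x0 t0) Y \<le> C \<and>
      (AE z in lebesgue_on (cylinder p lam \<rho> x0 t0). \<exists>K::nat.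
        oscillation N u (cylinder p lam \<rho> x0 t0) z \<le> C * (\<rho> * data_mean q N Du F (cylinder p lam \<rho> x0 t0)) *
          (\<Sum>k\<le>K. 2 powr (real k * (D / q - 1))) \<and> 2 powr (real K * \<theta>) \<le> Y z))"
    by (elim exE conjE) (rule that)
  define x where "x = 2 powr (D / q - 1)"
  have x: "0 < x" "x < 1" using \<mu> by (auto simp: x_def powr_less_one)
  have sum: "(\<Sum>k\<le>K. 2 powr (real k * (D / q - 1))) \<le> 1 / (1 - x)" for K :: nat
  proof -
    have "(2::real) powr (real k * (D / q - 1)) = x ^ k" for k
      unfolding x_def by (subst powr_realpow[symmetric]) (simp_all only: powr_powr mult.commute, simp)
    then have "(\<Sum>k\<le>K. 2 powr (real k * (D / q - 1))) = (\<Sum>k\<le>K. x ^ k)" by simp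
    also have "\<dots> \<le> (\<Sum>k. x ^ k)" using x by (intro sum_le_suminf summable_geometric) auto
    also have "\<dots> = 1 / (1 - x)" using x by (intro suminf_geometric) simp
    finally show ?thesis .
  qed
  define c where "c = C / (1 - x)"
  show ?thesis
  proof (intro exI[of _ c] conjI[of "0 < c"] allI impI)
    show "0 < c" using C x by (simp add: c_def)
    fix N \<nu> and \<Omega> :: "(real^'n) set" and T A F u Du lam \<rho> x0 t0
    assume "intrinsic_setting p q L \<gamma> N \<nu> \<Omega> T A F u Du lam \<rho> x0 t0"
    note M = main[rule_format, OF this]
    define Q where "Q = cylinder p lam \<rho> x0 t0"
    define dm where "dm = data_mean q N Du F Q"
    from M[folded Q_def, folded dm_def] obtain Y where \<rho>: "0 < \<rho>" and dm: "0 < dm"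
      and om: "oscillation N u Q \<in> borel_measurable (lebesgue_on Q)"
      and ae: "AE z in lebesgue_on Q. \<exists>K::nat. oscillation N u Q z \<le> C * (\<rho> * dm) * (\<Sum>k\<le>K. 2 powr (real k * (D / q - 1))) \<and> 2 powr (real K * \<theta>) \<le> Y z"
      by (elim exE conjE) (rule that)
    have "esssup (lebesgue_on Q) (\<lambda>z. ereal (oscillation N u Q z / \<rho>)) \<le> ereal (c * dm)"
    proof (rule esssup_I)
      show "(\<lambda>z. ereal (oscillation N u Q z / \<rho>)) \<in> borel_measurable (lebesgue_on Q)"
        using om by (intro borel_measurable_ereal borel_measurable_divide) auto
      show "AE z in lebesgue_on Q. ereal (oscillation N u Q z / \<rho>) \<le> ereal (c * dm)"
        using ae
      proof (rule AE_mp, intro AE_I2 impI)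
        fix z assume "\<exists>K::nat. oscillation N u Q z \<le> C * (\<rho> * dm) * (\<Sum>k\<le>K. 2 powr (real k * (D / q - 1))) \<and> 2 powr (real K * \<theta>) \<le> Y z"
        then obtain K :: nat where "oscillation N u Q z \<le> C * (\<rho> * dm) * (\<Sum>k\<le>K. 2 powr (real k * (D / q - 1)))" by blast
        also have "\<dots> \<le> C * (\<rho> * dm) * (1 / (1 - x))" using C \<rho> dm by (intro mult_left_mono sum) auto
        also have "\<dots> = c * dm * \<rho>" by (simp add: c_def)
        finally show "ereal (oscillation N u Q z / \<rho>) \<le> ereal (c * dm)" using \<rho> by (simp add: pos_divide_le_eq)
      qed
    qed
    then show "let Q = cylinder p lam \<rho> x0 t0 in
             esssup (lebesgue_on Q) (\<lambda>z. ereal (oscillation N u Q z / \<rho>))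
               \<le> ereal (c * data_mean q N Du F Q)"
      unfolding Let_def Q_def dm_def .
  qed
qed

theorem theorem7p2:
  fixes p q :: real
  assumes "1 < p" and "max 1 (p - 1) \<le> q"
  shows
    "(\<forall>qs L \<gamma>.
        ((2 < p \<and> p - 1 \<le> q \<and> q < real CARD('n) + p) \<or>
         (p < 2 \<and> max 1 ((2 - p) * real CARD('n) / 2) < q \<and> q < real CARD('n) + p)) \<and>
        q \<le> qs \<and> qs < q * (real CARD('n) + 2) / (real CARD('n) + p - q) \<longrightarrow>
        (\<exists>c>0. (\<forall>N \<nu> (\<Omega>::(real^'n) set) T A F u Du lam \<rho> x0 t0.
          intrinsic_setting p q L \<gamma> N \<nu> \<Omega> T A F u Du lam \<rho> x0 t0 \<longrightarrow>
          (let Q = cylinder p lam \<rho> x0 t0 in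
             integrable (lebesgue_on Q) (\<lambda>z. oscillation N u Q z powr qs / \<rho> powr qs) \<and>
             average Q (\<lambda>z. oscillation N u Q z powr qs / \<rho> powr qs) powr (1 / qs)
               \<le> c * data_mean q N Du F Q)))) \<and>
     (\<forall>L \<gamma>. 2 < p \<and> q = real CARD('n) + p \<longrightarrow>
        (\<exists>c>0. (\<forall>N \<nu> (\<Omega>::(real^'n) set) T A F u Du lam \<rho> x0 t0.
          intrinsic_setting p q L \<gamma> N \<nu> \<Omega> T A F u Du lam \<rho> x0 t0 \<longrightarrow>
          (let Q = cylinder p lam \<rho> x0 t0 in
             integrable (lebesgue_on Q)
               (\<lambda>z. exp ((oscillation N u Q z / (c * \<rho> * data_mean q N Du F Q)) powr ((real CARD('n) + 2) / (real CARD('n) + p)))) \<and>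
             average Q
               (\<lambda>z. exp ((oscillation N u Q z / (c * \<rho> * data_mean q N Du F Q)) powr ((real CARD('n) + 2) / (real CARD('n) + p)))) \<le> c)))) \<and>
     (\<forall>L \<gamma>. p < 2 \<and> q = real CARD('n) + p \<longrightarrow>
        (\<exists>c>0. (\<forall>N \<nu> (\<Omega>::(real^'n) set) T A F u Du lam \<rho> x0 t0.
          intrinsic_setting p q L \<gamma> N \<nu> \<Omega> T A F u Du lam \<rho> x0 t0 \<longrightarrow>
          (let Q = cylinder p lam \<rho> x0 t0 in
             integrable (lebesgue_on Q)
               (\<lambda>z. exp (oscillation N u Q z / (c * \<rho> * data_mean q N Du F Q))) \<and>
             average Q
               (\<lambda>z. exp (oscillation N u Q z / (c * \<rho> * data_mean q N Du F Q))) \<le> c)))) \<and>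
     (\<forall>L \<gamma>. real CARD('n) + p < q \<longrightarrow>
        (\<exists>c>0. (\<forall>N \<nu> (\<Omega>::(real^'n) set) T A F u Du lam \<rho> x0 t0.
          intrinsic_setting p q L \<gamma> N \<nu> \<Omega> T A F u Du lam \<rho> x0 t0 \<longrightarrow>
          (let Q = cylinder p lam \<rho> x0 t0 in
             esssup (lebesgue_on Q) (\<lambda>z. ereal (oscillation N u Q z / \<rho>))
               \<le> ereal (c * data_mean q N Du F Q)))))"
proof (intro conjI allI impI)
  have q: "1 \<le> q" "p - 1 \<le> q" using assms(2) by auto
  fix qs L \<gamma> :: real
  assume *: "((2 < p \<and> p - 1 \<le> q \<and> q < real CARD('n) + p) \<or>
         (p < 2 \<and> max 1 ((2 - p) * real CARD('n) / 2) < q \<and> q < real CARD('n) + p)) \<and>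
        q \<le> qs \<and> qs < q * (real CARD('n) + 2) / (real CARD('n) + p - q)"
  have "0 < 2 * q + real CARD('n) * (p - 2)"
  proof (cases "2 < p")
    case True
    then have "0 \<le> real CARD('n) * (p - 2)" by simp
    then show ?thesis using q by linarith
  next
    case False
    then have "(2 - p) * real CARD('n) / 2 < q" using * by auto
    then show ?thesis by (simp add: algebra_simps)
  qed
  then show "\<exists>c>0. (\<forall>N \<nu> (\<Omega>::(real^'n) set) T A F u Du lam \<rho> x0 t0.
          intrinsic_setting p q L \<gamma> N \<nu> \<Omega> T A F u Du lam \<rho> x0 t0 \<longrightarrow>
          (let Q = cylinder p lam \<rho> x0 t0 in
             integrable (lebesgue_on Q) (\<lambda>z. oscillation N u Q z powr qs / \<rho> powr qs) \<and>
             average Q (\<lambda>z. oscillation N u Q z powr qs / \<rho> powr qs) powr (1 / qs)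
               \<le> c * data_mean q N Du F Q))"
    using * by (intro higher_integrability[OF assms(1) q]) auto
next
  fix L \<gamma> :: real
  assume *: "2 < p \<and> q = real CARD('n) + p"
  then have "q = real CARD('n) + p" by blast
  from exponential_integrability[OF assms(1) this, of L \<gamma>] obtain c where c: "0 < c"
    and main: "\<forall>N \<nu> (\<Omega>::(real^'n) set) T A F u Du lam \<rho> x0 t0 \<beta>.
          0 < \<beta> \<and> \<beta> \<le> 1 \<and> intrinsic_setting p q L \<gamma> N \<nu> \<Omega> T A F u Du lam \<rho> x0 t0 \<longrightarrow>
          (let Q = cylinder p lam \<rho> x0 t0 in
             integrable (lebesgue_on Q)
               (\<lambda>z. exp ((oscillation N u Q z / (c * \<rho> * data_mean q N Du F Q)) powr \<beta>)) \<and>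
             average Q
               (\<lambda>z. exp ((oscillation N u Q z / (c * \<rho> * data_mean q N Du F Q)) powr \<beta>)) \<le> c)"
    by (elim exE conjE) (rule that)
  have "0 < (real CARD('n) + 2) / (real CARD('n) + p)" "(real CARD('n) + 2) / (real CARD('n) + p) \<le> 1"
    using * by (auto simp: divide_le_eq_1 add_pos_pos intro!: divide_pos_pos)
  then show "\<exists>c>0. (\<forall>N \<nu> (\<Omega>::(real^'n) set) T A F u Du lam \<rho> x0 t0.
          intrinsic_setting p q L \<gamma> N \<nu> \<Omega> T A F u Du lam \<rho> x0 t0 \<longrightarrow>
          (let Q = cylinder p lam \<rho> x0 t0 in
             integrable (lebesgue_on Q)
               (\<lambda>z. exp ((oscillation N u Q z / (c * \<rho> * data_mean q N Du F Q)) powr ((real CARD('n) + 2) / (real CARD('n) + p)))) \<and>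
             average Q
               (\<lambda>z. exp ((oscillation N u Q z / (c * \<rho> * data_mean q N Du F Q)) powr ((real CARD('n) + 2) / (real CARD('n) + p)))) \<le> c))"
    by (intro exI[of _ c] conjI c allI impI main[rule_format])
next
  fix L \<gamma> :: real
  assume "p < 2 \<and> q = real CARD('n) + p"
  then have "q = real CARD('n) + p" by blast
  from exponential_integrability[OF assms(1) this, of L \<gamma>] obtain c where c: "0 < c"
    and main: "\<forall>N \<nu> (\<Omega>::(real^'n) set) T A F u Du lam \<rho> x0 t0 \<beta>.
          0 < \<beta> \<and> \<beta> \<le> 1 \<and> intrinsic_setting p q L \<gamma> N \<nu> \<Omega> T A F u Du lam \<rho> x0 t0 \<longrightarrow>
          (let Q = cylinder p lam \<rho> x0 t0 in
             integrable (lebesgue_on Q)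
               (\<lambda>z. exp ((oscillation N u Q z / (c * \<rho> * data_mean q N Du F Q)) powr \<beta>)) \<and>
             average Q
               (\<lambda>z. exp ((oscillation N u Q z / (c * \<rho> * data_mean q N Du F Q)) powr \<beta>)) \<le> c)"
    by (elim exE conjE) (rule that)
  show "\<exists>c>0. (\<forall>N \<nu> (\<Omega>::(real^'n) set) T A F u Du lam \<rho> x0 t0.
          intrinsic_setting p q L \<gamma> N \<nu> \<Omega> T A F u Du lam \<rho> x0 t0 \<longrightarrow>
          (let Q = cylinder p lam \<rho> x0 t0 in
             integrable (lebesgue_on Q)
               (\<lambda>z. exp (oscillation N u Q z / (c * \<rho> * data_mean q N Du F Q))) \<and>
             average Q
               (\<lambda>z. exp (oscillation N u Q z / (c * \<rho> * data_mean q N Du F Q))) \<le> c))"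
  proof (intro exI[of _ c] conjI[of "0 < c"] c allI impI)
    fix N \<nu> and \<Omega> :: "(real^'n) set" and T A F u Du lam \<rho> x0 t0
    assume set: "intrinsic_setting p q L \<gamma> N \<nu> \<Omega> T A F u Du lam \<rho> x0 t0"
    interpret intrinsic_solution p q L \<gamma> N \<nu> \<Omega> T A F u Du lam \<rho> x0 t0
      by unfold_locales (use assms set in auto)
    have "0 \<le> data_mean q N Du F Q" by (simp add: data_mean_def)
    then have "(oscillation N u Q z / (c * \<rho> * data_mean q N Du F Q)) powr 1
        = oscillation N u Q z / (c * \<rho> * data_mean q N Du F Q)" for z
      using c basic by (intro powr_one) (simp add: oscillation_def)
    moreover have "0 < (1::real) \<and> (1::real) \<le> 1 \<and> intrinsic_setting p q L \<gamma> N \<nu> \<Omega> T A F u Du lam \<rho> x0 t0"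
      using set by simp
    note main[rule_format, OF this]
    ultimately show "let Q = cylinder p lam \<rho> x0 t0 in
             integrable (lebesgue_on Q)
               (\<lambda>z. exp (oscillation N u Q z / (c * \<rho> * data_mean q N Du F Q))) \<and>
             average Q
               (\<lambda>z. exp (oscillation N u Q z / (c * \<rho> * data_mean q N Du F Q))) \<le> c"
      unfolding Let_def by simp
  qed
next
  fix L \<gamma> :: real
  assume "real CARD('n) + p < q"
  then show "\<exists>c>0. (\<forall>N \<nu> (\<Omega>::(real^'n) set) T A F u Du lam \<rho> x0 t0.
          intrinsic_setting p q L \<gamma> N \<nu> \<Omega> T A F u Du lam \<rho> x0 t0 \<longrightarrow>
          (let Q = cylinder p lam \<rho> x0 t0 in
             esssup (lebesgue_on Q) (\<lambda>z. ereal (oscillation N u Q z / \<rho>))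
               \<le> ereal (c * data_mean q N Du F Q)))"
    by (rule boundedness[OF assms(1)])
qed


end
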